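(* Let $n\ge1$, $1<p\le q<\infty$ and $0<\alpha<n$ be such that $\Theta(\alpha):=\alpha+n\left(\frac1q-\frac1p\right)>0$. Let $u,v$ be nonnegative measurable functions on $\mathbb{R}^n$ with $u\in A_\infty(\mathbb{R}^n)$ and $v^{-p'/p}\in A_\infty(\mathbb{R}^n)$, where $\frac1p+\frac1{p'}=1$. Put $$[(u,v)]_{A^\alpha_{p,q}}:=\sup_Q|Q|^{\Theta(\alpha)/n}\left(\frac1{|Q|}\int_Q u\right)^{1/q}\left(\frac1{|Q|}\int_Q v^{-p'/p}\right)^{1/p'}.$$ (1) If $u^{1/q}/v^{1/p}\in L^{n/\Theta(\alpha),\infty}(\mathbb{R}^n)$, then $[(u,v)]_{A^\alpha_{p,q}}<\infty$, with $$[(u,v)]_{A^\alpha_{p,q}}\le C_2\,\|u^{1/q}/v^{1/p}\|_{L^{n/\Theta(\alpha),\infty}(\mathbb{R}^n)},$$ where $C_2>0$ depends only on $n,\alpha,p,q,[u]_{A_\infty},[v^{-p'/p}]_{A_\infty}$. In particular, $$\left(\int_{\mathbb{R}^n}|I_\alpha(f)(x)|^q u(x)\,dx\right)^{1/q}\le C_2\,\|u^{1/q}/v^{1/p}\|_{L^{n/\Theta(\alpha),\infty}(\mathbb{R}^n)}\left(\int_{\mathbb{R}^n}|f(x)|^p v(x)\,dx\right)^{1/p}$$ for every measurable $f$. (2) If, in addition, $u^{1/q}/v^{1/p}\in A_\infty(\mathbb{R}^n)$, then $[(u,v)]_{A^\alpha_{p,q}}<\infty$ is equivalent to $\mathcal{M}_{\Theta(\alpha)}(u^{1/q}/v^{1/p})\in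 L^\infty(\mathbb{R}^n)$, with the estimates $$\theta\,\|\mathcal{M}_{\Theta(\alpha)}(u^{1/q}/v^{1/p})\|_{L^\infty(\mathbb{R}^n)}\le[(u,v)]_{A^\alpha_{p,q}}\le\theta^{-1}\|\mathcal{M}_{\Theta(\alpha)}(u^{1/q}/v^{1/p})\|_{L^\infty(\mathbb{R}^n)},$$ where $\theta\in(0,1)$ depends only on $n,\alpha,p,[u]_{A_\infty},[v^{-p'/p}]_{A_\infty}$ and $[u^{1/q}/v^{1/p}]_{A_\infty}$. (In (2), "in addition" is relative to the standing hypotheses $u,v^{-p'/p}\in A_\infty(\mathbb{R}^n)$; the weak-type hypothesis of (1) is not assumed.)
   Context: $Q$ always denotes a cube in $\mathbb{R}^n$ with sides parallel to the coordinate axes, and suprema over $Q$ are over all such cubes. For $0<\beta<n$: $\mathcal{M}_\beta(f)(x)=\sup_{Q\ni x}|Q|^{\beta/n}\frac1{|Q|}\int_Q|f|$ and $I_\beta(f)(x)=\int_{\mathbb{R}^n}\frac{f(y)}{|x-y|^{n-\beta}}\,dy$. (Note $0<\Theta(\alpha)\le\alpha<n$.) A weight is a function $w\in L^1_{\rm loc}(\mathbb{R}^n)$ with $w\ge0$ a.e.; $w\in A_\infty(\mathbb{R}^n)$ means $[w]_{A_\infty}:=\sup_Q\left(\frac1{|Q|}\int_Q w\right)\exp\left(-\frac1{|Q|}\int_Q\ln w\right)<\infty$. $L^{s,\infty}(\mathbb{R}^n)$ is weak $L^s$, with $\|h\|_{L^{s,\infty}}=\sup_{\lambda>0}\lambda\,|\{x:|h(x)|>\lambda\}|^{1/s}$.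 The weighted inequality is understood as trivially true when its right-hand side is infinite. *)

theory Defs
  imports "HOL-Analysis.Analysis" "HOL-Probability.Essential_Supremum"
begin

text \<open>
  Points of Euclidean \<open>n\<close>-space are elements of \<open>real ^ 'n\<close> with \<open>n = CARD('n)\<close>. "Measurable"
  means Lebesgue measurable. Quantities in the interval from 0 to \<open>\<infinity>\<close> are of type
  \<open>ennreal\<close>, with the usual convention \<open>0 * \<infinity> = 0\<close>.
\<close>

text \<open>The power \<open>x\<^sup>a\<close> for \<open>x\<close> between 0 and \<open>\<infinity>\<close>; in particular it is \<open>\<infinity>\<close> for \<open>x = 0\<close>, \<open>a < 0\<close>
  (unlike \<open>(powr)\<close>, which gives 0).\<close>

definition epowr :: "ennreal \<Rightarrow> real \<Rightarrow> ennreal" where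
  "epowr x a =
    (if a = 0 then 1
     else if x = 0 then (if a < 0 then \<infinity> else 0)
     else if x = \<infinity> then (if a < 0 then 0 else \<infinity>)
     else ennreal (enn2real x powr a))"

definition eln :: "ennreal \<Rightarrow> ereal" where
  "eln x = (if x = 0 then -\<infinity> else if x = \<infinity> then \<infinity> else ereal (ln (enn2real x)))"

definition eexp :: "ereal \<Rightarrow> ennreal" where
  "eexp x = (if x = \<infinity> then \<infinity> else if x = -\<infinity> then 0 else ennreal (exp (real_of_ereal x)))"

text \<open>The Lebesgue integral over \<open>A\<close> of an extended real function, positive part minus negative
  part (\<open>e2ennreal\<close> truncates negative values to 0). If both parts are infinite, the value is
  \<open>\<infinity> - \<infinity> = \<infinity>\<close> in \<open>ereal\<close>.\<close>

definition eintegral :: "(real ^ 'n) set \<Rightarrow> (real ^ 'n \<Rightarrow> ereal) \<Rightarrow> ereal" where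
  "eintegral A f =
     enn2ereal (\<integral>\<^sup>+x\<in>A. e2ennreal (f x) \<partial>lebesgue) - enn2ereal (\<integral>\<^sup>+x\<in>A. e2ennreal (- f x) \<partial>lebesgue)"

definition cubes :: "(real ^ 'n) set set" where
  "cubes = {cbox a (a + (\<chi> i. r)) |a r. r > 0}"

definition avg :: "(real ^ 'n) set \<Rightarrow> (real ^ 'n \<Rightarrow> ennreal) \<Rightarrow> ennreal" where
  "avg Q w = (\<integral>\<^sup>+x\<in>Q. w x \<partial>lebesgue) / emeasure lebesgue Q"

definition loc_integrable :: "(real ^ 'n \<Rightarrow> ennreal) \<Rightarrow> bool" where
  "loc_integrable w \<longleftrightarrow> w \<in> borel_measurable lebesgue \<and>
     (\<forall>K. compact K \<longrightarrow> (\<integral>\<^sup>+x\<in>K. w x \<partial>lebesgue) < \<infinity>)"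

text \<open>For locally integrable \<open>w\<close> the positive part of \<open>ln w\<close> is integrable on each cube, so the
  inner integral is a well-defined element of \<open>[-\<infinity>, \<infinity>)\<close>, and it is \<open>-\<infinity>\<close> if \<open>w\<close> vanishes on
  a subset of \<open>Q\<close> of positive measure. By the convention \<open>0 * \<infinity> = 0\<close> the zero weight has
  constant 0; any other \<open>w\<close> with finite constant is positive almost everywhere.\<close>

definition Ainf_const :: "(real ^ 'n \<Rightarrow> ennreal) \<Rightarrow> ennreal" where
  "Ainf_const w =
     (SUP Q\<in>cubes. avg Q w * eexp (- (eintegral Q (\<lambda>x. eln (w x)) / ereal (measure lebesgue Q))))"

definition Ainf :: "(real ^ 'n \<Rightarrow> ennreal) set" where
  "Ainf = {w. loc_integrable w \<and> Ainf_const w < \<infinity>}"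

definition weak_norm :: "real \<Rightarrow> (real ^ 'n \<Rightarrow> ennreal) \<Rightarrow> ennreal" where
  "weak_norm s h =
     (SUP l\<in>{0<..}. ennreal l * epowr (emeasure lebesgue {x. h x > ennreal l}) (1 / s))"

definition weak_L :: "real \<Rightarrow> (real ^ 'n \<Rightarrow> ennreal) set" where
  "weak_L s = {h \<in> borel_measurable lebesgue. weak_norm s h < \<infinity>}"

definition L_infinity :: "(real ^ 'n \<Rightarrow> ennreal) set" where
  "L_infinity = {h \<in> borel_measurable lebesgue. esssup lebesgue h < \<infinity>}"

definition maximal :: "real \<Rightarrow> (real ^ 'n \<Rightarrow> ennreal) \<Rightarrow> real ^ 'n \<Rightarrow> ennreal" where
  "maximal \<beta> f x =
     (SUP Q\<in>{Q \<in> cubes. x \<in> Q}. epowr (emeasure lebesgue Q) (\<beta> / real CARD('n)) * avg Q f)"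

text \<open>At points where the defining integral is \<open>\<infinity> - \<infinity>\<close> the value is \<open>\<infinity>\<close>, so finiteness of the
  integral of \<open>\<bar>riesz \<beta> f\<bar>\<^sup>q u\<close> includes that \<open>riesz \<beta> f\<close> is well defined where \<open>u > 0\<close>, up to
  a null set. The kernel takes the value 0 at \<open>y = x\<close>, a null set.\<close>

definition riesz :: "real \<Rightarrow> (real ^ 'n \<Rightarrow> real) \<Rightarrow> real ^ 'n \<Rightarrow> ereal" where
  "riesz \<beta> f x = eintegral UNIV (\<lambda>y. ereal (f y / norm (x - y) powr (real CARD('n) - \<beta>)))"

definition Theta :: "nat \<Rightarrow> real \<Rightarrow> real \<Rightarrow> real \<Rightarrow> real" where
  "Theta n \<alpha> p q = \<alpha> + real n * (1 / q - 1 / p)"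

text \<open>The exponent \<open>p'\<close> with \<open>1 / p + 1 / p' = 1\<close>.\<close>

definition conj_exp :: "real \<Rightarrow> real" where
  "conj_exp p = p / (p - 1)"

lemma conj_exp_iff: "p > 1 \<Longrightarrow> 1 / p + 1 / r = 1 \<longleftrightarrow> r = conj_exp p"
  by (cases "r = 0") (auto simp: conj_exp_def field_simps)

text \<open>The functions \<open>v\<^bsup>- p' / p\<^esup>\<close> and \<open>u\<^bsup>1 / q\<^esup> / v\<^bsup>1 / p\<^esup>\<close>. They are \<open>ennreal\<close>-valued because \<open>v\<close> may
  have zeros, where the former is \<open>\<infinity>\<close>.\<close>

definition dual_weight :: "real \<Rightarrow> (real ^ 'n \<Rightarrow> real) \<Rightarrow> real ^ 'n \<Rightarrow> ennreal" where
  "dual_weight p v x = epowr (ennreal (v x)) (- conj_exp p / p)"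

definition weight_ratio ::
  "real \<Rightarrow> real \<Rightarrow> (real ^ 'n \<Rightarrow> real) \<Rightarrow> (real ^ 'n \<Rightarrow> real) \<Rightarrow> real ^ 'n \<Rightarrow> ennreal" where
  "weight_ratio p q u v x = epowr (ennreal (u x)) (1 / q) / epowr (ennreal (v x)) (1 / p)"

definition A_const ::
  "real \<Rightarrow> real \<Rightarrow> real \<Rightarrow> (real ^ 'n \<Rightarrow> real) \<Rightarrow> (real ^ 'n \<Rightarrow> real) \<Rightarrow> ennreal" where
  "A_const \<alpha> p q u v =
     (SUP Q\<in>cubes. epowr (emeasure lebesgue Q) (Theta CARD('n) \<alpha> p q / real CARD('n))
        * epowr (avg Q (\<lambda>x. ennreal (u x))) (1 / q)
        * epowr (avg Q (dual_weight p v)) (1 / conj_exp p))"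

end

theory Submission
  imports Defs
begin

text \<open>
  Write \<open>\<sigma>\<close> for the dual weight, so that the weight ratio is \<open>w = u\<^bsup>1/q\<^esup> \<sigma>\<^bsup>1/p'\<^esup>\<close>. By Chebyshev's inequality for
  \<open>ln\<close>, a weight of class A-infinity is at least \<open>\<gamma>\<close> times its average on all of a cube except for an
  arbitrarily small fraction. Hence on at least half of each cube \<open>w\<close> exceeds a multiple of the product of
  averages in the definition of \<^const>\<open>A_const\<close>, which gives the weak-type bound; comparing three such
  weights at a common good point gives part (2).

  For the norm inequality, the Riesz kernel is dominated by the sum of
  \<open>\<bar>Q\<bar>\<^bsup>\<alpha>/n-1\<^esup> 1\<^sub>Q(y) 1\<^bsub>3Q\<^esub>(x)\<close> over all dyadic cubes. By duality it suffices to bound the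
  bilinear form. Stopping at cubes where the average of the first function doubles, and summing a geometric
  series inside each stopping cube (here \<open>\<alpha> > 0\<close> enters), leaves a sparse family, whose members have pairwise
  disjoint large subsets. There \<^const>\<open>A_const\<close> and Hoelder's inequality (using \<open>p \<le> q\<close>) separate the two
  functions, and each factor is a Carleson sum, controlled by a Vitali covering argument, because
  weights of class A-infinity are doubling and do not lose mass on large subsets.
\<close>

section \<open>Powers of extended nonnegative reals and averages over cubes\<close>

text \<open>The kernel bound pairs a dyadic cube Q in \<open>y\<close> with its triple 3Q in
  \<open>x\<close>. Stopping needs nested dyadic cubes, whereas the Carleson sums run over triples,
  which overlap without being nested; no dyadic maximal function controls them. Hence the covering
  argument, and hence doubling from 3Q to 9Q. The disjoint subsets of a sparse family are large in
  Lebesgue measure only. Class A-infinity converts half the volume of Q into a fixed share of the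
  mass of 3Q, for \<open>u\<close> and for the dual weight alike, so one family serves both
  measures. Writing \<open>|f|\<close> as \<open>F\<close> times the dual weight makes the two sides
  symmetric: the norms become those of L^p for the dual weight and L^q' for \<open>u\<close>, and
  the two-weight condition on a triple says that the side to the power \<open>\<alpha> - n\<close>
  times the masses to the powers \<open>1 / p'\<close> and \<open>1 / q\<close> is bounded.
  Selections are made in finite families only, with bounds independent of the family. Zero masses,
  zeros of \<open>v\<close> and infinite values are absorbed by product forms and by upper bounds
  \<open>X > 0\<close> standing in for norms, so that little is ever divided by a quantity that may
  vanish.\<close>

declare emeasure_completion [simp del]

text \<open>As a simp rule, \<open>emeasure_completion\<close> would rewrite every Lebesgue measure
  to the measure of a \<open>main_part\<close>. This form is applied by hand where boxes and balls
  are measured.\<close>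

lemma emeasure_completion_sets: "S \<in> sets M \<Longrightarrow> emeasure (completion M) S = emeasure M S"
  by (simp add: emeasure_completion)

lemma epowr_0 [simp]: "a > 0 \<Longrightarrow> epowr 0 a = 0"
  by (simp add: epowr_def)

lemma epowr_top [simp]: "a > 0 \<Longrightarrow> epowr \<infinity> a = \<infinity>" "a > 0 \<Longrightarrow> epowr top a = \<infinity>"
  by (simp_all add: epowr_def)

lemma epowr_ennreal: "r \<ge> 0 \<Longrightarrow> a > 0 \<Longrightarrow> epowr (ennreal r) a = ennreal (r powr a)"
  by (auto simp: epowr_def)

lemma epowr_ennreal_pos: "r > 0 \<Longrightarrow> epowr (ennreal r) a = ennreal (r powr a)"
  by (auto simp: epowr_def)

lemma epowr_mono:
  assumes "a > 0" "x \<le> y"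
  shows "epowr x a \<le> epowr y a"
proof (cases "y = top")
  case False
  then obtain r s where "x = ennreal r" "y = ennreal s" "0 \<le> r" "r \<le> s"
    using assms(2) by (cases x; cases y) (auto simp: top_unique)
  then show ?thesis
    using assms(1) by (simp add: epowr_ennreal powr_mono2 ennreal_leI)
qed (use assms in auto)

lemma epowr_eq_0_iff: "a > 0 \<Longrightarrow> epowr x a = 0 \<longleftrightarrow> x = 0"
  by (cases x) (auto simp: epowr_ennreal)

text \<open>A positive exponent is compatible with \<open>0 * \<infinity> = 0\<close>: there both
  sides vanish, whereas for \<open>a < 0\<close> the left side would be infinite and the right side
  0.\<close>

lemma epowr_mult:
  assumes "a > 0"
  shows "epowr (x * y) a = epowr x a * epowr y a"
proof -
  consider "x = 0 \<or> y = 0" | "x = top" "y \<noteq> 0" | "y = top" "x \<noteq> 0"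
    | r s where "x = ennreal r" "y = ennreal s" "r \<ge> 0" "s \<ge> 0"
    by (cases x; cases y) auto
  then show ?thesis
  proof cases
    case 4
    then have "epowr (x * y) a = epowr (ennreal (r * s)) a"
      by (simp add: ennreal_mult)
    also have "\<dots> = ennreal (r powr a) * ennreal (s powr a)"
      using 4 assms by (simp add: epowr_ennreal powr_mult flip: ennreal_mult del: ennreal_mult)
    finally show ?thesis
      using 4 assms by (simp add: epowr_ennreal)
  qed (use assms in \<open>auto simp: ennreal_top_mult ennreal_mult_top epowr_eq_0_iff\<close>)
qed

lemma epowr_epowr: "epowr (epowr x a) b = epowr x (a * b)"
proof -
  consider "x = 0" | "x = top" | r where "x = ennreal r" "r > 0"
    by (cases x) (auto simp: less_le)
  then show ?thesis
    by cases (simp_all add: epowr_def powr_powr mult_less_0_iff zero_less_mult_iff)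
qed

lemma epowr_measurable [measurable]:
  assumes [measurable]: "f \<in> borel_measurable M"
  shows "(\<lambda>x. epowr (f x) a) \<in> borel_measurable M"
  unfolding epowr_def by measurable

text \<open>Since \<open>(- p' / p) * (1 / p') = - 1 / p\<close>, the quotient becomes a product of
  powers of the two weights. At zeros of \<open>v\<close> it reads \<open>x / 0\<close>, which in
  \<open>ennreal\<close> is infinite for \<open>x \<noteq> 0\<close> and 0 for \<open>x = 0\<close>,
  exactly like \<open>x * \<infinity>\<close>.\<close>

lemma weight_ratio_eq:
  assumes "p > 1" "q > 0" "v x \<ge> 0"
  shows "weight_ratio p q u v x = epowr (ennreal (u x)) (1 / q) * epowr (dual_weight p v x) (1 / conj_exp p)"
proof -
  have "- conj_exp p / p * (1 / conj_exp p) = - (1 / p)"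
    using assms by (simp add: conj_exp_def)
  then have *: "epowr (dual_weight p v x) (1 / conj_exp p) = epowr (ennreal (v x)) (- (1 / p))"
    unfolding dual_weight_def epowr_epowr by simp
  show ?thesis
  proof (cases "v x = 0")
    case True
    have "epowr (ennreal (u x)) (1 / q) / 0 = epowr (ennreal (u x)) (1 / q) * top"
      by (cases "epowr (ennreal (u x)) (1 / q) = 0")
         (auto simp: ennreal_mult_top ennreal_divide_zero divide_ennreal_def)
    then show ?thesis
      unfolding * unfolding weight_ratio_def using True assms by (simp add: epowr_def)
  next
    case False
    then have "v x > 0" using assms by simp
    then have "inverse (epowr (ennreal (v x)) (1 / p)) = epowr (ennreal (v x)) (- (1 / p))"
      by (simp add: epowr_ennreal_pos inverse_ennreal powr_minus)
    then show ?thesis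
      unfolding * by (simp add: weight_ratio_def divide_ennreal_def)
  qed
qed

lemma emeasure_lebesgue_cube:
  fixes a :: "real ^ 'n"
  assumes "r > 0"
  shows "emeasure lebesgue (cbox a (a + (\<chi> i. r))) = ennreal (r ^ CARD('n))"
proof -
  have "cbox a (a + (\<chi> i. r)) \<noteq> {}"
    using assms by (simp add: interval_ne_empty_cart less_imp_le)
  then have *: "measure lborel (cbox a (a + (\<chi> i. r))) = r ^ CARD('n)"
    by (subst content_cbox_cart) auto
  have "emeasure lebesgue (cbox a (a + (\<chi> i. r))) = emeasure lborel (cbox a (a + (\<chi> i. r)))"
    by (intro emeasure_completion_sets) auto
  also have "\<dots> = ennreal (measure lborel (cbox a (a + (\<chi> i. r))))"
    by (intro emeasure_eq_ennreal_measure) (simp add: emeasure_lborel_cbox_eq)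
  finally show ?thesis
    by (simp add: *)
qed

lemma cubesE:
  fixes Q :: "(real ^ 'n) set"
  assumes "Q \<in> cubes"
  obtains a r where "r > 0" "Q = cbox a (a + (\<chi> i. r))" "emeasure lebesgue Q = ennreal (r ^ CARD('n))"
    "measure lebesgue Q = r ^ CARD('n)"
proof -
  obtain a r where "r > 0" "Q = cbox a (a + (\<chi> i. r))"
    using assms by (auto simp: cubes_def)
  with emeasure_lebesgue_cube[OF this(1), of a] show ?thesis
    by (intro that[of r a]) (simp_all add: measure_def)
qed

lemma cubes_sets [measurable]: "Q \<in> cubes \<Longrightarrow> Q \<in> sets lebesgue"
  by (auto elim!: cubesE)

lemma cubes_compact: "Q \<in> cubes \<Longrightarrow> compact Q"
  by (auto elim!: cubesE)

lemma cubes_measure_pos: "Q \<in> cubes \<Longrightarrow> measure lebesgue Q > 0"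
  by (auto elim!: cubesE)

lemma cubes_emeasure: "Q \<in> cubes \<Longrightarrow> emeasure lebesgue Q = ennreal (measure lebesgue Q)"
  by (auto elim!: cubesE)

lemma loc_integrable_cube:
  "loc_integrable w \<Longrightarrow> Q \<in> cubes \<Longrightarrow> (\<integral>\<^sup>+x\<in>Q. w x \<partial>lebesgue) < \<infinity>"
  by (simp add: loc_integrable_def cubes_compact)

lemma avg_finite: "loc_integrable w \<Longrightarrow> Q \<in> cubes \<Longrightarrow> avg Q w < top"
  using loc_integrable_cube[of w Q] cubes_measure_pos[of Q]
  by (simp add: avg_def cubes_emeasure ennreal_divide_eq_top_iff less_top[symmetric])

lemma avg_mult_measure:
  assumes "Q \<in> cubes"
  shows "(\<integral>\<^sup>+x\<in>Q. w x \<partial>lebesgue) = avg Q w * emeasure lebesgue Q"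
proof -
  have "emeasure lebesgue Q \<noteq> 0" "emeasure lebesgue Q \<noteq> top"
    using cubes_measure_pos[OF assms] by (simp_all add: cubes_emeasure[OF assms])
  then show ?thesis
    unfolding avg_def divide_ennreal_def mult.assoc
    by (simp add: mult.commute[of "inverse _"] ennreal_divide_self less_top flip: divide_ennreal_def)
qed

section \<open>Level sets of weights of class A-infinity\<close>

lemma eln_measurable [measurable]:
  assumes [measurable]: "f \<in> borel_measurable M"
  shows "(\<lambda>x. eln (f x)) \<in> borel_measurable M"
  unfolding eln_def by measurable

lemma eln_ennreal: "r > 0 \<Longrightarrow> eln (ennreal r) = ereal (ln r)"
  by (simp add: eln_def)

lemma e2ennreal_eln_le: "e2ennreal (eln x) \<le> x"
proof -
  consider "x = 0" | "x = top" | r where "x = ennreal r" "r > 0"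
    by (cases x) (auto simp: less_le)
  then show ?thesis
  proof cases
    case 1
    then show ?thesis by (simp add: eln_def e2ennreal_neg)
  next
    case 3
    have "ln r \<le> r"
      using 3 ln_le_minus_one[of r] by simp
    then show ?thesis
      using 3 by (simp add: eln_ennreal ennreal.abs_eq[symmetric] e2ennreal_mono flip: ennreal_def)
  qed simp
qed

lemma e2ennreal_ereal: "e2ennreal (ereal r) = ennreal r"
  by (simp add: ennreal.abs_eq flip: ennreal_def)

text \<open>For finite positive \<open>x\<close> this is
  \<open>L * 1 \<le> ln (W / x) + x / W\<close>, with \<open>1\<close> the indicator of
  \<open>x < exp (- L) * W\<close>: on that set \<open>ln (W / x) > L\<close>, and off it
  \<open>ln (x / W) \<le> x / W\<close> keeps the right side nonnegative. Logarithms are split into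
  positive and negative parts placed so that no subtraction occurs, which allows integration in
  \<open>ennreal\<close>.\<close>

lemma ln_pointwise:
  assumes "W > 0" "L \<ge> 0"
  shows "ennreal L * of_bool (x < ennreal (exp (- L)) * ennreal W) + e2ennreal (eln x) + ennreal (- ln W)
    \<le> e2ennreal (- eln x) + ennreal (ln W) + ennreal (inverse W) * x"
proof -
  consider "x = 0" | "x = top" | r where "x = ennreal r" "r > 0"
    by (cases x) (auto simp: less_le)
  then show ?thesis
  proof cases
    case 1
    then show ?thesis by (simp add: eln_def)
  next
    case 2
    then show ?thesis using assms by (simp add: eln_def ennreal_mult_top)
  next
    case 3
    have *: "x < ennreal (exp (- L)) * ennreal W \<longleftrightarrow> r < exp (- L) * W"
      using 3 assms by (simp add: ennreal_less_iff flip: ennreal_mult)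
    have ln: "ln (r / W) = ln r - ln W"
      using 3 assms by (simp add: ln_div)
    have "L * of_bool (r < exp (- L) * W) \<le> - ln r + ln W + inverse W * r"
    proof (cases "r < exp (- L) * W")
      case True
      then have "r / W < exp (- L)"
        using assms by (simp add: field_simps)
      then have "ln (r / W) < - L"
        using 3 assms ln_less_cancel_iff[of "r / W" "exp (- L)"] by simp
      moreover have "inverse W * r > 0"
        using 3 assms by simp
      ultimately show ?thesis
        using True ln by simp
    next
      case False
      have "ln (r / W) \<le> r / W"
        using 3 assms ln_le_minus_one[of "r / W"] by simp
      then show ?thesis
        using False ln by (simp add: field_simps)
    qed
    then have "L * of_bool (r < exp (- L) * W) + max 0 (ln r) + max 0 (- ln W)
        \<le> max 0 (- ln r) + max 0 (ln W) + inverse W * r"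
      by linarith
    then have "ennreal (L * of_bool (r < exp (- L) * W) + max 0 (ln r) + max 0 (- ln W))
        \<le> ennreal (max 0 (- ln r) + max 0 (ln W) + inverse W * r)"
      by (rule ennreal_leI)
    moreover have "ennreal (max 0 y) = ennreal y" for y
      by (simp add: max_def ennreal_neg)
    ultimately show ?thesis
      unfolding * using 3 assms
      by (cases "r < exp (- L) * W") (simp_all add: eln_ennreal e2ennreal_ereal ennreal_mult)
  qed
qed

text \<open>Integrate \<open>ln_pointwise\<close> with \<open>W\<close> the average of
  \<open>w\<close>. The A-infinity condition bounds the integral of \<open>ln (W / w)\<close> by
  \<open>|Q| * ln K\<close>, and \<open>w / W\<close> integrates to \<open>|Q|\<close>, so
  \<open>L\<close> times the measure of the bad set is at most \<open>|Q| * (1 + ln K)\<close>. This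
  dictates \<open>L = (1 + ln K) / \<delta>\<close>, which is positive because
  \<open>K \<ge> 1\<close>.\<close>

lemma Ainf_level_set:
  fixes w :: "real ^ 'n \<Rightarrow> ennreal"
  assumes w: "w \<in> Ainf" and K: "Ainf_const w \<le> ennreal K" "K \<ge> 1" and d: "\<delta> > 0" and Q: "Q \<in> cubes"
  shows "emeasure lebesgue {x\<in>Q. w x < ennreal (exp (- ((1 + ln K) / \<delta>))) * avg Q w}
      \<le> ennreal \<delta> * emeasure lebesgue Q"
proof -
  have loc: "loc_integrable w" using w by (simp add: Ainf_def)
  have [measurable]: "w \<in> borel_measurable lebesgue"
    using loc by (simp add: loc_integrable_def)
  note [measurable] = cubes_sets[OF Q]
  define m where "m = measure lebesgue Q"
  have m: "m > 0" "emeasure lebesgue Q = ennreal m"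
    using Q cubes_measure_pos cubes_emeasure by (auto simp: m_def)
  obtain W where W: "avg Q w = ennreal W" "W \<ge> 0"
    using avg_finite[OF loc Q] by (cases "avg Q w") auto
  define L where "L = (1 + ln K) / \<delta>"
  have L: "L > 0" using K d by (simp add: L_def add_pos_nonneg)
  define B where "B = {x\<in>Q. w x < ennreal (exp (- L)) * avg Q w}"
  have [measurable]: "B \<in> sets lebesgue"
    unfolding B_def by measurable
  have "emeasure lebesgue B \<le> ennreal \<delta> * emeasure lebesgue Q"
  proof (cases "W = 0")
    case True
    then show ?thesis by (simp add: B_def W)
  next
    case False
    with W have "W > 0" by simp
    define N where "N = (\<integral>\<^sup>+x\<in>Q. e2ennreal (- eln (w x)) \<partial>lebesgue)"
    define P where "P = (\<integral>\<^sup>+x\<in>Q. e2ennreal (eln (w x)) \<partial>lebesgue)"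
    \<comment> \<open>The positive part of \<open>ln w\<close> is at most \<open>w\<close>; so
      \<open>P\<close> is finite and \<open>P - N\<close> is never
      \<open>\<infinity> - \<infinity>\<close>.\<close>
    have "P \<le> (\<integral>\<^sup>+x\<in>Q. w x \<partial>lebesgue)"
      unfolding P_def by (intro nn_integral_mono mult_right_mono e2ennreal_eln_le) auto
    also have "\<dots> < \<infinity>" by (rule loc_integrable_cube[OF loc Q])
    finally obtain P' where P': "P = ennreal P'" "P' \<ge> 0" by (cases P) auto
    have "avg Q w * eexp (- (eintegral Q (\<lambda>x. eln (w x)) / ereal (measure lebesgue Q))) \<le> Ainf_const w"
      unfolding Ainf_const_def by (rule SUP_upper[OF Q])
    also have "\<dots> \<le> ennreal K" by (rule K)
    also have "eintegral Q (\<lambda>x. eln (w x)) = enn2ereal P - enn2ereal N"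
      by (simp add: eintegral_def P_def N_def)
    finally have le: "ennreal W * eexp (- ((enn2ereal P - enn2ereal N) / ereal m)) \<le> ennreal K"
      by (simp add: W m_def)
    \<comment> \<open>A divergent negative part would make the exponential factor infinite, against
      \<open>W > 0\<close> and the bound \<open>K\<close>.\<close>
    have "N \<noteq> top"
    proof
      assume "N = top"
      then have "- ((enn2ereal P - enn2ereal N) / ereal m) = \<infinity>"
        using P' m by (simp add: enn2ereal_ennreal)
      then show False
        using le \<open>W > 0\<close> by (simp add: eexp_def ennreal_mult_top top_unique)
    qed
    then obtain N' where N': "N = ennreal N'" "N' \<ge> 0" by (cases N) auto
    have "- ((enn2ereal P - enn2ereal N) / ereal m) = ereal ((N' - P') / m)"
      using P' N' m by (simp add: enn2ereal_ennreal diff_divide_distrib)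
    with le have "ennreal (W * exp ((N' - P') / m)) \<le> ennreal K"
      using W by (simp add: eexp_def ennreal_mult)
    then have "W * exp ((N' - P') / m) \<le> K"
      using K by (simp add: ennreal_le_iff)
    then have "ln (W * exp ((N' - P') / m)) \<le> ln K"
      using \<open>W > 0\<close> K by (subst ln_le_cancel_iff) auto
    then have "ln W + (N' - P') / m \<le> ln K"
      using \<open>W > 0\<close> by (simp add: ln_mult)
    then have NP: "N' - P' + m * ln W \<le> m * ln K"
      using m by (simp add: field_simps)
    have int_w: "(\<integral>\<^sup>+x\<in>Q. w x \<partial>lebesgue) = ennreal (W * m)"
      using avg_mult_measure[OF Q, of w] W m by (simp add: ennreal_mult)
    have "(\<integral>\<^sup>+x\<in>Q. ennreal L * of_bool (w x < ennreal (exp (- L)) * ennreal W) + e2ennreal (eln (w x)) + ennreal (- ln W) \<partial>lebesgue)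
      \<le> (\<integral>\<^sup>+x\<in>Q. e2ennreal (- eln (w x)) + ennreal (ln W) + ennreal (inverse W) * w x \<partial>lebesgue)"
      using \<open>W > 0\<close> L by (intro nn_integral_mono mult_right_mono ln_pointwise) auto
    also have "\<dots> = N + ennreal (ln W) * ennreal m + ennreal (inverse W) * ennreal (W * m)"
      unfolding N_def int_w[symmetric] m(2)[symmetric]
      by (simp add: distrib_right nn_integral_add nn_integral_cmult nn_integral_cmult_indicator mult.assoc)
    also have "(\<integral>\<^sup>+x\<in>Q. ennreal L * of_bool (w x < ennreal (exp (- L)) * ennreal W) + e2ennreal (eln (w x)) + ennreal (- ln W) \<partial>lebesgue)
      = (\<integral>\<^sup>+x. ennreal L * indicator B x + e2ennreal (eln (w x)) * indicator Q x + ennreal (- ln W) * indicator Q x \<partial>lebesgue)"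
      by (intro nn_integral_cong) (auto simp: B_def W indicator_def)
    also have "\<dots> = ennreal L * emeasure lebesgue B + P + ennreal (- ln W) * ennreal m"
      unfolding P_def m(2)[symmetric]
      by (simp add: nn_integral_add nn_integral_cmult_indicator)
    finally have ineq: "ennreal L * emeasure lebesgue B + P + ennreal (- ln W) * ennreal m
      \<le> N + ennreal (ln W) * ennreal m + ennreal (inverse W) * ennreal (W * m)" .
    have "emeasure lebesgue B \<le> emeasure lebesgue Q"
      by (intro emeasure_mono) (auto simp: B_def)
    then obtain b where b: "emeasure lebesgue B = ennreal b" "b \<ge> 0"
      using m by (cases "emeasure lebesgue B") (auto simp: top_unique)
    \<comment> \<open>The truncation hidden in \<open>ennreal (ln W)\<close> and
      \<open>ennreal (- ln W)\<close> has to be explicit before passing to real arithmetic.\<close>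
    have mx: "ennreal y = ennreal (max 0 y)" for y
      by (simp add: max_def ennreal_neg)
    have "ennreal (L * b + P' + max 0 (- ln W) * m) \<le> ennreal (N' + max 0 (ln W) * m + inverse W * (W * m))"
      using ineq m L W(2) P' N' b(2) unfolding P'(1) N'(1) b(1)
      by (subst (asm) (2 4) mx) (simp add: ennreal_mult)
    then have "L * b + P' + max 0 (- ln W) * m \<le> N' + max 0 (ln W) * m + m"
      using \<open>W > 0\<close> m N' by (subst (asm) ennreal_le_iff) (auto simp: field_simps)
    moreover have "max 0 (ln W) * m - max 0 (- ln W) * m = m * ln W"
      by (simp add: max_def)
    ultimately have "L * b \<le> m * (1 + ln K)"
      using NP by (simp add: algebra_simps)
    then have "(1 + ln K) * b \<le> (1 + ln K) * (\<delta> * m)"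
      using d unfolding L_def by (simp add: field_simps)
    then have "b \<le> \<delta> * m"
      using K by (subst (asm) mult_le_cancel_left_pos) (auto simp: add_pos_nonneg)
    then show ?thesis
      using d m b by (simp add: ennreal_leI flip: ennreal_mult)
  qed
  then show ?thesis by (simp add: B_def L_def)
qed

lemma Ainf_loc_integrable: "w \<in> Ainf \<Longrightarrow> loc_integrable w"
  by (simp add: Ainf_def)

lemma Ainf_measurable: "w \<in> Ainf \<Longrightarrow> w \<in> borel_measurable lebesgue"
  by (simp add: Ainf_def loc_integrable_def)

text \<open>The level \<open>\<gamma>\<close> is fixed by the value \<open>a\<close> before any
  weight or cube is given. This order of quantifiers, kept in the later lemmas, expresses that a
  constant depends on a weight only through its A-infinity constant.\<close>

lemma Ainf_level_exists:
  assumes "\<delta> > 0"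
  shows "\<exists>\<gamma>. 0 < \<gamma> \<and> \<gamma> \<le> 1 \<and> (\<forall>(w :: real ^ 'n \<Rightarrow> ennreal) Q. w \<in> Ainf \<longrightarrow> Ainf_const w = a \<longrightarrow> Q \<in> cubes \<longrightarrow>
     emeasure lebesgue {x\<in>Q. w x < ennreal \<gamma> * avg Q w} \<le> ennreal \<delta> * emeasure lebesgue Q)"
proof -
  define K where "K = max 1 (enn2real a)"
  define \<gamma> where "\<gamma> = exp (- ((1 + ln K) / \<delta>))"
  have "a \<le> ennreal K" if "(w :: real ^ 'n \<Rightarrow> ennreal) \<in> Ainf" "Ainf_const w = a" for w
  proof -
    have "a < top" using that by (auto simp: Ainf_def)
    then show ?thesis by (cases a) (auto simp: K_def intro!: ennreal_leI)
  qed
  moreover have "\<gamma> \<le> 1"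
    using assms by (simp add: \<gamma>_def K_def add_nonneg_nonneg)
  ultimately show ?thesis
    using Ainf_level_set[of _ K \<delta>] assms
    by (intro exI[of _ \<gamma>]) (auto simp: \<gamma>_def K_def)
qed

lemma markov_cube:
  fixes w :: "real ^ 'n \<Rightarrow> ennreal"
  assumes "loc_integrable w" and Q: "Q \<in> cubes" and c: "c > 0"
  shows "emeasure lebesgue {x\<in>Q. w x > ennreal c * avg Q w} \<le> ennreal (1 / c) * emeasure lebesgue Q"
proof -
  have [measurable]: "w \<in> borel_measurable lebesgue"
    using assms by (simp add: loc_integrable_def)
  note [measurable] = cubes_sets[OF Q]
  define A where "A = {x\<in>Q. w x > ennreal c * avg Q w}"
  have [measurable]: "A \<in> sets lebesgue"
    unfolding A_def by measurable
  have I: "(\<integral>\<^sup>+x\<in>Q. w x \<partial>lebesgue) = avg Q w * emeasure lebesgue Q"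
    by (rule avg_mult_measure[OF Q])
  have m: "emeasure lebesgue Q \<noteq> 0" "emeasure lebesgue Q < top"
    using Q cubes_measure_pos[of Q] by (auto simp: cubes_emeasure)
  have "emeasure lebesgue A \<le> ennreal (1 / c) * emeasure lebesgue Q"
  \<comment> \<open>Markov's inequality divides by the average. If that is 0, the weight vanishes
    almost everywhere on \<open>Q\<close> and the strict superlevel set is null.\<close>
  proof (cases "avg Q w = 0")
    case True
    then have "(\<integral>\<^sup>+x. w x * indicator Q x \<partial>lebesgue) = 0"
      using I by simp
    then have "AE x in lebesgue. w x * indicator Q x = 0"
      by (subst (asm) nn_integral_0_iff_AE) auto
    then have "AE x in lebesgue. x \<notin> A"
      by eventually_elim (auto simp: A_def split: split_indicator)
    then have "emeasure lebesgue A = 0"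
      by (subst (asm) AE_iff_measurable[where N = A]) auto
    then show ?thesis by simp
  next
    case False
    have fin: "avg Q w < top" by (rule avg_finite[OF assms(1) Q])
    have "ennreal c * avg Q w * emeasure lebesgue A = (\<integral>\<^sup>+x\<in>A. ennreal c * avg Q w \<partial>lebesgue)"
      by (simp add: nn_integral_cmult_indicator)
    also have "\<dots> \<le> (\<integral>\<^sup>+x\<in>Q. w x \<partial>lebesgue)"
      by (intro nn_integral_mono) (auto simp: A_def split: split_indicator)
    also have "\<dots> = ennreal c * avg Q w * (ennreal (1 / c) * emeasure lebesgue Q)"
    proof -
      have "ennreal c * ennreal (1 / c) = 1"
        using c by (simp flip: ennreal_mult)
      then show ?thesis
        unfolding I by (metis mult.assoc mult.commute mult.right_neutral)
    qed
    finally show ?thesis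
      using False fin c by (subst (asm) ennreal_mult_le_mult_iff) (auto simp: ennreal_mult_eq_top_iff)
  qed
  then show ?thesis by (simp add: A_def)
qed

text \<open>The bad set for the fraction \<open>\<delta> / 2\<close> removes at most half of
  \<open>E\<close>; on the rest \<open>w\<close> is at least \<open>\<gamma>\<close> times its
  average, so the integral over \<open>E\<close> is at least \<open>\<gamma> * \<delta> / 2\<close>
  times that over \<open>Q\<close>. Doubling is the case where \<open>E\<close> is a smaller
  cube.\<close>

lemma Ainf_subset_bound:
  assumes "\<delta> > 0"
  shows "\<exists>C>0. \<forall>(w :: real ^ 'n \<Rightarrow> ennreal) Q E. w \<in> Ainf \<longrightarrow> Ainf_const w = a \<longrightarrow> Q \<in> cubes \<longrightarrow>
     E \<in> sets lebesgue \<longrightarrow> E \<subseteq> Q \<longrightarrow> ennreal \<delta> * emeasure lebesgue Q \<le> emeasure lebesgue E \<longrightarrow>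
     (\<integral>\<^sup>+x\<in>Q. w x \<partial>lebesgue) \<le> ennreal C * (\<integral>\<^sup>+x\<in>E. w x \<partial>lebesgue)"
proof -
  have "\<delta> / 2 > 0" using assms by simp
  from Ainf_level_exists[OF this, of a, where 'n = 'n] obtain \<gamma> where \<gamma>: "0 < \<gamma>" "\<gamma> \<le> 1"
    and lev: "\<And>(w :: real ^ 'n \<Rightarrow> ennreal) Q. w \<in> Ainf \<Longrightarrow> Ainf_const w = a \<Longrightarrow> Q \<in> cubes \<Longrightarrow>
     emeasure lebesgue {x\<in>Q. w x < ennreal \<gamma> * avg Q w} \<le> ennreal (\<delta> / 2) * emeasure lebesgue Q"
    by blast
  have "(\<integral>\<^sup>+x\<in>Q. w x \<partial>lebesgue) \<le> ennreal (2 / (\<delta> * \<gamma>)) * (\<integral>\<^sup>+x\<in>E. w x \<partial>lebesgue)"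
    if w: "w \<in> Ainf" "Ainf_const w = a" and Q: "Q \<in> cubes"
      and E[measurable]: "E \<in> sets lebesgue" and EQ: "E \<subseteq> Q" and le: "ennreal \<delta> * emeasure lebesgue Q \<le> emeasure lebesgue E"
    for w :: "real ^ 'n \<Rightarrow> ennreal" and Q E
  proof -
    note [measurable] = Ainf_measurable[OF w(1)] cubes_sets[OF Q]
    define B where "B = {x\<in>Q. w x < ennreal \<gamma> * avg Q w}"
    have [measurable]: "B \<in> sets lebesgue"
      unfolding B_def by measurable
    have B: "emeasure lebesgue B \<le> ennreal (\<delta> / 2) * emeasure lebesgue Q"
      using lev[OF w Q] by (simp add: B_def)
    have m: "emeasure lebesgue Q = ennreal (measure lebesgue Q)" "measure lebesgue Q > 0"
      using Q by (simp_all add: cubes_emeasure cubes_measure_pos)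
    have "ennreal \<delta> * emeasure lebesgue Q \<le> emeasure lebesgue (E - B) + emeasure lebesgue B"
    proof -
      have "emeasure lebesgue E \<le> emeasure lebesgue ((E - B) \<union> B)"
        by (intro emeasure_mono) auto
      also have "\<dots> = emeasure lebesgue (E - B) + emeasure lebesgue B"
        by (intro plus_emeasure[symmetric]) auto
      finally show ?thesis using le by simp
    qed
    also have "\<dots> \<le> emeasure lebesgue (E - B) + ennreal (\<delta> / 2) * emeasure lebesgue Q"
      by (intro add_left_mono B)
    finally have half: "ennreal (\<delta> / 2) * emeasure lebesgue Q \<le> emeasure lebesgue (E - B)"
    proof -
      assume *: "ennreal \<delta> * emeasure lebesgue Q \<le> emeasure lebesgue (E - B) + ennreal (\<delta> / 2) * emeasure lebesgue Q"
      have "emeasure lebesgue (E - B) \<le> emeasure lebesgue Q"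
        using EQ by (intro emeasure_mono) auto
      then obtain e where e: "emeasure lebesgue (E - B) = ennreal e" "e \<ge> 0"
        using m by (cases "emeasure lebesgue (E - B)") (auto simp: top_unique)
      from * have "\<delta> * measure lebesgue Q \<le> e + \<delta> / 2 * measure lebesgue Q"
        using assms e m by (simp flip: ennreal_mult ennreal_plus)
      then show ?thesis
        using assms e m by (simp add: field_simps flip: ennreal_mult)
    qed
    have "(\<integral>\<^sup>+x\<in>Q. w x \<partial>lebesgue) = avg Q w * emeasure lebesgue Q"
      by (rule avg_mult_measure[OF Q])
    also have "\<dots> = ennreal (2 / (\<delta> * \<gamma>)) * (ennreal \<gamma> * avg Q w * (ennreal (\<delta> / 2) * emeasure lebesgue Q))"
    proof -
      have "ennreal (2 / (\<delta> * \<gamma>)) * (ennreal \<gamma> * ennreal (\<delta> / 2)) = 1"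
        using assms \<gamma> by (simp flip: ennreal_mult)
      then show ?thesis
        by (metis (no_types, lifting) mult.assoc mult.commute mult.left_commute mult_1)
    qed
    also have "ennreal \<gamma> * avg Q w * (ennreal (\<delta> / 2) * emeasure lebesgue Q) \<le> ennreal \<gamma> * avg Q w * emeasure lebesgue (E - B)"
      by (intro mult_left_mono half) auto
    also have "\<dots> = (\<integral>\<^sup>+x\<in>E - B. ennreal \<gamma> * avg Q w \<partial>lebesgue)"
      by (simp add: nn_integral_cmult_indicator)
    also have "\<dots> \<le> (\<integral>\<^sup>+x\<in>E. w x \<partial>lebesgue)"
      using EQ by (intro nn_integral_mono) (auto simp: B_def not_less split: split_indicator)
    finally show ?thesis by (simp add: mult_left_mono)
  qed
  then show ?thesis
    using assms \<gamma> by (intro exI[of _ "2 / (\<delta> * \<gamma>)"]) auto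
qed

text \<open>Three exceptional sets of an eighth each cannot cover the cube. At a point outside them
  three weights can be compared with their averages simultaneously.\<close>

lemma exists_good_point:
  fixes Q :: "(real ^ 'n) set"
  assumes Q: "Q \<in> cubes"
    and [measurable]: "A \<in> sets lebesgue" "B \<in> sets lebesgue" "C \<in> sets lebesgue"
    and A: "emeasure lebesgue A \<le> ennreal (1 / 8) * emeasure lebesgue Q"
    and B: "emeasure lebesgue B \<le> ennreal (1 / 8) * emeasure lebesgue Q"
    and C: "emeasure lebesgue C \<le> ennreal (1 / 8) * emeasure lebesgue Q"
  obtains x where "x \<in> Q" "x \<notin> A" "x \<notin> B" "x \<notin> C"
proof (rule ccontr)
  assume "\<not> thesis"
  then have "Q \<subseteq> A \<union> B \<union> C" using that by blast
  then have "emeasure lebesgue Q \<le> emeasure lebesgue (A \<union> B \<union> C)"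
    by (intro emeasure_mono) auto
  also have "\<dots> \<le> emeasure lebesgue A + emeasure lebesgue B + emeasure lebesgue C"
    by (intro order_trans[OF emeasure_subadditive] add_right_mono emeasure_subadditive) auto
  also have "\<dots> \<le> ennreal (1 / 8) * emeasure lebesgue Q + ennreal (1 / 8) * emeasure lebesgue Q + ennreal (1 / 8) * emeasure lebesgue Q"
    by (intro add_mono A B C)
  also have "\<dots> = ennreal (3 / 8 * measure lebesgue Q)"
    by (simp add: cubes_emeasure[OF Q] flip: ennreal_mult ennreal_plus)
  finally show False
    using cubes_measure_pos[OF Q] by (simp add: cubes_emeasure[OF Q])
qed

section \<open>Comparing averages with the weight ratio\<close>

text \<open>For \<open>\<gamma> \<le> 1\<close> and \<open>e \<le> 1\<close> one has
  \<open>\<gamma> \<le> \<gamma> powr e\<close>. Taking constants out at the first power frees them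
  from the exponents \<open>1 / q\<close> and \<open>1 / p'\<close>; this is how
  \<open>\<theta>\<close> becomes independent of \<open>q\<close>.\<close>

lemma epowr_scale_ge:
  assumes "0 < \<gamma>" "\<gamma> \<le> 1" "0 < e" "e \<le> 1"
  shows "ennreal \<gamma> * epowr U e \<le> epowr (ennreal \<gamma> * U) e"
proof -
  have "\<gamma> powr 1 \<le> \<gamma> powr e"
    using assms by (intro powr_mono') auto
  then have "ennreal \<gamma> \<le> epowr (ennreal \<gamma>) e"
    using assms by (simp add: epowr_ennreal ennreal_leI)
  then show ?thesis
    using assms by (simp add: epowr_mult mult_right_mono)
qed

lemma epowr_scale_le:
  assumes "1 \<le> c" "0 < e" "e \<le> 1"
  shows "epowr (ennreal c * U) e \<le> ennreal c * epowr U e"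
proof -
  have "c powr e \<le> c powr 1"
    using assms by (intro powr_mono) auto
  then have "epowr (ennreal c) e \<le> ennreal c"
    using assms by (simp add: epowr_ennreal ennreal_leI)
  then show ?thesis
    using assms by (simp add: epowr_mult mult_right_mono)
qed

lemma conj_exp_pos: "p > 1 \<Longrightarrow> conj_exp p > 1"
  by (simp add: conj_exp_def)

lemma weight_ratio_ge:
  assumes "p > 1" "q \<ge> 1" "v x \<ge> 0" "0 < \<gamma>1" "\<gamma>1 \<le> 1" "0 < \<gamma>2" "\<gamma>2 \<le> 1"
    and "ennreal \<gamma>1 * U \<le> ennreal (u x)" "ennreal \<gamma>2 * S \<le> dual_weight p v x"
  shows "ennreal (\<gamma>1 * \<gamma>2) * (epowr U (1 / q) * epowr S (1 / conj_exp p)) \<le> weight_ratio p q u v x"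
proof -
  have "ennreal \<gamma>1 * epowr U (1 / q) \<le> epowr (ennreal \<gamma>1 * U) (1 / q)"
    using assms by (intro epowr_scale_ge) auto
  also have "\<dots> \<le> epowr (ennreal (u x)) (1 / q)"
    using assms by (intro epowr_mono) auto
  finally have 1: "ennreal \<gamma>1 * epowr U (1 / q) \<le> epowr (ennreal (u x)) (1 / q)" .
  have "ennreal \<gamma>2 * epowr S (1 / conj_exp p) \<le> epowr (ennreal \<gamma>2 * S) (1 / conj_exp p)"
    using assms conj_exp_pos[of p] by (intro epowr_scale_ge) auto
  also have "\<dots> \<le> epowr (dual_weight p v x) (1 / conj_exp p)"
    using assms conj_exp_pos[of p] by (intro epowr_mono) auto
  finally have 2: "ennreal \<gamma>2 * epowr S (1 / conj_exp p) \<le> epowr (dual_weight p v x) (1 / conj_exp p)" .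
  have "ennreal (\<gamma>1 * \<gamma>2) * (epowr U (1 / q) * epowr S (1 / conj_exp p))
      = (ennreal \<gamma>1 * epowr U (1 / q)) * (ennreal \<gamma>2 * epowr S (1 / conj_exp p))"
    using assms by (simp add: ennreal_mult ac_simps)
  also have "\<dots> \<le> weight_ratio p q u v x"
    using assms 1 2 by (subst weight_ratio_eq) (auto intro!: mult_mono)
  finally show ?thesis .
qed

lemma weight_ratio_le:
  assumes "p > 1" "q \<ge> 1" "v x \<ge> 0" "1 \<le> c1" "1 \<le> c2"
    and "ennreal (u x) \<le> ennreal c1 * U" "dual_weight p v x \<le> ennreal c2 * S"
  shows "weight_ratio p q u v x \<le> ennreal (c1 * c2) * (epowr U (1 / q) * epowr S (1 / conj_exp p))"
proof -
  have "epowr (ennreal (u x)) (1 / q) \<le> epowr (ennreal c1 * U) (1 / q)"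
    using assms by (intro epowr_mono) auto
  also have "\<dots> \<le> ennreal c1 * epowr U (1 / q)"
    using assms by (intro epowr_scale_le) auto
  finally have 1: "epowr (ennreal (u x)) (1 / q) \<le> ennreal c1 * epowr U (1 / q)" .
  have "epowr (dual_weight p v x) (1 / conj_exp p) \<le> epowr (ennreal c2 * S) (1 / conj_exp p)"
    using assms conj_exp_pos[of p] by (intro epowr_mono) auto
  also have "\<dots> \<le> ennreal c2 * epowr S (1 / conj_exp p)"
    using assms conj_exp_pos[of p] by (intro epowr_scale_le) auto
  finally have 2: "epowr (dual_weight p v x) (1 / conj_exp p) \<le> ennreal c2 * epowr S (1 / conj_exp p)" .
  have "weight_ratio p q u v x \<le> (ennreal c1 * epowr U (1 / q)) * (ennreal c2 * epowr S (1 / conj_exp p))"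
    using assms 1 2 by (subst weight_ratio_eq) (auto intro!: mult_mono)
  also have "\<dots> = ennreal (c1 * c2) * (epowr U (1 / q) * epowr S (1 / conj_exp p))"
    using assms by (simp add: ennreal_mult ac_simps)
  finally show ?thesis .
qed

section \<open>The weak-type bound for the two-weight constant\<close>

lemma weight_ratio_measurable:
  assumes [measurable]: "u \<in> borel_measurable lebesgue" "v \<in> borel_measurable lebesgue"
  shows "weight_ratio p q u v \<in> borel_measurable lebesgue"
proof -
  have "(\<lambda>x. weight_ratio p q u v x) \<in> borel_measurable lebesgue"
    unfolding weight_ratio_def by measurable
  then show ?thesis by simp
qed

text \<open>Off two bad sets of an eighth each, the ratio is at least
  \<open>\<gamma>1 * \<gamma>2\<close> times the product of averages. So a superlevel set at that
  height fills more than half of the cube, and \<open>weak_norm\<close> notices it.\<close>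

lemma A_const_le_weak_norm:
  "\<exists>C>0. \<forall>p q \<alpha> (u :: real ^ 'n \<Rightarrow> real) v. 1 < p \<longrightarrow> p \<le> q \<longrightarrow> \<alpha> < real CARD('n) \<longrightarrow>
     Theta CARD('n) \<alpha> p q > 0 \<longrightarrow> u \<in> borel_measurable lebesgue \<longrightarrow> v \<in> borel_measurable lebesgue \<longrightarrow>
     (\<forall>x. 0 \<le> v x) \<longrightarrow> (\<lambda>x. ennreal (u x)) \<in> Ainf \<longrightarrow> dual_weight p v \<in> Ainf \<longrightarrow>
     Ainf_const (\<lambda>x. ennreal (u x)) = a \<longrightarrow> Ainf_const (dual_weight p v) = b \<longrightarrow>
     A_const \<alpha> p q u v \<le> ennreal C * weak_norm (real CARD('n) / Theta CARD('n) \<alpha> p q) (weight_ratio p q u v)"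
proof -
  have d: "(1 / 8 :: real) > 0" by simp
  from Ainf_level_exists[OF d, of a, where 'n = 'n] obtain \<gamma>1 where g1: "0 < \<gamma>1" "\<gamma>1 \<le> 1"
    and lev1: "\<And>(w :: real ^ 'n \<Rightarrow> ennreal) Q. w \<in> Ainf \<Longrightarrow> Ainf_const w = a \<Longrightarrow> Q \<in> cubes \<Longrightarrow>
     emeasure lebesgue {x\<in>Q. w x < ennreal \<gamma>1 * avg Q w} \<le> ennreal (1 / 8) * emeasure lebesgue Q"
    by blast
  from Ainf_level_exists[OF d, of b, where 'n = 'n] obtain \<gamma>2 where g2: "0 < \<gamma>2" "\<gamma>2 \<le> 1"
    and lev2: "\<And>(w :: real ^ 'n \<Rightarrow> ennreal) Q. w \<in> Ainf \<Longrightarrow> Ainf_const w = b \<Longrightarrow> Q \<in> cubes \<Longrightarrow>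
     emeasure lebesgue {x\<in>Q. w x < ennreal \<gamma>2 * avg Q w} \<le> ennreal (1 / 8) * emeasure lebesgue Q"
    by blast
  \<comment> \<open>One factor 2 pays for halving the level, the other for keeping half of the cube,
    as \<open>m powr t \<le> 2 * (m / 2) powr t\<close> for \<open>t \<le> 1\<close>.\<close>
  define C where "C = 4 / (\<gamma>1 * \<gamma>2)"
  have C: "C > 0" using g1 g2 by (simp add: C_def)
  have "A_const \<alpha> p q u v \<le> ennreal C * weak_norm (real CARD('n) / Theta CARD('n) \<alpha> p q) (weight_ratio p q u v)"
    if p: "1 < p" "p \<le> q" and \<alpha>: "\<alpha> < real CARD('n)" and Th: "Theta CARD('n) \<alpha> p q > 0"
      and [measurable]: "u \<in> borel_measurable lebesgue" "v \<in> borel_measurable lebesgue"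
      and v: "\<forall>x. 0 \<le> v x" and u': "(\<lambda>x. ennreal (u x)) \<in> Ainf" and v': "dual_weight p v \<in> Ainf"
      and a: "Ainf_const (\<lambda>x. ennreal (u x)) = a" and b: "Ainf_const (dual_weight p v) = b"
    for p q \<alpha> and u v :: "real ^ 'n \<Rightarrow> real"
  proof -
    define \<sigma> where "\<sigma> = dual_weight p v"
    define w where "w = weight_ratio p q u v"
    define t where "t = Theta CARD('n) \<alpha> p q / real CARD('n)"
    note [measurable] = weight_ratio_measurable[of u v p q, folded w_def]
    have [measurable]: "\<sigma> \<in> borel_measurable lebesgue"
      using Ainf_measurable[OF v'] by (simp add: \<sigma>_def)
    have "1 / q \<le> 1 / p"
      using p by (simp add: frac_le)
    then have "real CARD('n) * (1 / q - 1 / p) \<le> 0"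
      by (intro mult_nonneg_nonpos) auto
    then have t: "0 < t" "t \<le> 1"
      using Th \<alpha> by (auto simp: t_def Theta_def)
    have cube: "epowr (emeasure lebesgue Q) t * epowr (avg Q (\<lambda>x. ennreal (u x))) (1 / q) * epowr (avg Q \<sigma>) (1 / conj_exp p)
        \<le> ennreal C * weak_norm (1 / t) w" if Q: "Q \<in> cubes" for Q
    proof -
      note [measurable] = cubes_sets[OF Q]
      define U where "U = avg Q (\<lambda>x. ennreal (u x))"
      define S where "S = avg Q \<sigma>"
      define B1 where "B1 = {x\<in>Q. ennreal (u x) < ennreal \<gamma>1 * U}"
      define B2 where "B2 = {x\<in>Q. \<sigma> x < ennreal \<gamma>2 * S}"
      have [measurable]: "B1 \<in> sets lebesgue" "B2 \<in> sets lebesgue"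
        unfolding B1_def B2_def by measurable
      have B1: "emeasure lebesgue B1 \<le> ennreal (1 / 8) * emeasure lebesgue Q"
        unfolding B1_def U_def by (rule lev1[OF u' a Q])
      have B2: "emeasure lebesgue B2 \<le> ennreal (1 / 8) * emeasure lebesgue Q"
        unfolding B2_def S_def \<sigma>_def by (rule lev2[OF v' b Q])
      have "U < top" "S < top"
        unfolding U_def S_def \<sigma>_def using u' v' Q by (auto intro: avg_finite Ainf_loc_integrable)
      then obtain r s where "U = ennreal r" "S = ennreal s" "r \<ge> 0" "s \<ge> 0"
        by (cases U; cases S) auto
      then obtain X where X: "epowr U (1 / q) * epowr S (1 / conj_exp p) = ennreal X" "X \<ge> 0"
        using p conj_exp_pos[of p] that[of "r powr (1 / q) * s powr (1 / conj_exp p)"]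
        by (simp add: epowr_ennreal ennreal_mult)
      show ?thesis
      proof (cases "X = 0")
        case True
        then show ?thesis
          using X by (auto simp: U_def S_def mult.assoc)
      next
        case False
        define G where "G = Q - B1 - B2"
        \<comment> \<open>Half of the guaranteed lower bound, because \<open>weak_norm\<close> is
          built on strict superlevel sets.\<close>
        define l where "l = \<gamma>1 * \<gamma>2 * X / 2"
        have l: "l > 0" using False X g1 g2 by (simp add: l_def)
        have G_sub: "G \<subseteq> {x. w x > ennreal l}"
        proof
          fix x assume x: "x \<in> G"
          have "ennreal l < ennreal (\<gamma>1 * \<gamma>2 * X)"
            using l by (simp add: l_def ennreal_less_iff mult_ac)
          also have "\<dots> = ennreal (\<gamma>1 * \<gamma>2) * (epowr U (1 / q) * epowr S (1 / conj_exp p))"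
            unfolding X using g1 g2 X by (simp add: ennreal_mult)
          also have "\<dots> \<le> w x"
            unfolding w_def using p v g1 g2 x
            by (intro weight_ratio_ge) (auto simp: G_def B1_def B2_def \<sigma>_def not_less)
          finally show "x \<in> {x. w x > ennreal l}" by simp
        qed
        define m where "m = measure lebesgue Q"
        have m: "emeasure lebesgue Q = ennreal m" "m > 0"
          using Q by (simp_all add: cubes_emeasure cubes_measure_pos m_def)
        have "emeasure lebesgue Q \<le> emeasure lebesgue G + (emeasure lebesgue B1 + emeasure lebesgue B2)"
        proof -
          have "emeasure lebesgue Q \<le> emeasure lebesgue (G \<union> (B1 \<union> B2))"
            by (intro emeasure_mono) (auto simp: G_def)
          also have "\<dots> \<le> emeasure lebesgue G + emeasure lebesgue (B1 \<union> B2)"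
            by (intro emeasure_subadditive) (auto simp: G_def)
          also have "\<dots> \<le> emeasure lebesgue G + (emeasure lebesgue B1 + emeasure lebesgue B2)"
            by (intro add_left_mono emeasure_subadditive) auto
          finally show ?thesis .
        qed
        also have "\<dots> \<le> emeasure lebesgue G + (ennreal (1 / 8) * emeasure lebesgue Q + ennreal (1 / 8) * emeasure lebesgue Q)"
          by (intro add_mono B1 B2) auto
        finally have "ennreal m \<le> emeasure lebesgue G + ennreal (m / 4)"
          using m by (simp flip: ennreal_mult ennreal_plus)
        then have "ennreal (m / 2) \<le> emeasure lebesgue G"
          using m by (cases "emeasure lebesgue G") (auto simp flip: ennreal_plus)
        also have "\<dots> \<le> emeasure lebesgue {x. w x > ennreal l}"
        proof (rule emeasure_mono[OF G_sub])
          have "{x \<in> space lebesgue. w x > ennreal l} \<in> sets lebesgue" by measurable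
          then show "{x. w x > ennreal l} \<in> sets lebesgue" by simp
        qed
        finally have ml: "ennreal (m / 2) \<le> emeasure lebesgue {x. w x > ennreal l}" .
        have mt: "m powr t \<le> 2 * (m / 2) powr t"
        proof -
          have "(2::real) powr t \<le> 2 powr 1" using t by (intro powr_mono) auto
          then show ?thesis
            using m by (simp add: powr_divide field_simps mult_right_mono)
        qed
        have "epowr (emeasure lebesgue Q) t * epowr U (1 / q) * epowr S (1 / conj_exp p) = ennreal (m powr t * X)"
          using m t X by (simp add: mult.assoc epowr_ennreal ennreal_mult)
        also have "\<dots> \<le> ennreal (C * (l * (m / 2) powr t))"
          using X g1 g2 mult_right_mono[OF mt, of X] by (intro ennreal_leI) (simp add: C_def l_def field_simps)
        also have "\<dots> = ennreal C * (ennreal l * epowr (ennreal (m / 2)) t)"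
          using l m t C by (simp add: epowr_ennreal ennreal_mult)
        also have "\<dots> \<le> ennreal C * (ennreal l * epowr (emeasure lebesgue {x. w x > ennreal l}) (1 / (1 / t)))"
          using t ml by (intro mult_left_mono) (auto intro!: epowr_mono)
        also have "\<dots> \<le> ennreal C * weak_norm (1 / t) w"
          unfolding weak_norm_def using l by (intro mult_left_mono SUP_upper) auto
        finally show ?thesis by (simp add: U_def S_def)
      qed
    qed
    have s: "real CARD('n) / Theta CARD('n) \<alpha> p q = 1 / t"
      by (simp add: t_def)
    show ?thesis
      unfolding A_const_def s w_def[symmetric] t_def[symmetric] \<sigma>_def[symmetric]
      by (intro SUP_least cube)
  qed
  with C show ?thesis by (intro exI[of _ C]) blast
qed

section \<open>Measurability and essential supremum of the fractional maximal function\<close>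

lemma cube_mem_cubes: "r > 0 \<Longrightarrow> cbox a (a + (\<chi> i. r)) \<in> cubes"
  by (auto simp: cubes_def)

lemma cube_subset_enlarged:
  fixes a :: "real ^ 'n"
  assumes "e > 0" "x \<in> cbox a (a + (\<chi> i. r))"
  shows "x \<in> box (a - (\<chi> i. e)) (a - (\<chi> i. e) + (\<chi> i. r + 2 * e))"
  unfolding mem_box_cart
proof
  fix i
  have "a $ i \<le> x $ i \<and> x $ i \<le> a $ i + r"
    using assms(2) by (simp add: mem_box_cart)
  then show "(a - (\<chi> i. e)) $ i < x $ i \<and> x $ i < (a - (\<chi> i. e) + (\<chi> i. r + 2 * e)) $ i"
    using assms(1) by simp
qed

text \<open>The superlevel sets are open. Cubes are closed and may have \<open>x\<close> on their
  boundary, so a good cube is enlarged slightly: its integral can only grow, its volume changes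
  continuously, and it then beats \<open>t\<close> while containing a neighbourhood of
  \<open>x\<close>.\<close>

lemma maximal_measurable:
  fixes w :: "real ^ 'n \<Rightarrow> ennreal"
  assumes loc: "loc_integrable w"
  shows "maximal \<beta> w \<in> borel_measurable lebesgue"
proof (rule borel_measurableI_greater)
  fix t :: ennreal
  have "open {x. t < maximal \<beta> w x}"
  proof (subst open_subopen, safe)
    fix x assume "t < maximal \<beta> w x"
    then obtain Q where Q: "Q \<in> cubes" "x \<in> Q"
      and tQ: "t < epowr (emeasure lebesgue Q) (\<beta> / real CARD('n)) * avg Q w"
      by (auto simp: maximal_def less_SUP_iff)
    from Q(1) obtain a r where r: "r > 0" "Q = cbox a (a + (\<chi> i. r))" "emeasure lebesgue Q = ennreal (r ^ CARD('n))"
      by (rule cubesE)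
    define I where "I = (\<integral>\<^sup>+x\<in>Q. w x \<partial>lebesgue)"
    obtain i where i: "I = ennreal i" "i \<ge> 0"
      using loc_integrable_cube[OF loc Q(1)] by (cases I) (auto simp: I_def)
    \<comment> \<open>The integral over the original cube stays fixed and only the side length
      varies, which makes continuity elementary.\<close>
    define \<phi> where "\<phi> \<rho> = (\<rho> ^ CARD('n)) powr (\<beta> / real CARD('n)) * (i / \<rho> ^ CARD('n))" for \<rho> :: real
    have phi: "epowr (ennreal (\<rho> ^ CARD('n))) (\<beta> / real CARD('n)) * (I / ennreal (\<rho> ^ CARD('n))) = ennreal (\<phi> \<rho>)"
      if "\<rho> > 0" for \<rho>
      unfolding \<phi>_def using that i by (subst ennreal_mult) (simp_all add: epowr_ennreal_pos divide_ennreal)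
    have "t < ennreal (\<phi> r)"
      using tQ phi[OF r(1)] by (simp add: r(3) avg_def I_def)
    then obtain t' where t': "t = ennreal t'" "0 \<le> t'" "t' < \<phi> r"
      by (cases t) (auto simp: ennreal_less_iff)
    have "isCont \<phi> r"
      unfolding \<phi>_def using r(1) by (intro continuous_intros) auto
    then have "eventually (\<lambda>\<rho>. t' < \<phi> \<rho>) (at r)"
      using t'(3) by (auto simp: isCont_def dest: order_tendstoD)
    then obtain d where d: "d > 0" "\<And>\<rho>. \<rho> \<noteq> r \<Longrightarrow> dist \<rho> r < d \<Longrightarrow> t' < \<phi> \<rho>"
      by (auto simp: eventually_at)
    \<comment> \<open>A margin \<open>e\<close> on each end lengthens the side by
      \<open>2 * e\<close>, which is less than \<open>d\<close>.\<close>
    define e where "e = d / 4"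
    define a' where "a' = a - (\<chi> i. e)"
    define Q' where "Q' = cbox a' (a' + (\<chi> i. r + 2 * e))"
    have e: "e > 0" using d by (simp add: e_def)
    have Q': "Q' \<in> cubes" "emeasure lebesgue Q' = ennreal ((r + 2 * e) ^ CARD('n))"
      unfolding Q'_def using e r(1) by (auto intro!: cube_mem_cubes emeasure_lebesgue_cube)
    have "Q \<subseteq> box a' (a' + (\<chi> i. r + 2 * e))"
      using cube_subset_enlarged[OF e] by (auto simp: r(2) a'_def)
    then have "Q \<subseteq> Q'"
      using box_subset_cbox[of a' "a' + (\<chi> i. r + 2 * e)"] by (auto simp: Q'_def)
    define B where "B = box a' (a' + (\<chi> i. r + 2 * e))"
    have "x \<in> B"
      using Q(2) cube_subset_enlarged[OF e] by (auto simp: r(2) B_def a'_def)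
    have "t < ennreal (\<phi> (r + 2 * e))"
      unfolding t' using e r(1) t'(2) by (intro ennreal_lessI order.strict_trans1[OF t'(2)] d) (auto simp: dist_real_def e_def)
    also have "\<dots> = epowr (emeasure lebesgue Q') (\<beta> / real CARD('n)) * (I / emeasure lebesgue Q')"
      using e r(1) phi[of "r + 2 * e"] by (simp add: Q')
    also have "\<dots> \<le> epowr (emeasure lebesgue Q') (\<beta> / real CARD('n)) * avg Q' w"
      unfolding avg_def I_def using \<open>Q \<subseteq> Q'\<close>
      by (intro mult_left_mono divide_right_mono_ennreal nn_set_integral_set_mono) auto
    finally have "t < maximal \<beta> w y" if "y \<in> B" for y
      using that Q'(1) box_subset_cbox[of a' "a' + (\<chi> i. r + 2 * e)"]
      by (auto simp: maximal_def less_SUP_iff B_def Q'_def)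
    moreover have "open B" unfolding B_def by (rule open_box)
    ultimately show "\<exists>T. open T \<and> x \<in> T \<and> T \<subseteq> {x. t < maximal \<beta> w x}"
      using \<open>x \<in> B\<close> by blast
  qed
  then show "{x \<in> space lebesgue. t < maximal \<beta> w x} \<in> sets lebesgue"
    by (simp add: borel_open)
qed

text \<open>The maximal function is at least the quantity belonging to \<open>Q\<close> at every
  point of \<open>Q\<close>, a set of positive measure, so no cube is lost in the essential
  supremum. The estimate for \<open>A_const\<close> becomes a comparison cube by cube.\<close>

lemma esssup_maximal:
  fixes w :: "real ^ 'n \<Rightarrow> ennreal"
  assumes loc: "loc_integrable w"
  shows "esssup lebesgue (maximal \<beta> w)
    = (SUP Q\<in>cubes. epowr (emeasure lebesgue Q) (\<beta> / real CARD('n)) * avg Q w)"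
proof (rule antisym)
  show "esssup lebesgue (maximal \<beta> w) \<le> (SUP Q\<in>cubes. epowr (emeasure lebesgue Q) (\<beta> / real CARD('n)) * avg Q w)"
    by (intro esssup_I maximal_measurable loc AE_I2) (auto simp: maximal_def intro!: SUP_subset_mono)
  show "(SUP Q\<in>cubes. epowr (emeasure lebesgue Q) (\<beta> / real CARD('n)) * avg Q w) \<le> esssup lebesgue (maximal \<beta> w)"
  proof (rule SUP_least, rule ccontr)
    fix Q :: "(real ^ 'n) set"
    assume Q: "Q \<in> cubes"
    let ?c = "epowr (emeasure lebesgue Q) (\<beta> / real CARD('n)) * avg Q w"
    assume c: "\<not> ?c \<le> esssup lebesgue (maximal \<beta> w)"
    have "?c \<le> maximal \<beta> w x" if "x \<in> Q" for x
      unfolding maximal_def using Q that by (intro SUP_upper) auto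
    then have "AE x in lebesgue. x \<notin> Q"
      using esssup_AE[of "maximal \<beta> w" lebesgue] c by (auto elim!: eventually_mono dest: order_trans)
    then have "emeasure lebesgue Q = 0"
      using Q by (subst (asm) AE_iff_measurable[where N = Q]) auto
    then show False
      using Q cubes_measure_pos[OF Q] by (simp add: cubes_emeasure)
  qed
qed

text \<open>At a point where \<open>u\<close> and the dual weight are not far below their averages
  and the ratio is not far above its own, the product of averages is bounded by the average of the
  ratio. A second point with the roles exchanged gives the converse. The power of \<open>|Q|\<close>
  is common to both sides.\<close>

lemma A_const_maximal_equiv:
  "\<exists>\<theta>>0. \<theta> < 1 \<and> (\<forall>p q \<alpha> (u :: real ^ 'n \<Rightarrow> real) v. 1 < p \<longrightarrow> p \<le> q \<longrightarrow>
     u \<in> borel_measurable lebesgue \<longrightarrow> v \<in> borel_measurable lebesgue \<longrightarrow>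
     (\<forall>x. 0 \<le> v x) \<longrightarrow> (\<lambda>x. ennreal (u x)) \<in> Ainf \<longrightarrow> dual_weight p v \<in> Ainf \<longrightarrow>
     weight_ratio p q u v \<in> Ainf \<longrightarrow>
     Ainf_const (\<lambda>x. ennreal (u x)) = a \<longrightarrow> Ainf_const (dual_weight p v) = b \<longrightarrow>
     Ainf_const (weight_ratio p q u v) = c \<longrightarrow>
     ennreal \<theta> * esssup lebesgue (maximal (Theta CARD('n) \<alpha> p q) (weight_ratio p q u v)) \<le> A_const \<alpha> p q u v \<and>
     A_const \<alpha> p q u v \<le> ennreal (inverse \<theta>) * esssup lebesgue (maximal (Theta CARD('n) \<alpha> p q) (weight_ratio p q u v)))"
proof -
  have d: "(1 / 8 :: real) > 0" by simp
  from Ainf_level_exists[OF d, of a, where 'n = 'n] obtain \<gamma>1 where g1: "0 < \<gamma>1" "\<gamma>1 \<le> 1"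
    and lev1: "\<And>(w :: real ^ 'n \<Rightarrow> ennreal) Q. w \<in> Ainf \<Longrightarrow> Ainf_const w = a \<Longrightarrow> Q \<in> cubes \<Longrightarrow>
     emeasure lebesgue {x\<in>Q. w x < ennreal \<gamma>1 * avg Q w} \<le> ennreal (1 / 8) * emeasure lebesgue Q"
    by blast
  from Ainf_level_exists[OF d, of b, where 'n = 'n] obtain \<gamma>2 where g2: "0 < \<gamma>2" "\<gamma>2 \<le> 1"
    and lev2: "\<And>(w :: real ^ 'n \<Rightarrow> ennreal) Q. w \<in> Ainf \<Longrightarrow> Ainf_const w = b \<Longrightarrow> Q \<in> cubes \<Longrightarrow>
     emeasure lebesgue {x\<in>Q. w x < ennreal \<gamma>2 * avg Q w} \<le> ennreal (1 / 8) * emeasure lebesgue Q"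
    by blast
  from Ainf_level_exists[OF d, of c, where 'n = 'n] obtain \<gamma>3 where g3: "0 < \<gamma>3" "\<gamma>3 \<le> 1"
    and lev3: "\<And>(w :: real ^ 'n \<Rightarrow> ennreal) Q. w \<in> Ainf \<Longrightarrow> Ainf_const w = c \<Longrightarrow> Q \<in> cubes \<Longrightarrow>
     emeasure lebesgue {x\<in>Q. w x < ennreal \<gamma>3 * avg Q w} \<le> ennreal (1 / 8) * emeasure lebesgue Q"
    by blast
  \<comment> \<open>One comparison loses \<open>\<gamma>1 * \<gamma>2\<close> and a factor 8 from
    Markov, the other \<open>\<gamma>3\<close> and \<open>8 * 8\<close>. This value is small enough
    for both.\<close>
  define \<theta> where "\<theta> = \<gamma>1 * \<gamma>2 * \<gamma>3 / 64"
  have "\<gamma>1 * \<gamma>2 \<le> 1" using g1 g2 by (simp add: mult_le_one)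
  then have "\<gamma>1 * \<gamma>2 * \<gamma>3 \<le> 1" using g1 g2 g3 by (simp add: mult_le_one)
  then have \<theta>: "\<theta> > 0" "\<theta> < 1"
    using g1 g2 g3 by (simp_all add: \<theta>_def)
  have \<theta>1: "\<theta> * 8 \<le> \<gamma>1 * \<gamma>2"
  proof -
    have "\<gamma>1 * \<gamma>2 * \<gamma>3 \<le> \<gamma>1 * \<gamma>2 * 1"
      using g1 g2 g3 by (intro mult_left_mono) auto
    moreover have "0 < \<gamma>1 * \<gamma>2" using g1 g2 by simp
    ultimately show ?thesis by (simp add: \<theta>_def)
  qed
  have \<theta>2: "\<theta> * 64 \<le> \<gamma>3"
  proof -
    have "\<gamma>1 * \<gamma>2 * \<gamma>3 \<le> 1 * \<gamma>3"
      using g3 \<open>\<gamma>1 * \<gamma>2 \<le> 1\<close> by (intro mult_right_mono) auto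
    then show ?thesis by (simp add: \<theta>_def)
  qed
  have "ennreal \<theta> * esssup lebesgue (maximal (Theta CARD('n) \<alpha> p q) (weight_ratio p q u v)) \<le> A_const \<alpha> p q u v \<and>
     A_const \<alpha> p q u v \<le> ennreal (inverse \<theta>) * esssup lebesgue (maximal (Theta CARD('n) \<alpha> p q) (weight_ratio p q u v))"
    if p: "1 < p" "p \<le> q"
      and [measurable]: "u \<in> borel_measurable lebesgue" "v \<in> borel_measurable lebesgue"
      and v: "\<forall>x. 0 \<le> v x" and u': "(\<lambda>x. ennreal (u x)) \<in> Ainf" and v': "dual_weight p v \<in> Ainf"
      and w': "weight_ratio p q u v \<in> Ainf"
      and a: "Ainf_const (\<lambda>x. ennreal (u x)) = a" and b: "Ainf_const (dual_weight p v) = b"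
      and c: "Ainf_const (weight_ratio p q u v) = c"
    for p q \<alpha> and u v :: "real ^ 'n \<Rightarrow> real"
  proof -
    define \<sigma> where "\<sigma> = dual_weight p v"
    define w where "w = weight_ratio p q u v"
    define t where "t = Theta CARD('n) \<alpha> p q / real CARD('n)"
    note [measurable] = weight_ratio_measurable[of u v p q, folded w_def]
    have [measurable]: "\<sigma> \<in> borel_measurable lebesgue"
      using Ainf_measurable[OF v'] by (simp add: \<sigma>_def)
    have cube: "ennreal \<theta> * avg Q w \<le> epowr (avg Q (\<lambda>x. ennreal (u x))) (1 / q) * epowr (avg Q \<sigma>) (1 / conj_exp p)"
      "ennreal \<theta> * (epowr (avg Q (\<lambda>x. ennreal (u x))) (1 / q) * epowr (avg Q \<sigma>) (1 / conj_exp p)) \<le> avg Q w"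
      if Q: "Q \<in> cubes" for Q
    proof -
      note [measurable] = cubes_sets[OF Q]
      define U where "U = avg Q (\<lambda>x. ennreal (u x))"
      define S where "S = avg Q \<sigma>"
      define W where "W = avg Q w"
      define Y where "Y = epowr U (1 / q) * epowr S (1 / conj_exp p)"
      have b1: "emeasure lebesgue {x\<in>Q. ennreal (u x) < ennreal \<gamma>1 * U} \<le> ennreal (1 / 8) * emeasure lebesgue Q"
        unfolding U_def by (rule lev1[OF u' a Q])
      have b2: "emeasure lebesgue {x\<in>Q. \<sigma> x < ennreal \<gamma>2 * S} \<le> ennreal (1 / 8) * emeasure lebesgue Q"
        unfolding S_def \<sigma>_def by (rule lev2[OF v' b Q])
      have b3: "emeasure lebesgue {x\<in>Q. w x > ennreal 8 * W} \<le> ennreal (1 / 8) * emeasure lebesgue Q"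
        unfolding W_def w_def by (rule markov_cube[OF Ainf_loc_integrable[OF w'] Q]) simp
      have m1: "{x\<in>Q. ennreal (u x) < ennreal \<gamma>1 * U} \<in> sets lebesgue" by measurable
      have m2: "{x\<in>Q. \<sigma> x < ennreal \<gamma>2 * S} \<in> sets lebesgue" by measurable
      have m3: "{x\<in>Q. w x > ennreal 8 * W} \<in> sets lebesgue" by measurable
      obtain x where x: "x \<in> Q" "x \<notin> {x\<in>Q. ennreal (u x) < ennreal \<gamma>1 * U}"
          "x \<notin> {x\<in>Q. \<sigma> x < ennreal \<gamma>2 * S}" "x \<notin> {x\<in>Q. w x > ennreal 8 * W}"
        using exists_good_point[OF Q m1 m2 m3 b1 b2 b3] by blast
      have "ennreal (\<theta> * 8) * Y \<le> ennreal (\<gamma>1 * \<gamma>2) * Y"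
        by (intro mult_right_mono ennreal_leI \<theta>1) auto
      also have "\<dots> \<le> w x"
        unfolding w_def Y_def using p v g1 g2 x
        by (intro weight_ratio_ge) (auto simp: \<sigma>_def not_less)
      also have "\<dots> \<le> ennreal 8 * W"
        using x by (auto simp: not_less)
      finally have "ennreal (1 / 8) * (ennreal (\<theta> * 8) * Y) \<le> ennreal (1 / 8) * (ennreal 8 * W)"
        by (intro mult_left_mono) auto
      moreover have "ennreal (1 / 8) * (ennreal (\<theta> * 8) * Y) = ennreal \<theta> * Y"
        using \<theta> by (simp add: mult.assoc[symmetric] flip: ennreal_mult)
      moreover have "ennreal (1 / 8) * (ennreal 8 * W) = W"
        by (simp add: mult.assoc[symmetric] flip: ennreal_mult del: ennreal_numeral)
      ultimately show "ennreal \<theta> * (epowr (avg Q (\<lambda>x. ennreal (u x))) (1 / q) * epowr (avg Q \<sigma>) (1 / conj_exp p)) \<le> avg Q w"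
        by (simp add: Y_def U_def S_def W_def)
      have b1: "emeasure lebesgue {x\<in>Q. w x < ennreal \<gamma>3 * W} \<le> ennreal (1 / 8) * emeasure lebesgue Q"
        unfolding W_def w_def by (rule lev3[OF w' c Q])
      have b2: "emeasure lebesgue {x\<in>Q. ennreal (u x) > ennreal 8 * U} \<le> ennreal (1 / 8) * emeasure lebesgue Q"
        unfolding U_def by (rule markov_cube[OF Ainf_loc_integrable[OF u'] Q]) simp
      have b3: "emeasure lebesgue {x\<in>Q. \<sigma> x > ennreal 8 * S} \<le> ennreal (1 / 8) * emeasure lebesgue Q"
        unfolding S_def \<sigma>_def by (rule markov_cube[OF Ainf_loc_integrable[OF v'] Q]) simp
      have m1: "{x\<in>Q. w x < ennreal \<gamma>3 * W} \<in> sets lebesgue" by measurable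
      have m2: "{x\<in>Q. ennreal (u x) > ennreal 8 * U} \<in> sets lebesgue" by measurable
      have m3: "{x\<in>Q. \<sigma> x > ennreal 8 * S} \<in> sets lebesgue" by measurable
      obtain x where x: "x \<in> Q" "x \<notin> {x\<in>Q. w x < ennreal \<gamma>3 * W}"
          "x \<notin> {x\<in>Q. ennreal (u x) > ennreal 8 * U}" "x \<notin> {x\<in>Q. \<sigma> x > ennreal 8 * S}"
        using exists_good_point[OF Q m1 m2 m3 b1 b2 b3] by blast
      have "ennreal (\<theta> * 64) * W \<le> ennreal \<gamma>3 * W"
        by (intro mult_right_mono ennreal_leI \<theta>2) auto
      also have "\<dots> \<le> w x"
        using x by (auto simp: not_less)
      also have "\<dots> \<le> ennreal (8 * 8) * Y"
        unfolding w_def Y_def using p v x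
        by (intro weight_ratio_le) (auto simp: \<sigma>_def not_less)
      finally have "ennreal (1 / 64) * (ennreal (\<theta> * 64) * W) \<le> ennreal (1 / 64) * (ennreal (8 * 8) * Y)"
        by (intro mult_left_mono) auto
      moreover have "ennreal (1 / 64) * (ennreal (\<theta> * 64) * W) = ennreal \<theta> * W"
        using \<theta> by (simp add: mult.assoc[symmetric] flip: ennreal_mult)
      moreover have "ennreal (1 / 64) * (ennreal (8 * 8) * Y) = Y"
        by (simp add: mult.assoc[symmetric] flip: ennreal_mult del: ennreal_numeral)
      ultimately show "ennreal \<theta> * avg Q w \<le> epowr (avg Q (\<lambda>x. ennreal (u x))) (1 / q) * epowr (avg Q \<sigma>) (1 / conj_exp p)"
        by (simp add: Y_def U_def S_def W_def)
    qed
    have M: "esssup lebesgue (maximal (Theta CARD('n) \<alpha> p q) w) = (SUP Q\<in>cubes. epowr (emeasure lebesgue Q) t * avg Q w)"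
      unfolding t_def w_def by (intro esssup_maximal Ainf_loc_integrable w')
    have A: "A_const \<alpha> p q u v = (SUP Q\<in>cubes. epowr (emeasure lebesgue Q) t
        * (epowr (avg Q (\<lambda>x. ennreal (u x))) (1 / q) * epowr (avg Q \<sigma>) (1 / conj_exp p)))"
      by (simp add: A_const_def t_def \<sigma>_def mult.assoc)
    have "ennreal \<theta> * esssup lebesgue (maximal (Theta CARD('n) \<alpha> p q) w) \<le> A_const \<alpha> p q u v"
      unfolding M A SUP_mult_left_ennreal
      by (intro SUP_subset_mono order_refl, subst mult.left_commute, intro mult_left_mono cube) auto
    moreover have "A_const \<alpha> p q u v = ennreal (inverse \<theta>) * (ennreal \<theta> * A_const \<alpha> p q u v)"
      using \<theta> by (simp add: mult.assoc[symmetric] flip: ennreal_mult)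
    moreover have "ennreal \<theta> * A_const \<alpha> p q u v \<le> esssup lebesgue (maximal (Theta CARD('n) \<alpha> p q) w)"
      unfolding M A SUP_mult_left_ennreal
      by (intro SUP_subset_mono order_refl, subst mult.left_commute, intro mult_left_mono cube) auto
    ultimately show ?thesis
      unfolding w_def by (metis mult_left_mono zero_le)
  qed
  with \<theta> show ?thesis by (intro exI[of _ \<theta>]) blast
qed

section \<open>Dyadic cubes\<close>

definition side :: "int \<times> (int ^ 'n) \<Rightarrow> real" where
  "side i = 2 powr real_of_int (fst i)"

lemma side_pos [simp]: "side i > 0" "side i \<ge> 0" "side i \<noteq> 0"
  by (simp_all add: side_def)

lemma side_le_iff: "side i \<le> side j \<longleftrightarrow> fst i \<le> fst j"
  by (simp add: side_def)

text \<open>Half-open cubes, indexed by scale and by the corner in units of the side. With floors,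
  the cubes of one scale partition space and passing to an ancestor is integer division of the
  corner.\<close>

definition dyadic :: "int \<times> (int ^ 'n) \<Rightarrow> (real ^ 'n) set" where
  "dyadic i = {x. \<forall>j. \<lfloor>x $ j / side i\<rfloor> = snd i $ j}"

text \<open>The closed cube concentric with \<^term>\<open>dyadic i\<close> whose side is \<open>2 t + 1\<close> times as long.\<close>

definition dilate :: "real \<Rightarrow> int \<times> (int ^ 'n) \<Rightarrow> (real ^ 'n) set" where
  "dilate t i = (let a = (\<chi> j. (real_of_int (snd i $ j) - t) * side i)
     in cbox a (a + (\<chi> j. (2 * t + 1) * side i)))"

lemma mem_dyadic:
  "x \<in> dyadic i \<longleftrightarrow> (\<forall>j. real_of_int (snd i $ j) * side i \<le> x $ j \<and> x $ j < (real_of_int (snd i $ j) + 1) * side i)"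
  by (simp add: dyadic_def floor_eq_iff field_simps)

lemma mem_dilate:
  "x \<in> dilate t i \<longleftrightarrow> (\<forall>j. (real_of_int (snd i $ j) - t) * side i \<le> x $ j \<and> x $ j \<le> (real_of_int (snd i $ j) + t + 1) * side i)"
  by (simp add: dilate_def Let_def mem_box_cart algebra_simps)

lemma dyadic_subset_dilate: "t \<ge> 0 \<Longrightarrow> dyadic i \<subseteq> dilate t i"
proof
  fix x assume t: "t \<ge> 0" and x: "x \<in> dyadic i"
  show "x \<in> dilate t i"
    unfolding mem_dilate
  proof
    fix j
    have "(real_of_int (snd i $ j) - t) * side i \<le> real_of_int (snd i $ j) * side i"
      "(real_of_int (snd i $ j) + 1) * side i \<le> (real_of_int (snd i $ j) + t + 1) * side i"
      using t by (intro mult_right_mono; simp)+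
    then show "(real_of_int (snd i $ j) - t) * side i \<le> x $ j \<and> x $ j \<le> (real_of_int (snd i $ j) + t + 1) * side i"
      using x[unfolded mem_dyadic, rule_format, of j] by linarith
  qed
qed

lemma dilate_cubes: "t \<ge> 0 \<Longrightarrow> dilate t i \<in> cubes"
  unfolding dilate_def Let_def by (intro cube_mem_cubes) simp

lemma emeasure_dilate:
  fixes i :: "int \<times> (int ^ 'n)"
  shows "t \<ge> 0 \<Longrightarrow> emeasure lebesgue (dilate t i) = ennreal (((2 * t + 1) * side i) ^ CARD('n))"
  unfolding dilate_def Let_def by (subst emeasure_lebesgue_cube) auto

lemma dyadic_sets_borel:
  fixes i :: "int \<times> (int ^ 'n)"
  shows "dyadic i \<in> sets borel"
proof -
  have "{x :: real ^ 'n. \<lfloor>x $ j / side i\<rfloor> = snd i $ j} \<in> sets borel" for j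
    by measurable
  then show ?thesis
    unfolding dyadic_def by (simp add: sets.sets_Collect_finite_All)
qed

lemma dyadic_sets [measurable]: "dyadic i \<in> sets lebesgue"
  using dyadic_sets_borel[of i] by simp

lemma dilate_sets [measurable]: "dilate t i \<in> sets lebesgue"
  by (simp add: dilate_def Let_def)

text \<open>The half-open cube lies between an open box and a closed cube of equal measure.\<close>

lemma emeasure_dyadic:
  fixes i :: "int \<times> (int ^ 'n)"
  shows "emeasure lebesgue (dyadic i) = ennreal ((side i) ^ CARD('n))"
proof -
  let ?a = "(\<chi> j. real_of_int (snd i $ j) * side i) :: real ^ 'n"
  let ?b = "?a + (\<chi> j. side i)"
  have 0: "dilate 0 i = cbox ?a ?b"
    by (simp add: dilate_def Let_def)
  have "emeasure lborel (box ?a ?b) = emeasure lborel (cbox ?a ?b)"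
    by (simp add: emeasure_lborel_box_eq emeasure_lborel_cbox_eq)
  then have "emeasure lebesgue (box ?a ?b) = emeasure lebesgue (dilate 0 i)"
    unfolding 0 by (simp add: emeasure_completion_sets)
  moreover have "box ?a ?b \<subseteq> dyadic i"
    by (auto simp: mem_box_cart mem_dyadic less_imp_le algebra_simps)
  then have "emeasure lebesgue (box ?a ?b) \<le> emeasure lebesgue (dyadic i)"
    by (intro emeasure_mono) auto
  moreover have "emeasure lebesgue (dyadic i) \<le> emeasure lebesgue (dilate 0 i)"
    by (intro emeasure_mono dyadic_subset_dilate) auto
  ultimately have "emeasure lebesgue (dyadic i) = emeasure lebesgue (dilate 0 i)"
    by (metis antisym)
  then show ?thesis by (simp add: emeasure_dilate)
qed

lemma dyadic_parent:
  assumes x: "x \<in> dyadic i" "x \<in> dyadic i'" and le: "fst i \<le> fst i'"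
  shows "snd i' $ j = snd i $ j div 2 ^ nat (fst i' - fst i)"
proof -
  define d where "d = nat (fst i' - fst i)"
  have "side i' = side i * real_of_int (2 ^ d)"
    using le by (simp add: d_def side_def powr_add[symmetric] flip: powr_realpow)
  then have "x $ j / side i' = (x $ j / side i) / real_of_int (2 ^ d)"
    by simp
  then have "\<lfloor>x $ j / side i'\<rfloor> = \<lfloor>x $ j / side i\<rfloor> div 2 ^ d"
    by (simp only:) (rule floor_divide_real_eq_div, simp)
  then show ?thesis using x by (simp add: dyadic_def d_def)
qed

lemma dyadic_eq:
  assumes "x \<in> dyadic i" "x \<in> dyadic i'" "fst i = fst i'"
  shows "i = i'"
  using assms by (auto simp: dyadic_def side_def prod_eq_iff vec_eq_iff)

text \<open>In units of the smaller side all corners are integers, and nesting is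
  \<open>m' * N \<le> m < (m' + 1) * N\<close>. Triples inherit it: one small side more on each end
  stays within one large side more, as \<open>N \<ge> 1\<close>.\<close>

lemma dyadic_nested:
  assumes x: "x \<in> dyadic i" "x \<in> dyadic i'" and le: "fst i \<le> fst i'"
  shows "dyadic i \<subseteq> dyadic i'" "dilate 1 i \<subseteq> dilate 1 i'"
proof -
  define d where "d = nat (fst i' - fst i)"
  define N where "N = (2 :: int) ^ d"
  have N: "N \<ge> 1" by (simp add: N_def)
  have s: "side i' = side i * real_of_int N"
    using le by (simp add: d_def N_def side_def powr_add[symmetric] flip: powr_realpow)
  have par: "snd i' $ j = snd i $ j div N" for j
    using dyadic_parent[OF assms] by (simp add: N_def d_def)
  have lo: "snd i' $ j * N \<le> snd i $ j" and hi: "snd i $ j + 1 \<le> (snd i' $ j + 1) * N" for j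
  proof -
    have "snd i $ j = snd i' $ j * N + snd i $ j mod N"
      by (simp add: par)
    moreover have "0 \<le> snd i $ j mod N" "snd i $ j mod N < N"
      using N by simp_all
    ultimately show "snd i' $ j * N \<le> snd i $ j" "snd i $ j + 1 \<le> (snd i' $ j + 1) * N"
      by (simp_all add: distrib_right)
  qed
  show "dyadic i \<subseteq> dyadic i'"
  proof
    fix y assume y: "y \<in> dyadic i"
    show "y \<in> dyadic i'"
      unfolding mem_dyadic
    proof
      fix j
      have "real_of_int (snd i' $ j * N) * side i \<le> real_of_int (snd i $ j) * side i"
        "real_of_int (snd i $ j + 1) * side i \<le> real_of_int ((snd i' $ j + 1) * N) * side i"
        using lo[of j] hi[of j] by (intro mult_right_mono; simp only: of_int_le_iff side_pos)+
      moreover have "real_of_int (snd i' $ j) * side i' = real_of_int (snd i' $ j * N) * side i"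
        "(real_of_int (snd i' $ j) + 1) * side i' = real_of_int ((snd i' $ j + 1) * N) * side i"
        "real_of_int (snd i $ j + 1) = real_of_int (snd i $ j) + 1"
        by (simp_all add: s)
      ultimately show "real_of_int (snd i' $ j) * side i' \<le> y $ j \<and> y $ j < (real_of_int (snd i' $ j) + 1) * side i'"
        using y[unfolded mem_dyadic, rule_format, of j] by (metis order_trans order_less_le_trans)
    qed
  qed
  show "dilate 1 i \<subseteq> dilate 1 i'"
  proof
    fix y assume y: "y \<in> dilate 1 i"
    show "y \<in> dilate 1 i'"
      unfolding mem_dilate
    proof
      fix j
      have "(snd i' $ j - 1) * N \<le> snd i $ j - 1" "snd i $ j + 2 \<le> (snd i' $ j + 2) * N"
        using lo[of j] hi[of j] N by (simp_all add: algebra_simps)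
      then have "real_of_int ((snd i' $ j - 1) * N) * side i \<le> real_of_int (snd i $ j - 1) * side i"
        "real_of_int (snd i $ j + 2) * side i \<le> real_of_int ((snd i' $ j + 2) * N) * side i"
        by (intro mult_right_mono; simp only: of_int_le_iff side_pos)+
      moreover have "(real_of_int (snd i' $ j) - 1) * side i' = real_of_int ((snd i' $ j - 1) * N) * side i"
        "(real_of_int (snd i' $ j) + 1 + 1) * side i' = real_of_int ((snd i' $ j + 2) * N) * side i"
        "real_of_int (snd i $ j - 1) = real_of_int (snd i $ j) - 1"
        "real_of_int (snd i $ j + 2) = real_of_int (snd i $ j) + 1 + 1"
        by (simp_all add: s)
      ultimately show "(real_of_int (snd i' $ j) - 1) * side i' \<le> y $ j \<and> y $ j \<le> (real_of_int (snd i' $ j) + 1 + 1) * side i'"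
        using y[unfolded mem_dilate, rule_format, of j] by (metis order_trans)
    qed
  qed
qed

text \<open>The smaller triple has side at most \<open>3 * side i'\<close>, so it reaches at most
  that far beyond the larger one; one plus three sides on each end make 4.\<close>

lemma dilate_vitali:
  assumes "dilate 1 i \<inter> dilate 1 i' \<noteq> {}" "fst i \<le> fst i'"
  shows "dilate 1 i \<subseteq> dilate 4 i'"
proof
  fix y assume y: "y \<in> dilate 1 i"
  obtain x where x: "x \<in> dilate 1 i" "x \<in> dilate 1 i'" using assms by blast
  have s: "side i \<le> side i'" using assms by (simp add: side_le_iff)
  show "y \<in> dilate 4 i'"
    unfolding mem_dilate
  proof
    fix j
    show "(real_of_int (snd i' $ j) - 4) * side i' \<le> y $ j \<and> y $ j \<le> (real_of_int (snd i' $ j) + 4 + 1) * side i'"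
      using x y s unfolding mem_dilate by (auto simp: algebra_simps dest!: spec[of _ j])
  qed
qed

section \<open>Bounded overlap of triples and geometric sums over scales\<close>

lemma finite_bounded_int_vec: "finite {m :: int ^ 'n. \<forall>j. \<bar>m $ j\<bar> \<le> b}"
proof (rule finite_subset)
  show "{m :: int ^ 'n. \<forall>j. \<bar>m $ j\<bar> \<le> b} \<subseteq> (\<lambda>f. \<chi> j. f j) ` (PiE UNIV (\<lambda>_. {-b..b}))"
  proof
    fix m :: "int ^ 'n" assume "m \<in> {m. \<forall>j. \<bar>m $ j\<bar> \<le> b}"
    then show "m \<in> (\<lambda>f. \<chi> j. f j) ` (PiE UNIV (\<lambda>_. {-b..b}))"
      by (intro image_eqI[of _ _ "\<lambda>j. m $ j"]) (auto simp: vec_eq_iff abs_le_iff minus_le_iff)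
  qed
qed (auto intro!: finite_PiE)

text \<open>Equal to \<open>5 ^ CARD('n)\<close>; serves as a bound for the number of triples of one
  scale through a point. The type argument carries the dimension.\<close>

definition overlap :: "('n::finite) itself \<Rightarrow> nat" where
  "overlap _ = card {m :: int ^ 'n. \<forall>j. \<bar>m $ j\<bar> \<le> 2}"

lemma dilate_overlap:
  fixes x :: "real ^ 'n"
  assumes "finite F" "\<And>i. i \<in> F \<Longrightarrow> fst i = k \<and> x \<in> dilate 1 i"
  shows "card F \<le> overlap TYPE('n)"
  unfolding overlap_def
proof (rule card_inj_on_le)
  define c :: "int ^ 'n" where "c = (\<chi> j. \<lfloor>x $ j / 2 powr k\<rfloor>)"
  show "inj_on (\<lambda>i. snd i - c) F"
    using assms(2) by (intro inj_onI) (metis diff_add_cancel prod_eq_iff)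
  show "(\<lambda>i. snd i - c) ` F \<subseteq> {m. \<forall>j. \<bar>m $ j\<bar> \<le> 2}"
  proof clarify
    fix a m j assume "(a, m) \<in> F"
    with assms(2) have "a = k" "x \<in> dilate 1 (k, m)" by force+
    then have "real_of_int (m $ j) - 1 \<le> x $ j / 2 powr k" "x $ j / 2 powr k \<le> real_of_int (m $ j) + 2"
      by (auto simp: mem_dilate side_def field_simps dest!: spec[of _ j])
    then have "m $ j - 1 \<le> c $ j" "c $ j \<le> m $ j + 2"
      unfolding c_def by (simp_all, linarith+)
    then show "\<bar>(snd (a, m) - c) $ j\<bar> \<le> 2" by simp
  qed
qed (rule finite_bounded_int_vec)

lemma sum_powr_le:
  assumes "finite K" "\<And>k. k \<in> K \<Longrightarrow> k \<le> k0" "\<beta> > 0"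
  shows "(\<Sum>k\<in>K. 2 powr (real_of_int k * \<beta>)) \<le> 2 powr (real_of_int k0 * \<beta>) / (1 - 2 powr (- \<beta>))"
proof -
  define r where "r = (2::real) powr (- \<beta>)"
  have r: "0 < r" "r < 1"
    using assms(3) powr_less_mono[of "- \<beta>" 0 2] by (auto simp: r_def)
  have "(\<Sum>k\<in>K. 2 powr (real_of_int k * \<beta>)) = (\<Sum>k\<in>K. 2 powr (real_of_int k0 * \<beta>) * r ^ nat (k0 - k))"
  proof (intro sum.cong refl)
    fix k assume "k \<in> K"
    then have "k \<le> k0" using assms by simp
    then have "r ^ nat (k0 - k) = 2 powr (- \<beta> * real_of_int (k0 - k))"
      using r(1) by (simp add: r_def powr_powr flip: powr_realpow)
    then show "2 powr (real_of_int k * \<beta>) = 2 powr (real_of_int k0 * \<beta>) * r ^ nat (k0 - k)"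
      by (simp add: algebra_simps flip: powr_add)
  qed
  also have "\<dots> = 2 powr (real_of_int k0 * \<beta>) * (\<Sum>n\<in>(\<lambda>k. nat (k0 - k)) ` K. r ^ n)"
  proof (subst sum.reindex)
    show "inj_on (\<lambda>k. nat (k0 - k)) K"
    proof (rule inj_onI)
      fix k k' assume "k \<in> K" "k' \<in> K" "nat (k0 - k) = nat (k0 - k')"
      then show "k = k'" using assms(2)[of k] assms(2)[of k'] by simp
    qed
  qed (simp add: sum_distrib_left)
  also have "(\<Sum>n\<in>(\<lambda>k. nat (k0 - k)) ` K. r ^ n) \<le> (\<Sum>n. r ^ n)"
    using r assms by (intro sum_le_suminf summable_geometric) auto
  also have "\<dots> = 1 / (1 - r)"
    using r by (intro suminf_geometric) auto
  finally show ?thesis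
    by (simp add: r_def mult_left_mono)
qed

text \<open>At most \<open>overlap\<close> triples of each scale contain \<open>x\<close>, and the
  geometric series over the scales that remains is dominated by its largest term.\<close>

lemma sum_dilate_le:
  fixes x :: "real ^ 'n"
  assumes F: "finite F" "\<And>i. i \<in> F \<Longrightarrow> fst i \<le> k0 \<and> x \<in> dilate 1 i" and \<alpha>: "\<alpha> > 0"
  shows "(\<Sum>i\<in>F. 2 powr (real_of_int (fst i) * \<alpha>)) \<le> overlap TYPE('n) * (2 powr (real_of_int k0 * \<alpha>) / (1 - 2 powr (- \<alpha>)))"
proof -
  have "(\<Sum>i\<in>F. 2 powr (real_of_int (fst i) * \<alpha>)) = (\<Sum>k\<in>fst ` F. \<Sum>i\<in>{i\<in>F. fst i = k}. 2 powr (real_of_int (fst i) * \<alpha>))"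
    using F(1) by (rule sum.image_gen)
  also have "\<dots> = (\<Sum>k\<in>fst ` F. real (card {i\<in>F. fst i = k}) * 2 powr (real_of_int k * \<alpha>))"
    by (intro sum.cong refl) simp
  also have "\<dots> \<le> (\<Sum>k\<in>fst ` F. real (overlap TYPE('n)) * 2 powr (real_of_int k * \<alpha>))"
    using F by (intro sum_mono mult_right_mono of_nat_mono dilate_overlap[where x = x]) auto
  also have "\<dots> = overlap TYPE('n) * (\<Sum>k\<in>fst ` F. 2 powr (real_of_int k * \<alpha>))"
    by (simp add: sum_distrib_left)
  also have "\<dots> \<le> overlap TYPE('n) * (2 powr (real_of_int k0 * \<alpha>) / (1 - 2 powr (- \<alpha>)))"
    using F \<alpha> by (intro mult_left_mono sum_powr_le) auto
  finally show ?thesis .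
qed

text \<open>Take the dyadic cube of \<open>y\<close> whose side is the power of two with
  \<open>side / 2 < norm (x - y) \<le> side\<close>. The upper bound puts \<open>x\<close> into its
  triple, the lower bound costs the factor \<open>2 powr \<beta>\<close>.\<close>

lemma kernel_le_dyadic:
  fixes x y :: "real ^ 'n"
  assumes "x \<noteq> y" "\<beta> > 0"
  obtains i where "y \<in> dyadic i" "x \<in> dilate 1 i"
    "1 / norm (x - y) powr \<beta> \<le> 2 powr \<beta> * 2 powr (- real_of_int (fst i) * \<beta>)"
proof -
  define k where "k = \<lceil>log 2 (norm (x - y))\<rceil>"
  have pos: "norm (x - y) > 0" using assms by simp
  have k1: "norm (x - y) \<le> 2 powr k"
    using pos by (simp add: k_def log_le_iff[symmetric] le_of_int_ceiling)
  have "real_of_int k - 1 < log 2 (norm (x - y))"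
    unfolding k_def by linarith
  then have k2: "2 powr (real_of_int k - 1) < norm (x - y)"
    using pos by (simp add: less_log_iff)
  define i where "i = (k, (\<chi> j. \<lfloor>y $ j / 2 powr k\<rfloor>) :: int ^ 'n)"
  have y: "y \<in> dyadic i" by (simp add: i_def side_def dyadic_def)
  moreover have "x \<in> dilate 1 i"
    unfolding mem_dilate
  proof
    fix j
    have "\<bar>x $ j - y $ j\<bar> \<le> side i"
      using component_le_norm_cart[of "x - y" j] k1 by (simp add: i_def side_def)
    then show "(real_of_int (snd i $ j) - 1) * side i \<le> x $ j \<and> x $ j \<le> (real_of_int (snd i $ j) + 1 + 1) * side i"
      using y unfolding mem_dyadic by (auto simp: algebra_simps abs_le_iff dest!: spec[of _ j])
  qed
  moreover have "1 / norm (x - y) powr \<beta> \<le> 2 powr \<beta> * 2 powr (- real_of_int (fst i) * \<beta>)"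
  proof -
    have "(2 powr (real_of_int k - 1)) powr \<beta> \<le> norm (x - y) powr \<beta>"
      using k2 assms by (intro powr_mono2) auto
    then have "1 / norm (x - y) powr \<beta> \<le> 1 / (2 powr (real_of_int k - 1)) powr \<beta>"
      using pos by (intro divide_left_mono) auto
    also have "\<dots> = 2 powr \<beta> * 2 powr (- real_of_int (fst i) * \<beta>)"
      by (simp add: i_def powr_powr powr_minus[symmetric] divide_inverse algebra_simps flip: powr_add)
    finally show ?thesis .
  qed
  ultimately show ?thesis using that by blast
qed

section \<open>Sparse families and the Carleson embedding\<close>

text \<open>Elements are treated by decreasing \<open>s\<close>, and one is kept unless it is
  related to something already kept. Both the stopping cubes and the Vitali covering arise in this
  way. For equal \<open>s\<close> the exclusion is claimed in both directions while only one is
  tested; \<open>tie\<close> closes that gap.\<close>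

lemma greedy_selection:
  fixes s :: "'a \<Rightarrow> int"
  assumes "finite F" and refl: "\<And>i. R i i"
    and tie: "\<And>i j. s i = s j \<Longrightarrow> R i j \<Longrightarrow> R j i"
  shows "\<exists>T\<subseteq>F. (\<forall>i\<in>F. \<exists>j\<in>T. s i \<le> s j \<and> R i j) \<and> (\<forall>i\<in>T. \<forall>j\<in>T. i \<noteq> j \<longrightarrow> s i \<le> s j \<longrightarrow> \<not> R i j)"
  using assms(1)
\<comment> \<open>Ranking by \<open>- s\<close> makes the inserted element one of smallest
  \<open>s\<close>.\<close>
proof (induction F rule: finite_ranking_induct[where f = "\<lambda>i. - s i"])
  case (insert x S)
  obtain T where "T \<subseteq> S \<and> (\<forall>i\<in>S. \<exists>j\<in>T. s i \<le> s j \<and> R i j)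
      \<and> (\<forall>i\<in>T. \<forall>j\<in>T. i \<noteq> j \<longrightarrow> s i \<le> s j \<longrightarrow> \<not> R i j)"
    using insert.IH by (rule exE)
  then have T: "T \<subseteq> S" "\<forall>i\<in>S. \<exists>j\<in>T. s i \<le> s j \<and> R i j"
    "\<forall>i\<in>T. \<forall>j\<in>T. i \<noteq> j \<longrightarrow> s i \<le> s j \<longrightarrow> \<not> R i j"
    by simp_all
  have min: "s x \<le> s y" if "y \<in> S" for y
    using insert.hyps(2)[OF that] by simp
  show ?case
  proof (cases "\<exists>j\<in>T. R x j")
    case True
    then have "\<exists>j\<in>T. s x \<le> s j \<and> R x j" using T(1) min by blast
    then have "\<forall>i\<in>insert x S. \<exists>j\<in>T. s i \<le> s j \<and> R i j"
      using T(2) by simp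
    then show ?thesis using T(1,3) by (intro exI[of _ T]) auto
  next
    case False
    have "\<forall>i\<in>insert x S. \<exists>j\<in>insert x T. s i \<le> s j \<and> R i j"
      using T(2) refl[of x] by auto
    moreover have "\<forall>i\<in>insert x T. \<forall>j\<in>insert x T. i \<noteq> j \<longrightarrow> s i \<le> s j \<longrightarrow> \<not> R i j"
    proof (intro ballI impI)
      fix i j assume ij: "i \<in> insert x T" "j \<in> insert x T" "i \<noteq> j" "s i \<le> s j"
      consider "i \<in> T" "j \<in> T" | "i = x" "j \<in> T" | "i \<in> T" "j = x" using ij by blast
      then show "\<not> R i j"
      proof cases
        case 1
        then show ?thesis using T(3) ij by blast
      next
        case 2
        then show ?thesis using False by blast
      next
        case 3
        then have "s i = s j" using ij(4) min[of i] T(1) by auto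
        then show ?thesis using 3 False tie by blast
      qed
    qed
    ultimately show ?thesis
      using insert_mono[OF T(1)] by (intro exI[of _ "insert x T"] conjI)
  qed
qed auto

text \<open>Greedy selection for the relation of meeting each other: for dyadic cubes it yields the
  maximal ones, for triples a Vitali family.\<close>

lemma disjoint_selection:
  fixes s :: "'a \<Rightarrow> int" and D :: "'a \<Rightarrow> 'b set"
  assumes "finite F" "\<And>i. D i \<noteq> {}"
  obtains T where "T \<subseteq> F" "\<And>i. i \<in> F \<Longrightarrow> \<exists>j\<in>T. s i \<le> s j \<and> D i \<inter> D j \<noteq> {}" "disjoint_family_on D T"
proof -
  have "\<exists>T\<subseteq>F. (\<forall>i\<in>F. \<exists>j\<in>T. s i \<le> s j \<and> D i \<inter> D j \<noteq> {}) \<and> (\<forall>i\<in>T. \<forall>j\<in>T. i \<noteq> j \<longrightarrow> s i \<le> s j \<longrightarrow> \<not> D i \<inter> D j \<noteq> {})"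
    using assms by (intro greedy_selection) auto
  then obtain T where T: "T \<subseteq> F" "\<forall>i\<in>F. \<exists>j\<in>T. s i \<le> s j \<and> D i \<inter> D j \<noteq> {}"
    "\<forall>i\<in>T. \<forall>j\<in>T. i \<noteq> j \<longrightarrow> s i \<le> s j \<longrightarrow> D i \<inter> D j = {}"
    by auto
  have "disjoint_family_on D T"
    unfolding disjoint_family_on_def
  proof (intro ballI impI)
    fix i j assume "i \<in> T" "j \<in> T" "i \<noteq> j"
    then show "D i \<inter> D j = {}"
      using T(3) by (cases "s i \<le> s j") (fastforce simp: Int_commute)+
  qed
  with T(1) bspec[OF T(2)] show ?thesis
    by (rule that)
qed

lemma dyadic_nonempty: "dyadic i \<noteq> {}"
proof -
  have "(\<chi> j. real_of_int (snd i $ j) * side i) \<in> dyadic i"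
    by (simp add: mem_dyadic)
  then show ?thesis by blast
qed

text \<open>Here \<open>a\<close> is mass per volume, and a cube is dropped when a kept cube
  contains it with at least half its density. So density more than doubles from a kept cube to a
  kept subcube, and the kept subcubes fill at most half its volume, since otherwise they would carry
  more mass than the cube has. Sparseness is in Lebesgue measure, whatever \<open>\<mu>\<close>
  is.\<close>

lemma sparse_selection:
  fixes F :: "(int \<times> (int ^ 'n)) set"
  assumes F: "finite F" and [measurable_cong]: "sets \<mu> = sets lebesgue"
    and fin: "\<And>i :: int \<times> (int ^ 'n). emeasure \<mu> (dyadic i) < top"
  defines "a \<equiv> \<lambda>i :: int \<times> (int ^ 'n). measure \<mu> (dyadic i) / side i ^ CARD('n)"
  obtains S E where "S \<subseteq> F"
    "\<And>i. i \<in> F \<Longrightarrow> \<exists>j\<in>S. fst i \<le> fst j \<and> dyadic i \<subseteq> dyadic j \<and> a i \<le> 2 * a j"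
    "\<And>i. i \<in> S \<Longrightarrow> E i \<in> sets lebesgue \<and> E i \<subseteq> dyadic i \<and> emeasure lebesgue (dyadic i) \<le> 2 * emeasure lebesgue (E i)"
    "disjoint_family_on E S"
proof -
  define R where "R = (\<lambda>i j :: int \<times> (int ^ 'n). dyadic i \<subseteq> dyadic j \<and> a i \<le> 2 * a j)"
  have a_nonneg: "a i \<ge> 0" for i by (simp add: a_def)
  have a_eq: "measure \<mu> (dyadic i) = a i * side i ^ CARD('n)" for i
    by (simp add: a_def)
  have eq: "i = j" if "dyadic i \<subseteq> dyadic j" "fst i = fst j" for i j :: "int \<times> (int ^ 'n)"
    using that dyadic_nonempty[of i] dyadic_eq by blast
  have "\<exists>S\<subseteq>F. (\<forall>i\<in>F. \<exists>j\<in>S. fst i \<le> fst j \<and> R i j) \<and> (\<forall>i\<in>S. \<forall>j\<in>S. i \<noteq> j \<longrightarrow> fst i \<le> fst j \<longrightarrow> \<not> R i j)"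
    using F a_nonneg by (intro greedy_selection) (auto simp: R_def dest: eq)
  then obtain S where S: "S \<subseteq> F" "\<And>i. i \<in> F \<Longrightarrow> \<exists>j\<in>S. fst i \<le> fst j \<and> R i j"
    "\<And>i j. i \<in> S \<Longrightarrow> j \<in> S \<Longrightarrow> i \<noteq> j \<Longrightarrow> fst i \<le> fst j \<Longrightarrow> \<not> R i j"
    by metis
  have finS: "finite S" using S(1) F finite_subset by blast
  define J where "J = (\<lambda>i. {j\<in>S. fst j < fst i \<and> dyadic j \<subseteq> dyadic i})"
  \<comment> \<open>Removing all smaller kept cubes inside makes these sets disjoint: two dyadic
    cubes that meet are nested, and the larger one has given up the smaller.\<close>
  define E where "E = (\<lambda>i. dyadic i - (\<Union>j\<in>J i. dyadic j))"
  have finJ: "finite (J i)" for i using finS by (simp add: J_def)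
  have E_sets: "E i \<in> sets lebesgue" for i
    unfolding E_def using finJ by (intro sets.Diff sets.finite_UN) auto
  have half: "emeasure lebesgue (dyadic i) \<le> 2 * emeasure lebesgue (E i)" if i: "i \<in> S" for i
  proof -
    \<comment> \<open>Cubes in \<open>J i\<close> may be nested; the maximal ones have the same
      union and are disjoint, so that their masses add up.\<close>
    obtain T where T: "T \<subseteq> J i" "\<And>j. j \<in> J i \<Longrightarrow> \<exists>j'\<in>T. fst j \<le> fst j' \<and> dyadic j \<inter> dyadic j' \<noteq> {}"
      "disjoint_family_on dyadic T"
      using disjoint_selection[where s = fst and D = dyadic, OF finJ[of i] dyadic_nonempty] by blast
    have finT: "finite T" using T(1) finJ finite_subset by blast
    have cover: "(\<Union>j\<in>J i. dyadic j) \<subseteq> (\<Union>j\<in>T. dyadic j)"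
    proof (rule UN_least)
      fix j assume "j \<in> J i"
      then obtain j' y where "j' \<in> T" "fst j \<le> fst j'" "y \<in> dyadic j" "y \<in> dyadic j'"
        using T(2) by blast
      then show "dyadic j \<subseteq> (\<Union>j\<in>T. dyadic j)"
        using dyadic_nested(1)[of y j j'] by blast
    qed
    have big: "a j > 2 * a i" if "j \<in> T" for j
    proof -
      have "j \<in> S" "fst j < fst i" "dyadic j \<subseteq> dyadic i"
        using that T(1) by (auto simp: J_def)
      then show ?thesis
        using i S(3)[of j i] by (force simp: R_def)
    qed
    have fm: "emeasure \<mu> (dyadic j) \<noteq> \<infinity>" for j :: "int \<times> (int ^ 'n)"
      using fin[of j] by simp
    have sum_le: "(\<Sum>j\<in>T. a j * side j ^ CARD('n)) \<le> a i * side i ^ CARD('n)"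
    proof -
      have "(\<Sum>j\<in>T. measure \<mu> (dyadic j)) = measure \<mu> (\<Union>j\<in>T. dyadic j)"
        using T(3) finT fm by (intro measure_finite_Union[symmetric]) auto
      also have "\<dots> \<le> measure \<mu> (dyadic i)"
        using T(1) fm[of i] finT by (intro measure_mono_fmeasurable) (auto simp: J_def fmeasurable_def less_top)
      finally show ?thesis by (simp add: a_eq)
    qed
    have "2 * (\<Sum>j\<in>T. side j ^ CARD('n)) \<le> side i ^ CARD('n)"
    \<comment> \<open>The density of \<open>i\<close> is about to be cancelled. If it is 0, a member
      of \<open>T\<close> would have positive mass inside a cube of mass 0, so \<open>T\<close> is
      empty.\<close>
    proof (cases "a i = 0")
      case True
      have "T = {}"
      proof (rule ccontr)
        assume "T \<noteq> {}"
        then have "(\<Sum>j\<in>T. a j * side j ^ CARD('n)) > 0"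
          using finT big True by (intro sum_pos) auto
        then show False using sum_le True by simp
      qed
      then show ?thesis by simp
    next
      case False
      then have pos: "a i > 0" using a_nonneg[of i] by simp
      have "a i * (2 * (\<Sum>j\<in>T. side j ^ CARD('n))) = (\<Sum>j\<in>T. 2 * a i * side j ^ CARD('n))"
        by (simp add: sum_distrib_left mult_ac)
      also have "\<dots> \<le> (\<Sum>j\<in>T. a j * side j ^ CARD('n))"
        using big by (intro sum_mono mult_right_mono) (auto simp: less_imp_le)
      also note sum_le
      finally show ?thesis using pos by simp
    qed
    moreover have "emeasure lebesgue (\<Union>j\<in>J i. dyadic j) \<le> ennreal (\<Sum>j\<in>T. side j ^ CARD('n))"
    proof -
      have "emeasure lebesgue (\<Union>j\<in>J i. dyadic j) \<le> emeasure lebesgue (\<Union>j\<in>T. dyadic j)"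
        using cover finT by (intro emeasure_mono sets.finite_UN) auto
      also have "\<dots> \<le> (\<Sum>j\<in>T. emeasure lebesgue (dyadic j))"
        using finT by (intro emeasure_subadditive_finite) auto
      finally show ?thesis by (simp add: emeasure_dyadic)
    qed
    ultimately have U: "emeasure lebesgue (\<Union>j\<in>J i. dyadic j) \<le> ennreal (side i ^ CARD('n) / 2)"
      by (auto elim!: order_trans intro!: ennreal_leI)
    have "emeasure lebesgue (dyadic i) \<le> emeasure lebesgue (E i \<union> (\<Union>j\<in>J i. dyadic j))"
      using finJ E_sets by (intro emeasure_mono sets.Un sets.finite_UN) (auto simp: E_def)
    also have "\<dots> \<le> emeasure lebesgue (E i) + emeasure lebesgue (\<Union>j\<in>J i. dyadic j)"
      using finJ E_sets by (intro emeasure_subadditive sets.finite_UN) auto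
    also have "\<dots> \<le> emeasure lebesgue (E i) + ennreal (side i ^ CARD('n) / 2)"
      by (intro add_left_mono U)
    finally have "ennreal (side i ^ CARD('n)) \<le> emeasure lebesgue (E i) + ennreal (side i ^ CARD('n) / 2)"
      by (simp add: emeasure_dyadic)
    then have "ennreal (side i ^ CARD('n)) \<le> 2 * emeasure lebesgue (E i)"
    proof (cases "emeasure lebesgue (E i)")
      case (real r)
      assume "ennreal (side i ^ CARD('n)) \<le> emeasure lebesgue (E i) + ennreal (side i ^ CARD('n) / 2)"
      then have "side i ^ CARD('n) \<le> r + side i ^ CARD('n) / 2"
        using real by (simp add: ennreal_le_iff flip: ennreal_plus)
      then have "ennreal (side i ^ CARD('n)) \<le> ennreal (2 * r)"
        by (intro ennreal_leI) simp
      then show ?thesis using real by (simp add: ennreal_mult)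
    qed (simp add: ennreal_mult_top)
    then show ?thesis by (simp add: emeasure_dyadic)
  qed
  have disj0: "E i \<inter> E j = {}" if "i \<in> S" "j \<in> S" "i \<noteq> j" "fst i \<le> fst j" for i j
  proof (rule ccontr)
    assume "E i \<inter> E j \<noteq> {}"
    then obtain x where x: "x \<in> E i" "x \<in> E j" by blast
    then have xd: "x \<in> dyadic i" "x \<in> dyadic j" by (auto simp: E_def)
    then have "fst i < fst j" "dyadic i \<subseteq> dyadic j"
      using that dyadic_eq[OF xd] dyadic_nested(1)[OF xd] by force+
    then have "i \<in> J j" using that by (simp add: J_def)
    then show False using x xd by (auto simp: E_def)
  qed
  have "disjoint_family_on E S"
    unfolding disjoint_family_on_def
  proof (intro ballI impI)
    fix i j assume "i \<in> S" "j \<in> S" "i \<noteq> j"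
    then show "E i \<inter> E j = {}"
      using disj0[of i j] disj0[of j i] by (cases "fst i \<le> fst j") auto
  qed
  then show ?thesis
    using S(1,2) E_sets half by (intro that[of S E]) (auto simp: R_def E_def)
qed

text \<open>The disjoint sets \<open>E i\<close> carry a fixed share of the masses, so the sum is
  controlled by the mass of their union, which the dilates of disjoint triples cover. On each of
  these triples the part of \<open>h\<close> up to \<open>l / 2\<close> explains at most half of the
  average, so only \<open>h > l / 2\<close> is needed on the right; this truncation is what makes
  the levels summable.\<close>

lemma weak_embedding:
  fixes S :: "(int \<times> (int ^ 'n)) set" and h :: "real ^ 'n \<Rightarrow> real"
  assumes S: "finite S" and sets_mu[measurable_cong]: "sets \<mu> = sets lebesgue"
    and fin: "\<And>i :: int \<times> (int ^ 'n). emeasure \<mu> (dilate 1 i) < top"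
    and dbl: "\<And>i :: int \<times> (int ^ 'n). emeasure \<mu> (dilate 4 i) \<le> ennreal D * emeasure \<mu> (dilate 1 i)"
    and E: "\<And>i. i \<in> S \<Longrightarrow> E i \<in> sets lebesgue \<and> E i \<subseteq> dilate 1 i \<and> emeasure \<mu> (dilate 1 i) \<le> ennreal C * emeasure \<mu> (E i)"
    and disj: "disjoint_family_on E S"
    and h[measurable]: "h \<in> borel_measurable lebesgue" "\<And>x. h x \<ge> 0"
    and l0: "l > 0"
    and avg: "\<And>i. i \<in> S \<Longrightarrow> ennreal l * emeasure \<mu> (dilate 1 i) \<le> (\<integral>\<^sup>+x\<in>dilate 1 i. ennreal (h x) \<partial>\<mu>)"
    and nn: "C \<ge> 0" "D \<ge> 0"
  shows "(\<Sum>i\<in>S. emeasure \<mu> (dilate 1 i)) \<le> ennreal (2 * C * D / l) * (\<integral>\<^sup>+x\<in>{x. h x > l / 2}. ennreal (h x) \<partial>\<mu>)"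
proof -
  define H where "H = {x. h x > l / 2}"
  have H[measurable]: "H \<in> sets lebesgue"
  proof -
    have "{x \<in> space lebesgue. h x > l / 2} \<in> sets lebesgue" by measurable
    then show ?thesis by (simp add: H_def)
  qed
  have dil_ne: "dilate 1 i \<noteq> {}" for i :: "int \<times> (int ^ 'n)"
    using dyadic_subset_dilate[of 1 i] dyadic_nonempty[of i] by auto
  obtain T where T: "T \<subseteq> S" "\<And>i. i \<in> S \<Longrightarrow> \<exists>j\<in>T. fst i \<le> fst j \<and> dilate 1 i \<inter> dilate 1 j \<noteq> {}"
    "disjoint_family_on (dilate 1) T"
    using disjoint_selection[where s = fst and D = "dilate 1", OF S dil_ne] by blast
  have finT: "finite T" using T(1) S finite_subset by blast
  have avgH: "emeasure \<mu> (dilate 1 i) \<le> ennreal (2 / l) * (\<integral>\<^sup>+x\<in>dilate 1 i \<inter> H. ennreal (h x) \<partial>\<mu>)" if "i \<in> S" for i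
  proof -
    define m where "m = measure \<mu> (dilate 1 i)"
    have m: "emeasure \<mu> (dilate 1 i) = ennreal m" "m \<ge> 0"
      using fin[of i] by (auto simp: m_def emeasure_eq_ennreal_measure)
    define I where "I = (\<integral>\<^sup>+x\<in>dilate 1 i \<inter> H. ennreal (h x) \<partial>\<mu>)"
    have "ennreal l * ennreal m \<le> (\<integral>\<^sup>+x\<in>dilate 1 i. ennreal (h x) \<partial>\<mu>)"
      using avg[OF that] m by simp
    also have "\<dots> \<le> (\<integral>\<^sup>+x. ennreal (h x) * indicator (dilate 1 i \<inter> H) x + ennreal (l / 2) * indicator (dilate 1 i) x \<partial>\<mu>)"
      by (intro nn_integral_mono) (auto simp: H_def not_less intro: ennreal_leI split: split_indicator)
    also have "\<dots> = I + ennreal (l / 2) * ennreal m"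
      by (simp add: nn_integral_add nn_integral_cmult_indicator I_def m)
    finally have le: "ennreal l * ennreal m \<le> I + ennreal (l / 2) * ennreal m" .
    have "ennreal m \<le> ennreal (2 / l) * I"
    proof (cases I)
      case (real r)
      then have "l * m \<le> r + l / 2 * m"
        using le l0 m by (simp add: ennreal_le_iff flip: ennreal_mult ennreal_plus)
      then have "m \<le> 2 / l * r"
        using l0 by (simp add: field_simps)
      then have "ennreal m \<le> ennreal (2 / l * r)" by (rule ennreal_leI)
      also have "\<dots> = ennreal (2 / l) * ennreal r"
        using real l0 by (intro ennreal_mult) auto
      finally show ?thesis using real by simp
    qed (use l0 in \<open>simp add: ennreal_mult_top\<close>)
    then show ?thesis by (simp add: m I_def)
  qed
  have "(\<Sum>i\<in>S. emeasure \<mu> (dilate 1 i)) \<le> (\<Sum>i\<in>S. ennreal C * emeasure \<mu> (E i))"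
    using E by (intro sum_mono) auto
  also have "\<dots> = ennreal C * (\<Sum>i\<in>S. emeasure \<mu> (E i))"
    by (simp add: sum_distrib_left)
  also have "(\<Sum>i\<in>S. emeasure \<mu> (E i)) = emeasure \<mu> (\<Union>i\<in>S. E i)"
    using S E disj sets_mu by (intro sum_emeasure) auto
  also have "\<dots> \<le> emeasure \<mu> (\<Union>j\<in>T. dilate 4 j)"
  proof (rule emeasure_mono)
    show "(\<Union>i\<in>S. E i) \<subseteq> (\<Union>j\<in>T. dilate 4 j)"
    proof clarify
      fix x i assume "i \<in> S" "x \<in> E i"
      then have "x \<in> dilate 1 i" using E by blast
      moreover obtain j where "j \<in> T" "fst i \<le> fst j" "dilate 1 i \<inter> dilate 1 j \<noteq> {}"
        using T(2) \<open>i \<in> S\<close> by blast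
      ultimately show "x \<in> (\<Union>j\<in>T. dilate 4 j)"
        using dilate_vitali by blast
    qed
    show "(\<Union>j\<in>T. dilate 4 j) \<in> sets \<mu>"
      unfolding sets_mu using finT by (intro sets.finite_UN) auto
  qed
  also have "\<dots> \<le> (\<Sum>j\<in>T. emeasure \<mu> (dilate 4 j))"
    using finT by (intro emeasure_subadditive_finite) (auto simp: sets_mu)
  also have "\<dots> \<le> (\<Sum>j\<in>T. ennreal D * (ennreal (2 / l) * (\<integral>\<^sup>+x\<in>dilate 1 j \<inter> H. ennreal (h x) \<partial>\<mu>)))"
    using T(1) by (intro sum_mono order_trans[OF dbl] mult_left_mono avgH) auto
  also have "\<dots> = ennreal D * ennreal (2 / l) * (\<Sum>j\<in>T. \<integral>\<^sup>+x\<in>dilate 1 j \<inter> H. ennreal (h x) \<partial>\<mu>)"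
    by (simp add: sum_distrib_left mult.assoc)
  also have "(\<Sum>j\<in>T. \<integral>\<^sup>+x\<in>dilate 1 j \<inter> H. ennreal (h x) \<partial>\<mu>) = (\<integral>\<^sup>+x. (\<Sum>j\<in>T. ennreal (h x) * indicator (dilate 1 j \<inter> H) x) \<partial>\<mu>)"
    by (intro nn_integral_sum[symmetric]) measurable
  also have "\<dots> \<le> (\<integral>\<^sup>+x\<in>H. ennreal (h x) \<partial>\<mu>)"
  proof (intro nn_integral_mono)
    fix x
    have "(\<Sum>j\<in>T. ennreal (h x) * indicator (dilate 1 j \<inter> H) x) = ennreal (h x) * (indicator H x * (\<Sum>j\<in>T. indicator (dilate 1 j) x))"
      by (simp add: sum_distrib_left indicator_inter_arith mult_ac)
    also have "(\<Sum>j\<in>T. indicator (dilate 1 j) x :: ennreal) = indicator (\<Union>j\<in>T. dilate 1 j) x"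
      using T(3) finT by (rule indicator_UN_disjoint[symmetric, rotated])
    also have "ennreal (h x) * (indicator H x * indicator (\<Union>j\<in>T. dilate 1 j) x) \<le> ennreal (h x) * indicator H x"
      by (intro mult_left_mono) (auto split: split_indicator)
    finally show "(\<Sum>j\<in>T. ennreal (h x) * indicator (dilate 1 j \<inter> H) x) \<le> ennreal (h x) * indicator H x" .
  qed
  finally have "(\<Sum>i\<in>S. emeasure \<mu> (dilate 1 i)) \<le> ennreal C * (ennreal D * ennreal (2 / l) * (\<integral>\<^sup>+x\<in>H. ennreal (h x) \<partial>\<mu>))"
    by (simp add: mult_left_mono)
  also have "\<dots> = ennreal (2 * C * D / l) * (\<integral>\<^sup>+x\<in>H. ennreal (h x) \<partial>\<mu>)"
  proof -
    have "ennreal C * (ennreal D * ennreal (2 / l)) = ennreal (C * (D * (2 / l)))"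
      using nn l0 by (simp only: ennreal_mult' mult_nonneg_nonneg)
    also have "C * (D * (2 / l)) = 2 * C * D / l" by simp
    finally show ?thesis by (simp add: mult.assoc[symmetric])
  qed
  finally show ?thesis by (simp add: H_def)
qed

lemma superlevel_sets:
  fixes f :: "'a :: euclidean_space \<Rightarrow> 'b :: {second_countable_topology, linorder_topology}"
  assumes "f \<in> borel_measurable lebesgue"
  shows "{x. f x > c} \<in> sets lebesgue"
  using borel_measurable_less[OF borel_measurable_const assms, of c] by simp

text \<open>The losses of the summation over levels: \<open>2 * C * D\<close> from the weak
  estimate, \<open>2 powr r\<close> from rounding up to a power of two,
  \<open>4 powr (r - 1)\<close> from a top level of at most \<open>4 * h\<close>, and a geometric
  series with exponent \<open>r - 1\<close>.\<close>

definition embedding_const :: "real \<Rightarrow> real \<Rightarrow> real \<Rightarrow> real" where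
  "embedding_const r C D = 2 * C * D * 2 powr r * 4 powr (r - 1) / (1 - 2 powr (- (r - 1)))"

lemma embedding_const_nonneg: "r > 1 \<Longrightarrow> C \<ge> 0 \<Longrightarrow> D \<ge> 0 \<Longrightarrow> embedding_const r C D \<ge> 0"
  using powr_mono[of "- (r - 1)" 0 2] by (auto simp: embedding_const_def intro!: divide_nonneg_nonneg)

text \<open>At a fixed point only levels below \<open>2 * h\<close> occur. They form a geometric
  series in \<open>2 powr (r - 1)\<close>, whose top term is comparable to
  \<open>h powr (r - 1)\<close> because \<open>r > 1\<close>.\<close>

lemma level_sum_le:
  assumes K: "finite K" and r: "r > 1" and h: "(h :: real) \<ge> 0" and nn: "C \<ge> 0" "D \<ge> 0"
  shows "(\<Sum>k\<in>K. 2 powr ((real_of_int k + 1) * r) * (2 * C * D / 2 powr k * (h * of_bool (h > 2 powr k / 2))))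
    \<le> embedding_const r C D * h powr r"
proof (cases "h = 0")
  case False
  then have h: "h > 0" using h by simp
  define k0 where "k0 = \<lceil>log 2 (2 * h)\<rceil>"
  define K' where "K' = {k\<in>K. h > 2 powr k / 2}"
  have le: "k \<le> k0" if "k \<in> K'" for k
  proof -
    have "2 powr k < 2 * h" using that by (simp add: K'_def)
    then have "real_of_int k < log 2 (2 * h)"
      using h by (simp add: less_log_iff)
    then show ?thesis unfolding k0_def by linarith
  qed
  have "real_of_int k0 < log 2 (2 * h) + 1"
    unfolding k0_def by linarith
  then have "2 powr k0 < 2 powr (log 2 (2 * h) + 1)"
    by simp
  also have "\<dots> = 4 * h"
    using h by (simp add: powr_add)
  finally have k0: "2 powr k0 \<le> 4 * h" by simp
  have "(\<Sum>k\<in>K. 2 powr ((real_of_int k + 1) * r) * (2 * C * D / 2 powr k * (h * of_bool (h > 2 powr k / 2))))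
      = (\<Sum>k\<in>K'. 2 powr ((real_of_int k + 1) * r) * (2 * C * D / 2 powr k * h))"
    unfolding K'_def using K by (intro sum.mono_neutral_cong_right) auto
  also have "\<dots> = (\<Sum>k\<in>K'. 2 * C * D * 2 powr r * h * 2 powr (real_of_int k * (r - 1)))"
  proof (intro sum.cong refl)
    fix k
    have "2 powr ((real_of_int k + 1) * r) = 2 powr r * (2 powr (real_of_int k * (r - 1)) * 2 powr k)"
      by (simp add: powr_add[symmetric] algebra_simps)
    then show "2 powr ((real_of_int k + 1) * r) * (2 * C * D / 2 powr k * h)
        = 2 * C * D * 2 powr r * h * 2 powr (real_of_int k * (r - 1))"
      by simp
  qed
  also have "\<dots> = 2 * C * D * 2 powr r * h * (\<Sum>k\<in>K'. 2 powr (real_of_int k * (r - 1)))"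
    by (rule sum_distrib_left[symmetric])
  also have "\<dots> \<le> 2 * C * D * 2 powr r * h * (2 powr (real_of_int k0 * (r - 1)) / (1 - 2 powr (- (r - 1))))"
    using K r h nn le by (intro mult_left_mono sum_powr_le) (auto simp: K'_def)
  also have "\<dots> \<le> 2 * C * D * 2 powr r * h * ((4 * h) powr (r - 1) / (1 - 2 powr (- (r - 1))))"
  proof (intro mult_left_mono divide_right_mono)
    have "2 powr (real_of_int k0 * (r - 1)) = (2 powr k0) powr (r - 1)"
      by (simp add: powr_powr)
    also have "\<dots> \<le> (4 * h) powr (r - 1)"
      using k0 r by (intro powr_mono2) auto
    finally show "2 powr (real_of_int k0 * (r - 1)) \<le> (4 * h) powr (r - 1)" .
    show "0 \<le> 1 - 2 powr (- (r - 1))"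
      using r powr_mono[of "- (r - 1)" 0 2] by simp
  qed (use h nn in auto)
  also have "\<dots> = embedding_const r C D * h powr r"
  proof -
    have "h * h powr (r - 1) = h powr r"
      using h by (simp add: powr_mult_base)
    then show ?thesis
      using h by (simp add: embedding_const_def powr_mult)
  qed
  finally show ?thesis .
qed simp

text \<open>Marcinkiewicz interpolation by hand: indices are grouped by the dyadic size of
  \<open>x i\<close>, \<open>weak_embedding\<close> is applied at each level, and exchanging sum and
  integral leaves the pointwise sum of \<open>level_sum_le\<close>.\<close>

lemma strong_embedding:
  fixes S :: "(int \<times> (int ^ 'n)) set" and h :: "real ^ 'n \<Rightarrow> real"
  assumes S: "finite S" and sets_mu[measurable_cong]: "sets \<mu> = sets lebesgue"
    and fin: "\<And>i :: int \<times> (int ^ 'n). emeasure \<mu> (dilate 1 i) < top"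
    and dbl: "\<And>i :: int \<times> (int ^ 'n). emeasure \<mu> (dilate 4 i) \<le> ennreal D * emeasure \<mu> (dilate 1 i)"
    and E: "\<And>i. i \<in> S \<Longrightarrow> E i \<in> sets lebesgue \<and> E i \<subseteq> dilate 1 i \<and> emeasure \<mu> (dilate 1 i) \<le> ennreal C * emeasure \<mu> (E i)"
    and disj: "disjoint_family_on E S"
    and h[measurable]: "h \<in> borel_measurable lebesgue" "\<And>x. h x \<ge> 0"
    and avg: "\<And>i. i \<in> S \<Longrightarrow> ennreal (x i) * emeasure \<mu> (dilate 1 i) \<le> (\<integral>\<^sup>+y\<in>dilate 1 i. ennreal (h y) \<partial>\<mu>)"
    and x: "\<And>i. i \<in> S \<Longrightarrow> x i \<ge> 0"
    and nn: "C \<ge> 0" "D \<ge> 0" and r: "r > 1"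
  shows "(\<Sum>i\<in>S. emeasure \<mu> (dilate 1 i) * ennreal (x i powr r))
    \<le> ennreal (embedding_const r C D) * (\<integral>\<^sup>+y. ennreal (h y powr r) \<partial>\<mu>)"
proof -
  \<comment> \<open>Chosen so that \<open>x i\<close> lies above \<open>2 powr \<kappa>\<close> and
    not above twice that. Only positive \<open>x i\<close> have such a level; the others contribute
    0 to the sum.\<close>
  define \<kappa> where "\<kappa> i = \<lceil>log 2 (x i)\<rceil> - 1" for i
  define S' where "S' = {i\<in>S. x i > 0}"
  have S': "finite S'" "S' \<subseteq> S" using S by (auto simp: S'_def)
  have \<kappa>: "2 powr (\<kappa> i) < x i" "x i \<le> 2 powr (real_of_int (\<kappa> i) + 1)" if "i \<in> S'" for i
  proof -
    have "x i > 0" using that by (simp add: S'_def)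
    have "real_of_int (\<kappa> i) < log 2 (x i)" "log 2 (x i) \<le> real_of_int (\<kappa> i) + 1"
      unfolding \<kappa>_def by (simp_all, linarith)
    then show "2 powr (\<kappa> i) < x i" "x i \<le> 2 powr (real_of_int (\<kappa> i) + 1)"
      using \<open>x i > 0\<close> by (simp_all add: less_log_iff log_le_iff)
  qed
  define H where "H k = {y. h y > 2 powr real_of_int k / 2}" for k :: int
  have [measurable]: "H k \<in> sets lebesgue" for k
    unfolding H_def by (rule superlevel_sets[OF h(1)])
  have level: "(\<Sum>i\<in>{i\<in>S'. \<kappa> i = k}. emeasure \<mu> (dilate 1 i)) \<le> ennreal (2 * C * D / 2 powr k) * (\<integral>\<^sup>+y\<in>H k. ennreal (h y) \<partial>\<mu>)" for k
    unfolding H_def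
  proof (rule weak_embedding[OF _ sets_mu fin dbl])
    show "ennreal (2 powr k) * emeasure \<mu> (dilate 1 i) \<le> (\<integral>\<^sup>+y\<in>dilate 1 i. ennreal (h y) \<partial>\<mu>)"
      if "i \<in> {i\<in>S'. \<kappa> i = k}" for i
    proof -
      have "ennreal (2 powr k) * emeasure \<mu> (dilate 1 i) \<le> ennreal (x i) * emeasure \<mu> (dilate 1 i)"
        using that \<kappa>(1)[of i] by (intro mult_right_mono ennreal_leI) auto
      also have "\<dots> \<le> (\<integral>\<^sup>+y\<in>dilate 1 i. ennreal (h y) \<partial>\<mu>)"
        using that S' by (intro avg) auto
      finally show ?thesis .
    qed
    show "disjoint_family_on E {i\<in>S'. \<kappa> i = k}"
      using disj S'(2) by (intro disjoint_family_on_mono[OF _ disj]) auto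
  qed (use S' E nn h in auto)
  have "(\<Sum>i\<in>S. emeasure \<mu> (dilate 1 i) * ennreal (x i powr r)) = (\<Sum>i\<in>S'. emeasure \<mu> (dilate 1 i) * ennreal (x i powr r))"
    using S x by (intro sum.mono_neutral_right) (force simp: S'_def)+
  also have "\<dots> \<le> (\<Sum>i\<in>S'. emeasure \<mu> (dilate 1 i) * ennreal (2 powr ((real_of_int (\<kappa> i) + 1) * r)))"
  proof (intro sum_mono mult_left_mono ennreal_leI)
    fix i assume "i \<in> S'"
    then have "x i powr r \<le> (2 powr (real_of_int (\<kappa> i) + 1)) powr r"
      using \<kappa>(2)[of i] x[of i] S' r by (intro powr_mono2) auto
    then show "x i powr r \<le> 2 powr ((real_of_int (\<kappa> i) + 1) * r)"
      by (simp add: powr_powr)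
  qed auto
  also have "\<dots> = (\<Sum>k\<in>\<kappa> ` S'. \<Sum>i\<in>{i\<in>S'. \<kappa> i = k}. emeasure \<mu> (dilate 1 i) * ennreal (2 powr ((real_of_int (\<kappa> i) + 1) * r)))"
    using S'(1) by (rule sum.image_gen)
  also have "\<dots> = (\<Sum>k\<in>\<kappa> ` S'. ennreal (2 powr ((real_of_int k + 1) * r)) * (\<Sum>i\<in>{i\<in>S'. \<kappa> i = k}. emeasure \<mu> (dilate 1 i)))"
    by (intro sum.cong refl) (simp add: sum_distrib_left mult.commute)
  also have "\<dots> \<le> (\<Sum>k\<in>\<kappa> ` S'. ennreal (2 powr ((real_of_int k + 1) * r)) * (ennreal (2 * C * D / 2 powr k) * (\<integral>\<^sup>+y\<in>H k. ennreal (h y) \<partial>\<mu>)))"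
    by (intro sum_mono mult_left_mono level) auto
  also have "\<dots> = (\<integral>\<^sup>+y. (\<Sum>k\<in>\<kappa> ` S'. ennreal (2 powr ((real_of_int k + 1) * r)) * (ennreal (2 * C * D / 2 powr k) * (ennreal (h y) * indicator (H k) y))) \<partial>\<mu>)"
    by (subst nn_integral_sum) (auto simp: nn_integral_cmult)
  also have "\<dots> \<le> (\<integral>\<^sup>+y. ennreal (embedding_const r C D) * ennreal (h y powr r) \<partial>\<mu>)"
  proof (intro nn_integral_mono)
    fix y
    have "(\<Sum>k\<in>\<kappa> ` S'. ennreal (2 powr ((real_of_int k + 1) * r)) * (ennreal (2 * C * D / 2 powr k) * (ennreal (h y) * indicator (H k) y)))
      = (\<Sum>k\<in>\<kappa> ` S'. ennreal (2 powr ((real_of_int k + 1) * r) * (2 * C * D / 2 powr k * (h y * of_bool (h y > 2 powr k / 2)))))"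
    proof (intro sum.cong refl)
      fix k
      have "ennreal (h y) * indicator (H k) y = ennreal (h y * of_bool (h y > 2 powr k / 2))"
        by (simp add: H_def)
      moreover have "2 * C * D / 2 powr k \<ge> 0" "h y * of_bool (h y > 2 powr k / 2) \<ge> 0"
        using nn h(2)[of y] by auto
      ultimately show "ennreal (2 powr ((real_of_int k + 1) * r)) * (ennreal (2 * C * D / 2 powr k) * (ennreal (h y) * indicator (H k) y))
        = ennreal (2 powr ((real_of_int k + 1) * r) * (2 * C * D / 2 powr k * (h y * of_bool (h y > 2 powr k / 2))))"
        by (simp only: ennreal_mult mult_nonneg_nonneg powr_ge_zero)
    qed
    also have "\<dots> = ennreal (\<Sum>k\<in>\<kappa> ` S'. 2 powr ((real_of_int k + 1) * r) * (2 * C * D / 2 powr k * (h y * of_bool (h y > 2 powr k / 2))))"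
      using nn h(2)[of y] by (intro sum_ennreal) auto
    also have "\<dots> \<le> ennreal (embedding_const r C D * h y powr r)"
      using S' r h nn by (intro ennreal_leI level_sum_le) auto
    also have "\<dots> = ennreal (embedding_const r C D) * ennreal (h y powr r)"
      using embedding_const_nonneg[OF r nn] by (intro ennreal_mult) auto
    finally show "(\<Sum>k\<in>\<kappa> ` S'. ennreal (2 powr ((real_of_int k + 1) * r)) * (ennreal (2 * C * D / 2 powr k) * (ennreal (h y) * indicator (H k) y)))
      \<le> ennreal (embedding_const r C D) * ennreal (h y powr r)" .
  qed
  also have "\<dots> = ennreal (embedding_const r C D) * (\<integral>\<^sup>+y. ennreal (h y powr r) \<partial>\<mu>)"
    by (intro nn_integral_cmult) measurable
  finally show ?thesis .
qed

section \<open>Hoelder's inequality for sums with exponents on the favourable side of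
  duality\<close>

lemma conj_exp_antimono: "1 < p \<Longrightarrow> p \<le> q \<Longrightarrow> conj_exp q \<le> conj_exp p"
  by (simp add: conj_exp_def frac_le_eq divide_le_0_iff) (simp add: field_simps)

lemma conj_exp_sum: "p > 1 \<Longrightarrow> 1 / p + 1 / conj_exp p = 1"
  by (simp add: conj_exp_iff)

text \<open>After normalisation every \<open>b' i\<close> is at most 1, so its power with exponent
  \<open>p'\<close> is at most the one with the smaller exponent \<open>q'\<close>; this is where
  \<open>p \<le> q\<close> enters. Young's inequality for \<open>p\<close> and \<open>p'\<close>
  then suffices, at the price of the factor 2.\<close>

lemma holder_sum:
  fixes a b :: "'a \<Rightarrow> real"
  assumes I: "finite I" and nn: "\<And>i. i \<in> I \<Longrightarrow> a i \<ge> 0" "\<And>i. i \<in> I \<Longrightarrow> b i \<ge> 0"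
    and p: "1 < p" "p \<le> q" and X: "X > 0" and Y: "Y > 0"
    and a: "(\<Sum>i\<in>I. a i powr p) \<le> X powr p" and b: "(\<Sum>i\<in>I. b i powr conj_exp q) \<le> Y powr conj_exp q"
  shows "(\<Sum>i\<in>I. a i * b i) \<le> 2 * X * Y"
proof -
  define a' where "a' i = a i / X" for i
  define b' where "b' i = b i / Y" for i
  have nn': "a' i \<ge> 0" "b' i \<ge> 0" if "i \<in> I" for i
    using nn[OF that] X Y by (auto simp: a'_def b'_def)
  have q': "conj_exp q > 1" "conj_exp p > 1" using p conj_exp_pos by auto
  have A: "(\<Sum>i\<in>I. a' i powr p) \<le> 1"
  proof -
    have "(\<Sum>i\<in>I. a' i powr p) = (\<Sum>i\<in>I. a i powr p) / X powr p"
      using nn X by (simp add: a'_def powr_divide sum_divide_distrib)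
    then show ?thesis using a X by simp
  qed
  have B: "(\<Sum>i\<in>I. b' i powr conj_exp q) \<le> 1"
  proof -
    have "(\<Sum>i\<in>I. b' i powr conj_exp q) = (\<Sum>i\<in>I. b i powr conj_exp q) / Y powr conj_exp q"
      using nn Y by (simp add: b'_def powr_divide sum_divide_distrib)
    then show ?thesis using b Y by simp
  qed
  have b1: "b' i \<le> 1" if "i \<in> I" for i
  proof (rule ccontr)
    assume "\<not> b' i \<le> 1"
    then have "1 powr conj_exp q < b' i powr conj_exp q"
      using q' by (intro powr_less_mono2) auto
    also have "\<dots> \<le> (\<Sum>i\<in>I. b' i powr conj_exp q)"
      using I that by (intro member_le_sum) auto
    finally show False using B by simp
  qed
  have "(\<Sum>i\<in>I. a' i * b' i) \<le> (\<Sum>i\<in>I. a' i powr p + b' i powr conj_exp q)"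
  proof (intro sum_mono)
    fix i assume i: "i \<in> I"
    have "a' i * b' i \<le> a' i powr p / p + b' i powr conj_exp p / conj_exp p"
      using p q' nn'[OF i] conj_exp_sum by (intro Youngs_inequality) auto
    also have "\<dots> \<le> a' i powr p + b' i powr conj_exp p"
    proof (intro add_mono)
      show "a' i powr p / p \<le> a' i powr p"
        using p mult_left_mono[of 1 p "a' i powr p"] by (simp add: field_simps)
      show "b' i powr conj_exp p / conj_exp p \<le> b' i powr conj_exp p"
        using q' mult_left_mono[of 1 "conj_exp p" "b' i powr conj_exp p"] by (simp add: field_simps)
    qed
    also have "b' i powr conj_exp p \<le> b' i powr conj_exp q"
      using b1[OF i] nn'[OF i] conj_exp_antimono[OF p] by (intro powr_mono') auto
    finally show "a' i * b' i \<le> a' i powr p + b' i powr conj_exp q" by simp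
  qed
  also have "\<dots> \<le> 2"
    using A B by (simp add: sum.distrib)
  finally have "(\<Sum>i\<in>I. a' i * b' i) \<le> 2" .
  moreover have "(\<Sum>i\<in>I. a i * b i) = X * Y * (\<Sum>i\<in>I. a' i * b' i)"
    using X Y by (simp add: a'_def b'_def sum_distrib_left)
  ultimately show ?thesis
    using X Y mult_left_mono[of _ 2 "X * Y"] by (simp add: mult_ac)
qed

section \<open>The two-weight inequality for the Riesz potential\<close>

text \<open>What the bilinear estimate takes from class A-infinity: finite mass of triples, doubling
  from 3Q to 9Q, and a fixed share of the mass of 3Q in every subset filling half of Q.\<close>

definition dyadic_doubling :: "real \<Rightarrow> real \<Rightarrow> (real ^ 'n) measure \<Rightarrow> bool" where
  "dyadic_doubling C D \<mu> \<longleftrightarrow> sets \<mu> = sets lebesgue \<and>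
     (\<forall>i. emeasure \<mu> (dilate 1 i) < top) \<and>
     (\<forall>i. emeasure \<mu> (dilate 4 i) \<le> ennreal D * emeasure \<mu> (dilate 1 i)) \<and>
     (\<forall>i E. E \<in> sets lebesgue \<longrightarrow> E \<subseteq> dyadic i \<longrightarrow> emeasure lebesgue (dyadic i) \<le> 2 * emeasure lebesgue E \<longrightarrow>
        emeasure \<mu> (dilate 1 i) \<le> ennreal C * emeasure \<mu> E)"

lemma dyadic_doublingD:
  assumes "dyadic_doubling C D \<mu>"
  shows "sets \<mu> = sets lebesgue" "emeasure \<mu> (dilate 1 i) < top"
    "emeasure \<mu> (dilate 4 i) \<le> ennreal D * emeasure \<mu> (dilate 1 i)"
    "E \<in> sets lebesgue \<Longrightarrow> E \<subseteq> dyadic i \<Longrightarrow> emeasure lebesgue (dyadic i) \<le> 2 * emeasure lebesgue E \<Longrightarrow>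
        emeasure \<mu> (dilate 1 i) \<le> ennreal C * emeasure \<mu> E"
  using assms unfolding dyadic_doubling_def by blast+

lemma Ainf_dyadic_doubling:
  "\<exists>C>0. \<exists>D>0. \<forall>w :: real ^ 'n \<Rightarrow> ennreal. w \<in> Ainf \<longrightarrow> Ainf_const w = a \<longrightarrow> dyadic_doubling C D (density lebesgue w)"
proof -
  \<comment> \<open>The volume of half of Q relative to 3Q, and of 3Q relative to 9Q.\<close>
  have p: "1 / (2 * 3 ^ CARD('n)) > (0::real)" "1 / 3 ^ CARD('n) > (0::real)" by simp_all
  obtain C where C: "C > 0" "\<And>(w :: real ^ 'n \<Rightarrow> ennreal) Q E. w \<in> Ainf \<Longrightarrow> Ainf_const w = a \<Longrightarrow> Q \<in> cubes \<Longrightarrow>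
     E \<in> sets lebesgue \<Longrightarrow> E \<subseteq> Q \<Longrightarrow> ennreal (1 / (2 * 3 ^ CARD('n))) * emeasure lebesgue Q \<le> emeasure lebesgue E \<Longrightarrow>
     (\<integral>\<^sup>+x\<in>Q. w x \<partial>lebesgue) \<le> ennreal C * (\<integral>\<^sup>+x\<in>E. w x \<partial>lebesgue)"
    using Ainf_subset_bound[OF p(1), of a, where 'n = 'n] by blast
  obtain D where D: "D > 0" "\<And>(w :: real ^ 'n \<Rightarrow> ennreal) Q E. w \<in> Ainf \<Longrightarrow> Ainf_const w = a \<Longrightarrow> Q \<in> cubes \<Longrightarrow>
     E \<in> sets lebesgue \<Longrightarrow> E \<subseteq> Q \<Longrightarrow> ennreal (1 / 3 ^ CARD('n)) * emeasure lebesgue Q \<le> emeasure lebesgue E \<Longrightarrow>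
     (\<integral>\<^sup>+x\<in>Q. w x \<partial>lebesgue) \<le> ennreal D * (\<integral>\<^sup>+x\<in>E. w x \<partial>lebesgue)"
    using Ainf_subset_bound[OF p(2), of a, where 'n = 'n] by blast
  have "dyadic_doubling C D (density lebesgue w)" if w: "w \<in> Ainf" "Ainf_const w = a" for w :: "real ^ 'n \<Rightarrow> ennreal"
  proof -
    have [measurable]: "w \<in> borel_measurable lebesgue" by (rule Ainf_measurable[OF w(1)])
    have em: "emeasure (density lebesgue w) A = (\<integral>\<^sup>+x\<in>A. w x \<partial>lebesgue)" if "A \<in> sets lebesgue" for A
      using that by (simp add: emeasure_density)
    have fin: "emeasure (density lebesgue w) (dilate 1 i) < top" for i :: "int \<times> (int ^ 'n)"
      using loc_integrable_cube[OF Ainf_loc_integrable[OF w(1)] dilate_cubes[of 1 i]] by (simp add: em)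
    have dbl: "emeasure (density lebesgue w) (dilate 4 i) \<le> ennreal D * emeasure (density lebesgue w) (dilate 1 i)" for i :: "int \<times> (int ^ 'n)"
    proof -
      have sub: "dilate 1 i \<subseteq> dilate 4 i"
        by (rule dilate_vitali) (use dyadic_subset_dilate[of 1 i] dyadic_nonempty[of i] in auto)
      have "1 / 3 ^ CARD('n) * ((9 * side i) ^ CARD('n)) = (3 * side i) ^ CARD('n)"
      proof -
        have "(9 :: real) ^ CARD('n) = 3 ^ CARD('n) * 3 ^ CARD('n)"
          by (simp flip: power_mult_distrib)
        then show ?thesis by (simp add: power_mult_distrib)
      qed
      then have "ennreal (1 / 3 ^ CARD('n)) * emeasure lebesgue (dilate 4 i) \<le> emeasure lebesgue (dilate 1 i)"
        by (simp add: emeasure_dilate flip: ennreal_mult')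
      then show ?thesis
        using D(2)[OF w dilate_cubes[of 4 i] dilate_sets sub] by (simp add: em)
    qed
    have cmp: "emeasure (density lebesgue w) (dilate 1 i) \<le> ennreal C * emeasure (density lebesgue w) E"
      if E: "E \<in> sets lebesgue" "E \<subseteq> dyadic i" "emeasure lebesgue (dyadic i) \<le> 2 * emeasure lebesgue E" for i E
    proof -
      have sub: "E \<subseteq> dilate 1 i"
        using E(2) dyadic_subset_dilate[of 1 i] by simp
      have "ennreal (1 / (2 * 3 ^ CARD('n))) * emeasure lebesgue (dilate 1 i)
          = ennreal (1 / (2 * 3 ^ CARD('n)) * (3 * side i) ^ CARD('n))"
        by (simp add: emeasure_dilate flip: ennreal_mult')
      also have "1 / (2 * 3 ^ CARD('n)) * (3 * side i) ^ CARD('n) = 1 / 2 * side i ^ CARD('n)"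
        by (simp add: power_mult_distrib)
      also have "ennreal (1 / 2 * side i ^ CARD('n)) = ennreal (1 / 2) * emeasure lebesgue (dyadic i)"
        unfolding emeasure_dyadic by (intro ennreal_mult) auto
      also have "\<dots> \<le> ennreal (1 / 2) * (ennreal 2 * emeasure lebesgue E)"
        using E(3) by (intro mult_left_mono) auto
      also have "\<dots> = emeasure lebesgue E"
        by (subst mult.assoc[symmetric], subst ennreal_mult[symmetric]) auto
      finally show ?thesis
        using C(2)[OF w dilate_cubes[of 1 i] E(1) sub] E(1) by (simp add: em)
    qed
    show ?thesis
      unfolding dyadic_doubling_def using fin dbl cmp by simp
  qed
  with C(1) D(1) show ?thesis by blast
qed

section \<open>Sparse sums and the bilinear form over dyadic cubes\<close>

lemma dyadic_doubling_integral_finite: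
  fixes f :: "real ^ 'n \<Rightarrow> real"
  assumes \<mu>: "dyadic_doubling C D \<mu>" and [measurable]: "f \<in> borel_measurable lebesgue" and f: "\<And>x. f x \<ge> 0"
    and r: "r > 1" and X: "(\<integral>\<^sup>+x. ennreal (f x powr r) \<partial>\<mu>) < top"
  shows "(\<integral>\<^sup>+x\<in>dilate 1 i. ennreal (f x) \<partial>\<mu>) < top"
proof -
  have [measurable_cong]: "sets \<mu> = sets lebesgue"
    using \<mu> by (simp add: dyadic_doubling_def)
  have "(\<integral>\<^sup>+x\<in>dilate 1 i. ennreal (f x) \<partial>\<mu>) \<le> (\<integral>\<^sup>+x. indicator (dilate 1 i) x + ennreal (f x powr r) \<partial>\<mu>)"
  proof (intro nn_integral_mono)
    fix x
    have "f x \<le> 1 + f x powr r"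
    proof (cases "f x \<le> 1")
      case False
      then have "f x powr 1 \<le> f x powr r" using r by (intro powr_mono) auto
      then show ?thesis using False by simp
    qed (use powr_ge_zero[of "f x" r] in linarith)
    then have "ennreal (f x) \<le> 1 + ennreal (f x powr r)"
      by (metis ennreal_1 ennreal_leI ennreal_plus powr_ge_zero zero_le_one)
    then show "ennreal (f x) * indicator (dilate 1 i) x \<le> indicator (dilate 1 i) x + ennreal (f x powr r)"
      by (auto split: split_indicator)
  qed
  also have "\<dots> = emeasure \<mu> (dilate 1 i) + (\<integral>\<^sup>+x. ennreal (f x powr r) \<partial>\<mu>)"
    by (simp add: nn_integral_add)
  also have "\<dots> < top"
    using dyadic_doublingD(2)[OF \<mu>] X by (simp add: less_top[symmetric])
  finally show ?thesis .
qed

text \<open>Applies \<open>strong_embedding\<close> to the averages \<open>m / M\<close> over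
  triples. The factor \<open>M powr (1 / r)\<close> turns the Carleson sum into the sum of r-th
  powers that \<open>holder_sum\<close> expects.\<close>

lemma sparse_embedding:
  fixes S :: "(int \<times> (int ^ 'n)) set" and f :: "real ^ 'n \<Rightarrow> real"
  assumes \<mu>: "dyadic_doubling C D \<mu>" and S: "finite S"
    and E: "\<And>i. i \<in> S \<Longrightarrow> E i \<in> sets lebesgue \<and> E i \<subseteq> dyadic i \<and> emeasure lebesgue (dyadic i) \<le> 2 * emeasure lebesgue (E i)"
    and disj: "disjoint_family_on E S"
    and f[measurable]: "f \<in> borel_measurable lebesgue" "\<And>x. f x \<ge> 0"
    and r: "r > 1" and CD: "C > 0" "D > 0" and X: "X > 0" "(\<integral>\<^sup>+x. ennreal (f x powr r) \<partial>\<mu>) \<le> ennreal (X powr r)"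
  defines "m \<equiv> \<lambda>i :: int \<times> (int ^ 'n). enn2real (\<integral>\<^sup>+x\<in>dilate 1 i. ennreal (f x) \<partial>\<mu>)"
    and "M \<equiv> \<lambda>i :: int \<times> (int ^ 'n). measure \<mu> (dilate 1 i)"
  shows "(\<Sum>i\<in>S. (M i powr (1 / r) * (m i / M i)) powr r) \<le> (embedding_const r C D powr (1 / r) * X) powr r"
    and "m i / M i * M i = m i"
    and "(\<integral>\<^sup>+x\<in>dilate 1 i. ennreal (f x) \<partial>\<mu>) = ennreal (m i)"
proof -
  note sets_mu[measurable_cong] = dyadic_doublingD(1)[OF \<mu>]
  note fin = dyadic_doublingD(2)[OF \<mu>] and dbl = dyadic_doublingD(3)[OF \<mu>] and cmp = dyadic_doublingD(4)[OF \<mu>]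
  have "(\<integral>\<^sup>+x. ennreal (f x powr r) \<partial>\<mu>) < top"
    using X(2) by (rule le_less_trans) simp
  then have finf: "(\<integral>\<^sup>+x\<in>dilate 1 i. ennreal (f x) \<partial>\<mu>) < top" for i
    using dyadic_doubling_integral_finite[OF \<mu> f r] by blast
  have m: "(\<integral>\<^sup>+x\<in>dilate 1 i. ennreal (f x) \<partial>\<mu>) = ennreal (m i)" for i
    using finf[of i] by (simp add: m_def)
  have M: "emeasure \<mu> (dilate 1 i) = ennreal (M i)" for i
    using fin[of i] by (simp add: M_def emeasure_eq_ennreal_measure)
  have m_nonneg: "m i \<ge> 0" for i by (simp add: m_def)
  have M_nonneg: "M i \<ge> 0" for i by (simp add: M_def)
  \<comment> \<open>With \<open>M i = 0\<close> the quotient \<open>m i / M i\<close> is 0 by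
    convention; as \<open>m i\<close> vanishes too, average times mass gives back \<open>m i\<close>
    without exception.\<close>
  have zero: "m i = 0" if "M i = 0" for i
  proof -
    have "dilate 1 i \<in> null_sets \<mu>"
      using that M[of i] sets_mu by (auto simp: null_sets_def)
    then have "(\<integral>\<^sup>+x\<in>dilate 1 i. ennreal (f x) \<partial>\<mu>) = 0"
      by (rule nn_integral_null_set)
    then show ?thesis by (simp add: m_def)
  qed
  show "m i / M i * M i = m i" "(\<integral>\<^sup>+x\<in>dilate 1 i. ennreal (f x) \<partial>\<mu>) = ennreal (m i)" for i
    using zero[of i] m[of i] by auto
  have "(\<Sum>i\<in>S. emeasure \<mu> (dilate 1 i) * ennreal ((m i / M i) powr r))
    \<le> ennreal (embedding_const r C D) * (\<integral>\<^sup>+y. ennreal (f y powr r) \<partial>\<mu>)"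
  proof (rule strong_embedding[OF S sets_mu fin dbl _ disj f])
    fix i assume "i \<in> S"
    show "E i \<in> sets lebesgue \<and> E i \<subseteq> dilate 1 i \<and> emeasure \<mu> (dilate 1 i) \<le> ennreal C * emeasure \<mu> (E i)"
      using E[OF \<open>i \<in> S\<close>] cmp[of "E i" i] dyadic_subset_dilate[of 1 i] by auto
    show "m i / M i \<ge> 0" using m_nonneg M_nonneg by simp
    have "ennreal (m i / M i) * ennreal (M i) = ennreal (m i)"
      using zero[of i] m_nonneg[of i] M_nonneg[of i] by (cases "M i = 0") (auto simp flip: ennreal_mult)
    then show "ennreal (m i / M i) * emeasure \<mu> (dilate 1 i) \<le> (\<integral>\<^sup>+y\<in>dilate 1 i. ennreal (f y) \<partial>\<mu>)"
      by (simp add: m M)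
  qed (use CD r in auto)
  also have "\<dots> \<le> ennreal (embedding_const r C D) * ennreal (X powr r)"
    by (intro mult_left_mono X(2)) auto
  also have "\<dots> = ennreal (embedding_const r C D * X powr r)"
    by (simp add: ennreal_mult'')
  also have "(\<Sum>i\<in>S. emeasure \<mu> (dilate 1 i) * ennreal ((m i / M i) powr r)) = ennreal (\<Sum>i\<in>S. M i * (m i / M i) powr r)"
    using M_nonneg by (simp add: M ennreal_mult' flip: sum_ennreal)
  finally have "(\<Sum>i\<in>S. M i * (m i / M i) powr r) \<le> embedding_const r C D * X powr r"
    using embedding_const_nonneg[of r C D] CD r by (subst (asm) ennreal_le_iff) auto
  moreover have "(M i powr (1 / r) * (m i / M i)) powr r = M i * (m i / M i) powr r" for i
    using r m_nonneg[of i] M_nonneg[of i] by (subst powr_mult) (auto simp: powr_powr)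
  moreover have "(embedding_const r C D powr (1 / r) * X) powr r = embedding_const r C D * X powr r"
    using r X(1) embedding_const_nonneg[of r C D] CD by (simp add: powr_mult powr_powr)
  ultimately show "(\<Sum>i\<in>S. (M i powr (1 / r) * (m i / M i)) powr r) \<le> (embedding_const r C D powr (1 / r) * X) powr r"
    by simp
qed

lemma embedding_const_pos: "r > 1 \<Longrightarrow> C > 0 \<Longrightarrow> D > 0 \<Longrightarrow> embedding_const r C D > 0"
  using powr_less_mono[of "- (r - 1)" 0 2] by (auto simp: embedding_const_def intro!: divide_pos_pos)

text \<open>The 4 is 2 from the stopping rule times 2 from \<open>holder_sum\<close>; the next
  factor sums the scales below a stopping cube, and the last two come from the embeddings.\<close>

definition bilinear_const :: "'n::finite itself \<Rightarrow> real \<Rightarrow> real \<Rightarrow> real \<Rightarrow> real \<Rightarrow> real \<Rightarrow> real \<Rightarrow> real \<Rightarrow> real" where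
  "bilinear_const n \<alpha> p q C D C' D' = 4 * (overlap n / (1 - 2 powr (- \<alpha>)))
     * (embedding_const p C D powr (1 / p) * embedding_const (conj_exp q) C' D' powr (1 / conj_exp q))"

text \<open>\<open>cond\<close> is the two-weight condition multiplied by
  \<open>M powr (1 / p) * N powr (1 / q')\<close>, with \<open>M\<close> and \<open>N\<close> the
  masses of a triple, so that triples of mass 0 need no separate treatment. The bound does not
  depend on \<open>F\<close>.\<close>

lemma bilinear_finite:
  fixes F :: "(int \<times> (int ^ 'n)) set" and f h :: "real ^ 'n \<Rightarrow> real" and \<alpha> p q A :: real
  assumes \<mu>: "dyadic_doubling C D \<mu>" and \<nu>: "dyadic_doubling C' D' \<nu>" and F: "finite F"
    and CD: "C > 0" "D > 0" "C' > 0" "D' > 0"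
    and p: "1 < p" "p \<le> q" and \<alpha>: "\<alpha> > 0" and A: "A \<ge> 0"
    and cond: "\<And>i :: int \<times> (int ^ 'n). measure \<mu> (dilate 1 i) * measure \<nu> (dilate 1 i) * side i powr (\<alpha> - CARD('n))
      \<le> A * (measure \<mu> (dilate 1 i) powr (1 / p) * measure \<nu> (dilate 1 i) powr (1 / conj_exp q))"
    and f[measurable]: "f \<in> borel_measurable lebesgue" "\<And>x. f x \<ge> 0"
    and h[measurable]: "h \<in> borel_measurable lebesgue" "\<And>x. h x \<ge> 0"
    and X: "X > 0" "(\<integral>\<^sup>+x. ennreal (f x powr p) \<partial>\<mu>) \<le> ennreal (X powr p)"
    and Y: "Y > 0" "(\<integral>\<^sup>+x. ennreal (h x powr conj_exp q) \<partial>\<nu>) \<le> ennreal (Y powr conj_exp q)"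
  shows "(\<Sum>i\<in>F. ennreal (side i powr (\<alpha> - CARD('n))) * ((\<integral>\<^sup>+x\<in>dyadic i. ennreal (f x) \<partial>\<mu>) * (\<integral>\<^sup>+x\<in>dilate 1 i. ennreal (h x) \<partial>\<nu>)))
    \<le> ennreal (bilinear_const TYPE('n) \<alpha> p q C D C' D' * A * X * Y)"
proof -
  have sets[measurable_cong]: "sets \<mu> = sets lebesgue" "sets \<nu> = sets lebesgue"
    using \<mu> \<nu> by (simp_all add: dyadic_doubling_def)
  have q': "conj_exp q > 1" using p conj_exp_pos[of q] by simp
  \<comment> \<open>Stopping concerns averages of this measure against Lebesgue measure, not against
    \<open>\<mu>\<close>: they appear once \<open>side powr (\<alpha> - n)\<close> is split into
    \<open>side powr \<alpha>\<close> and the inverse volume.\<close>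
  define \<mu>f where "\<mu>f = density \<mu> (\<lambda>x. ennreal (f x))"
  have sets_f: "sets \<mu>f = sets lebesgue" by (simp add: \<mu>f_def sets)
  have "(\<integral>\<^sup>+x. ennreal (f x powr p) \<partial>\<mu>) < top"
    using X(2) by (rule le_less_trans) simp
  note fin_f = dyadic_doubling_integral_finite[OF \<mu> f p(1) this]
  have em_f: "emeasure \<mu>f B = (\<integral>\<^sup>+x\<in>B. ennreal (f x) \<partial>\<mu>)" if "B \<in> sets lebesgue" for B
    using that by (simp add: \<mu>f_def emeasure_density sets)
  have le_dil: "emeasure \<mu>f (dyadic i) \<le> (\<integral>\<^sup>+x\<in>dilate 1 i. ennreal (f x) \<partial>\<mu>)" for i
    using dyadic_subset_dilate[of 1 i] by (simp add: em_f nn_set_integral_set_mono)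
  have fin_d: "emeasure \<mu>f (dyadic i) < top" for i
    using le_dil[of i] fin_f[of i] by (rule le_less_trans)
  define a where "a = (\<lambda>i :: int \<times> (int ^ 'n). measure \<mu>f (dyadic i) / side i ^ CARD('n))"
  obtain S E where S: "S \<subseteq> F"
    and par: "\<And>i. i \<in> F \<Longrightarrow> \<exists>j\<in>S. fst i \<le> fst j \<and> dyadic i \<subseteq> dyadic j \<and> a i \<le> 2 * a j"
    and E: "\<And>i. i \<in> S \<Longrightarrow> E i \<in> sets lebesgue \<and> E i \<subseteq> dyadic i \<and> emeasure lebesgue (dyadic i) \<le> 2 * emeasure lebesgue (E i)"
    and disj: "disjoint_family_on E S"
    using sparse_selection[OF F sets_f fin_d] unfolding a_def by blast
  have finS: "finite S" using S F finite_subset by blast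
  \<comment> \<open>A stopping cube above each \<open>i\<close>. Replacing \<open>a i\<close> by
    \<open>2 * a (\<pi> i)\<close> freezes the first function and leaves a sum over the scales below
    \<open>\<pi> i\<close>.\<close>
  obtain \<pi> where \<pi>: "\<And>i. i \<in> F \<Longrightarrow> \<pi> i \<in> S" "\<And>i. i \<in> F \<Longrightarrow> fst i \<le> fst (\<pi> i)"
    "\<And>i. i \<in> F \<Longrightarrow> dyadic i \<subseteq> dyadic (\<pi> i)" "\<And>i. i \<in> F \<Longrightarrow> a i \<le> 2 * a (\<pi> i)"
    using par by metis
  define m where "m i = enn2real (\<integral>\<^sup>+x\<in>dilate 1 i. ennreal (f x) \<partial>\<mu>)" for i :: "int \<times> (int ^ 'n)"
  define n where "n i = enn2real (\<integral>\<^sup>+x\<in>dilate 1 i. ennreal (h x) \<partial>\<nu>)" for i :: "int \<times> (int ^ 'n)"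
  define M where "M i = measure \<mu> (dilate 1 i)" for i :: "int \<times> (int ^ 'n)"
  define N where "N i = measure \<nu> (dilate 1 i)" for i :: "int \<times> (int ^ 'n)"
  note emb_f = sparse_embedding[OF \<mu> finS E disj f p(1) CD(1,2) X, folded m_def M_def]
  note emb_h = sparse_embedding[OF \<nu> finS E disj h q' CD(3,4) Y, folded n_def N_def]
  have nonneg: "a i \<ge> 0" "m i \<ge> 0" "n i \<ge> 0" "M i \<ge> 0" "N i \<ge> 0" for i
    by (simp_all add: a_def m_def n_def M_def N_def)
  define \<nu>h where "\<nu>h = (\<lambda>i :: int \<times> (int ^ 'n). (\<integral>\<^sup>+x\<in>dilate 1 i. ennreal (h x) \<partial>\<nu>))"
  have \<nu>h: "\<nu>h i = ennreal (n i)" for i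
    using emb_h(3) by (simp add: \<nu>h_def)
  define G where "G = overlap TYPE('n) / (1 - 2 powr (- \<alpha>))"
  have G: "G \<ge> 0"
    using \<alpha> powr_mono[of "- \<alpha>" 0 2] by (simp add: G_def)
  have side_pow: "side i powr (\<alpha> - CARD('n)) * side i ^ CARD('n) = side i powr \<alpha>" for i :: "int \<times> (int ^ 'n)"
    by (simp add: powr_diff powr_realpow)
  have summand: "ennreal (side i powr (\<alpha> - CARD('n))) * ((\<integral>\<^sup>+x\<in>dyadic i. ennreal (f x) \<partial>\<mu>) * \<nu>h i)
      = ennreal (a i) * (ennreal (side i powr \<alpha>) * \<nu>h i)" for i
  proof -
    have "(\<integral>\<^sup>+x\<in>dyadic i. ennreal (f x) \<partial>\<mu>) = ennreal (a i * side i ^ CARD('n))"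
      using fin_d[of i] by (simp add: em_f[symmetric] a_def emeasure_eq_ennreal_measure)
    then show ?thesis
      unfolding \<nu>h side_pow[symmetric] using nonneg(1)[of i] nonneg(3)[of i]
      by (simp add: mult_ac flip: ennreal_mult)
  qed
  have "(\<Sum>i\<in>F. ennreal (side i powr (\<alpha> - CARD('n))) * ((\<integral>\<^sup>+x\<in>dyadic i. ennreal (f x) \<partial>\<mu>) * \<nu>h i))
     \<le> (\<Sum>i\<in>F. ennreal (2 * a (\<pi> i)) * (ennreal (side i powr \<alpha>) * \<nu>h i))"
    unfolding summand using \<pi>(4) by (intro sum_mono mult_right_mono ennreal_leI) auto
  also have "\<dots> = (\<Sum>P\<in>\<pi> ` F. \<Sum>i\<in>{i\<in>F. \<pi> i = P}. ennreal (2 * a (\<pi> i)) * (ennreal (side i powr \<alpha>) * \<nu>h i))"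
    using F by (rule sum.image_gen)
  also have "\<dots> = (\<Sum>P\<in>\<pi> ` F. ennreal (2 * a P) * (\<Sum>i\<in>{i\<in>F. \<pi> i = P}. ennreal (side i powr \<alpha>) * \<nu>h i))"
    by (intro sum.cong refl) (simp add: sum_distrib_left)
  also have "\<dots> \<le> (\<Sum>P\<in>\<pi> ` F. ennreal (2 * a P) * (ennreal (G * side P powr \<alpha>) * \<nu>h P))"
  proof (intro sum_mono mult_left_mono)
    fix P assume "P \<in> \<pi> ` F"
    define FP where "FP = {i\<in>F. \<pi> i = P}"
    have FP: "finite FP" using F by (simp add: FP_def)
    have sub: "fst i \<le> fst P \<and> dilate 1 i \<subseteq> dilate 1 P" if "i \<in> FP" for i
    proof -
      have i: "i \<in> F" "\<pi> i = P" using that by (auto simp: FP_def)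
      obtain x where "x \<in> dyadic i" using dyadic_nonempty by blast
      then show ?thesis
        using \<pi>(2,3)[OF i(1)] i(2) dyadic_nested(2)[of x i P] by auto
    qed
    \<comment> \<open>Inside the integral only triples through the point \<open>x\<close> count, so
      \<open>sum_dilate_le\<close> applies pointwise.\<close>
    have "(\<Sum>i\<in>FP. ennreal (side i powr \<alpha>) * \<nu>h i)
        = (\<integral>\<^sup>+x. (\<Sum>i\<in>FP. ennreal (side i powr \<alpha>) * (ennreal (h x) * indicator (dilate 1 i) x)) \<partial>\<nu>)"
      unfolding \<nu>h_def by (subst nn_integral_sum) (auto simp: nn_integral_cmult)
    also have "\<dots> \<le> (\<integral>\<^sup>+x. ennreal (G * side P powr \<alpha>) * (ennreal (h x) * indicator (dilate 1 P) x) \<partial>\<nu>)"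
    proof (intro nn_integral_mono)
      fix x
      define FX where "FX = {i\<in>FP. x \<in> dilate 1 i}"
      have FX: "finite FX" "\<And>i. i \<in> FX \<Longrightarrow> fst i \<le> fst P \<and> x \<in> dilate 1 i"
        using FP sub by (auto simp: FX_def)
      have "(\<Sum>i\<in>FP. ennreal (side i powr \<alpha>) * (ennreal (h x) * indicator (dilate 1 i) x))
          = (\<Sum>i\<in>FX. ennreal (side i powr \<alpha>) * (ennreal (h x) * indicator (dilate 1 P) x))"
        unfolding FX_def using FP sub by (intro sum.mono_neutral_cong_right) (auto split: split_indicator)
      also have "\<dots> = ennreal (\<Sum>i\<in>FX. side i powr \<alpha>) * (ennreal (h x) * indicator (dilate 1 P) x)"
        by (simp add: sum_distrib_right flip: sum_ennreal)
      also have "\<dots> \<le> ennreal (G * side P powr \<alpha>) * (ennreal (h x) * indicator (dilate 1 P) x)"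
      proof (intro mult_right_mono ennreal_leI)
        show "(\<Sum>i\<in>FX. side i powr \<alpha>) \<le> G * side P powr \<alpha>"
          using sum_dilate_le[OF FX \<alpha>] by (simp add: G_def side_def powr_powr)
      qed auto
      finally show "(\<Sum>i\<in>FP. ennreal (side i powr \<alpha>) * (ennreal (h x) * indicator (dilate 1 i) x))
          \<le> ennreal (G * side P powr \<alpha>) * (ennreal (h x) * indicator (dilate 1 P) x)" .
    qed
    also have "\<dots> = ennreal (G * side P powr \<alpha>) * \<nu>h P"
      unfolding \<nu>h_def by (intro nn_integral_cmult) measurable
    finally show "(\<Sum>i\<in>{i\<in>F. \<pi> i = P}. ennreal (side i powr \<alpha>) * \<nu>h i) \<le> ennreal (G * side P powr \<alpha>) * \<nu>h P"
      by (simp add: FP_def)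
  qed auto
  also have "\<dots> \<le> (\<Sum>P\<in>S. ennreal (2 * a P) * (ennreal (G * side P powr \<alpha>) * \<nu>h P))"
    using \<pi>(1) finS by (intro sum_mono2) auto
  also have "\<dots> = ennreal (\<Sum>P\<in>S. 2 * a P * (G * side P powr \<alpha> * n P))"
    unfolding \<nu>h using G nonneg by (simp add: ennreal_mult' ennreal_mult'' flip: sum_ennreal)
  also have "(\<Sum>P\<in>S. 2 * a P * (G * side P powr \<alpha> * n P))
      \<le> (\<Sum>P\<in>S. 2 * G * A * ((M P powr (1 / p) * (m P / M P)) * (N P powr (1 / conj_exp q) * (n P / N P))))"
  proof (intro sum_mono)
    fix P assume "P \<in> S"
    have "a P * side P ^ CARD('n) \<le> m P"
    proof -
      have "ennreal (a P * side P ^ CARD('n)) \<le> ennreal (m P)"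
        using le_dil[of P] fin_d[of P] emb_f(3)[of P] by (simp add: a_def emeasure_eq_ennreal_measure)
      then show ?thesis using nonneg(2)[of P] by (simp add: ennreal_le_iff)
    qed
    then have "side P powr (\<alpha> - CARD('n)) * (a P * side P ^ CARD('n)) * n P \<le> side P powr (\<alpha> - CARD('n)) * m P * n P"
      using nonneg by (intro mult_right_mono mult_left_mono) auto
    also have "side P powr (\<alpha> - CARD('n)) * (a P * side P ^ CARD('n)) * n P = a P * side P powr \<alpha> * n P"
      unfolding side_pow[symmetric] by simp
    \<comment> \<open>Both integrals are written as average times mass; \<open>cond\<close> then
      trades the masses for the two factors of \<open>holder_sum\<close>.\<close>
    also have "side P powr (\<alpha> - CARD('n)) * m P * n P
        = (M P * N P * side P powr (\<alpha> - CARD('n))) * ((m P / M P) * (n P / N P))"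
    proof -
      have "(M P * N P * side P powr (\<alpha> - CARD('n))) * ((m P / M P) * (n P / N P))
          = side P powr (\<alpha> - CARD('n)) * (m P / M P * M P) * (n P / N P * N P)"
        by (simp only: mult_ac)
      then show ?thesis by (simp only: emb_f(2) emb_h(2))
    qed
    also have "\<dots> \<le> (A * (M P powr (1 / p) * N P powr (1 / conj_exp q))) * ((m P / M P) * (n P / N P))"
      using cond[of P] nonneg by (intro mult_right_mono) (auto simp: M_def N_def)
    finally have "(2 * G) * (a P * side P powr \<alpha> * n P)
       \<le> (2 * G) * ((A * (M P powr (1 / p) * N P powr (1 / conj_exp q))) * ((m P / M P) * (n P / N P)))"
      using G by (intro mult_left_mono) auto
    then show "2 * a P * (G * side P powr \<alpha> * n P)
       \<le> 2 * G * A * ((M P powr (1 / p) * (m P / M P)) * (N P powr (1 / conj_exp q) * (n P / N P)))"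
      by (simp only: mult_ac)
  qed
  also have "\<dots> = 2 * G * A * (\<Sum>P\<in>S. (M P powr (1 / p) * (m P / M P)) * (N P powr (1 / conj_exp q) * (n P / N P)))"
    by (rule sum_distrib_left[symmetric])
  also have "\<dots> \<le> 2 * G * A * (2 * (embedding_const p C D powr (1 / p) * X) * (embedding_const (conj_exp q) C' D' powr (1 / conj_exp q) * Y))"
  proof (intro mult_left_mono holder_sum[OF finS _ _ p])
    show "0 < embedding_const p C D powr (1 / p) * X" "0 < embedding_const (conj_exp q) C' D' powr (1 / conj_exp q) * Y"
      using X Y embedding_const_pos[OF p(1) CD(1,2)] embedding_const_pos[OF q' CD(3,4)] by auto
    show "(\<Sum>i\<in>S. (M i powr (1 / p) * (m i / M i)) powr p) \<le> (embedding_const p C D powr (1 / p) * X) powr p"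
      by (rule emb_f(1))
    show "(\<Sum>i\<in>S. (N i powr (1 / conj_exp q) * (n i / N i)) powr conj_exp q)
        \<le> (embedding_const (conj_exp q) C' D' powr (1 / conj_exp q) * Y) powr conj_exp q"
      by (rule emb_h(1))
  qed (use nonneg G A in auto)
  also have "\<dots> = bilinear_const TYPE('n) \<alpha> p q C D C' D' * A * X * Y"
    by (simp add: bilinear_const_def G_def mult_ac)
  finally show ?thesis
    by (simp add: \<nu>h_def ennreal_leI)
qed

lemma kernel_le_suminf:
  fixes x y :: "real ^ 'n" and e :: "nat \<Rightarrow> int \<times> (int ^ 'n)"
  assumes "surj e" "\<beta> > 0"
  shows "ennreal (1 / norm (x - y) powr \<beta>)
    \<le> ennreal (2 powr \<beta>) * (\<Sum>k. ennreal (side (e k) powr (- \<beta>)) * (indicator (dyadic (e k)) y * indicator (dilate 1 (e k)) x))"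
\<comment> \<open>On the diagonal the kernel is \<open>1 / 0\<close>, which is 0.\<close>
proof (cases "x = y")
  case False
  then obtain i where i: "y \<in> dyadic i" "x \<in> dilate 1 i"
    "1 / norm (x - y) powr \<beta> \<le> 2 powr \<beta> * 2 powr (- real_of_int (fst i) * \<beta>)"
    using kernel_le_dyadic[of x y \<beta>] assms by blast
  obtain k where k: "e k = i" using assms(1) by (metis surjD)
  have "ennreal (1 / norm (x - y) powr \<beta>) \<le> ennreal (2 powr \<beta> * side i powr (- \<beta>))"
    using i(3) by (intro ennreal_leI) (simp add: side_def powr_powr)
  also have "\<dots> = ennreal (2 powr \<beta>) * ennreal (side i powr (- \<beta>))"
    by (intro ennreal_mult) auto
  also have "\<dots> \<le> ennreal (2 powr \<beta>) * (\<Sum>k. ennreal (side (e k) powr (- \<beta>)) * (indicator (dyadic (e k)) y * indicator (dilate 1 (e k)) x))"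
  proof (intro mult_left_mono)
    have "ennreal (side i powr (- \<beta>)) = (\<Sum>k\<in>{k}. ennreal (side (e k) powr (- \<beta>)) * (indicator (dyadic (e k)) y * indicator (dilate 1 (e k)) x))"
      using i k by simp
    also have "\<dots> \<le> (\<Sum>k. ennreal (side (e k) powr (- \<beta>)) * (indicator (dyadic (e k)) y * indicator (dilate 1 (e k)) x))"
      by (intro sum_le_suminf) auto
    finally show "ennreal (side i powr (- \<beta>)) \<le> (\<Sum>k. ennreal (side (e k) powr (- \<beta>)) * (indicator (dyadic (e k)) y * indicator (dilate 1 (e k)) x))" .
  qed auto
  finally show ?thesis .
qed simp

text \<open>All dyadic cubes are enumerated: surjectivity serves the kernel bound, and injectivity
  turns partial sums into sums over finite sets, where \<open>bilinear_finite\<close> is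
  uniform.\<close>

lemma bilinear_kernel:
  fixes f h :: "real ^ 'n \<Rightarrow> real" and \<alpha> p q A :: real
  assumes \<mu>: "dyadic_doubling C D \<mu>" and \<nu>: "dyadic_doubling C' D' \<nu>"
    and CD: "C > 0" "D > 0" "C' > 0" "D' > 0"
    and p: "1 < p" "p \<le> q" and \<alpha>: "\<alpha> > 0" "\<alpha> < CARD('n)" and A: "A \<ge> 0"
    and cond: "\<And>i :: int \<times> (int ^ 'n). measure \<mu> (dilate 1 i) * measure \<nu> (dilate 1 i) * side i powr (\<alpha> - CARD('n))
      \<le> A * (measure \<mu> (dilate 1 i) powr (1 / p) * measure \<nu> (dilate 1 i) powr (1 / conj_exp q))"
    and f[measurable]: "f \<in> borel_measurable lebesgue" "\<And>x. f x \<ge> 0"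
    and h[measurable]: "h \<in> borel_measurable lebesgue" "\<And>x. h x \<ge> 0"
    and X: "X > 0" "(\<integral>\<^sup>+x. ennreal (f x powr p) \<partial>\<mu>) \<le> ennreal (X powr p)"
    and Y: "Y > 0" "(\<integral>\<^sup>+x. ennreal (h x powr conj_exp q) \<partial>\<nu>) \<le> ennreal (Y powr conj_exp q)"
  shows "(\<integral>\<^sup>+x. (\<integral>\<^sup>+y. ennreal (1 / norm (x - y) powr (CARD('n) - \<alpha>)) * ennreal (f y) \<partial>\<mu>) * ennreal (h x) \<partial>\<nu>)
    \<le> ennreal (2 powr (CARD('n) - \<alpha>) * (bilinear_const TYPE('n) \<alpha> p q C D C' D' * A * X * Y))"
proof -
  define \<beta> where "\<beta> = CARD('n) - \<alpha>"
  have \<beta>: "\<beta> > 0" "\<alpha> - CARD('n) = - \<beta>" using \<alpha> by (simp_all add: \<beta>_def)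
  note sets[measurable_cong] = dyadic_doublingD(1)[OF \<mu>] dyadic_doublingD(1)[OF \<nu>]
  have "infinite (UNIV :: (int \<times> (int ^ 'n)) set)"
    by (simp add: finite_prod)
  then obtain g :: "int \<times> (int ^ 'n) \<Rightarrow> nat" where "bij_betw g UNIV UNIV"
    using countableE_infinite[of "UNIV :: (int \<times> (int ^ 'n)) set"] by auto
  then obtain e :: "nat \<Rightarrow> int \<times> (int ^ 'n)" where e: "bij e"
    using bij_imp_bij_inv by blast
  then have surj: "surj e" and inj: "inj e" by (auto simp: bij_def)
  define s where "s k = ennreal (side (e k) powr (- \<beta>))" for k
  define I where "I k = (\<integral>\<^sup>+y\<in>dyadic (e k). ennreal (f y) \<partial>\<mu>)" for k
  define J where "J k = (\<integral>\<^sup>+x\<in>dilate 1 (e k). ennreal (h x) \<partial>\<nu>)" for k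
  have inner: "(\<integral>\<^sup>+y. ennreal (1 / norm (x - y) powr \<beta>) * ennreal (f y) \<partial>\<mu>)
      \<le> ennreal (2 powr \<beta>) * (\<Sum>k. s k * I k * indicator (dilate 1 (e k)) x)" for x
  proof -
    have "(\<integral>\<^sup>+y. ennreal (1 / norm (x - y) powr \<beta>) * ennreal (f y) \<partial>\<mu>)
      \<le> (\<integral>\<^sup>+y. (ennreal (2 powr \<beta>) * (\<Sum>k. s k * (indicator (dyadic (e k)) y * indicator (dilate 1 (e k)) x))) * ennreal (f y) \<partial>\<mu>)"
      unfolding s_def by (intro nn_integral_mono mult_right_mono kernel_le_suminf surj \<beta>) auto
    also have "\<dots> = (\<integral>\<^sup>+y. ennreal (2 powr \<beta>) * (\<Sum>k. (s k * indicator (dilate 1 (e k)) x) * (ennreal (f y) * indicator (dyadic (e k)) y)) \<partial>\<mu>)"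
    proof (intro nn_integral_cong)
      fix y
      have "(\<Sum>k. s k * (indicator (dyadic (e k)) y * indicator (dilate 1 (e k)) x)) * ennreal (f y)
         = (\<Sum>k. s k * (indicator (dyadic (e k)) y * indicator (dilate 1 (e k)) x) * ennreal (f y))"
        by (rule ennreal_suminf_multc[symmetric])
      also have "\<dots> = (\<Sum>k. (s k * indicator (dilate 1 (e k)) x) * (ennreal (f y) * indicator (dyadic (e k)) y))"
        by (simp only: mult_ac)
      finally show "(ennreal (2 powr \<beta>) * (\<Sum>k. s k * (indicator (dyadic (e k)) y * indicator (dilate 1 (e k)) x))) * ennreal (f y)
        = ennreal (2 powr \<beta>) * (\<Sum>k. (s k * indicator (dilate 1 (e k)) x) * (ennreal (f y) * indicator (dyadic (e k)) y))"
        by (simp only: mult.assoc)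
    qed
    also have "\<dots> = ennreal (2 powr \<beta>) * (\<Sum>k. \<integral>\<^sup>+y. (s k * indicator (dilate 1 (e k)) x) * (ennreal (f y) * indicator (dyadic (e k)) y) \<partial>\<mu>)"
      by (subst nn_integral_cmult, measurable, subst nn_integral_suminf, measurable)
    also have "(\<lambda>k. \<integral>\<^sup>+y. (s k * indicator (dilate 1 (e k)) x) * (ennreal (f y) * indicator (dyadic (e k)) y) \<partial>\<mu>)
       = (\<lambda>k. s k * I k * indicator (dilate 1 (e k)) x)"
      unfolding I_def by (subst nn_integral_cmult, measurable) (simp add: mult_ac)
    finally show ?thesis .
  qed
  have "(\<integral>\<^sup>+x. (\<integral>\<^sup>+y. ennreal (1 / norm (x - y) powr \<beta>) * ennreal (f y) \<partial>\<mu>) * ennreal (h x) \<partial>\<nu>)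
     \<le> (\<integral>\<^sup>+x. ennreal (2 powr \<beta>) * (\<Sum>k. s k * I k * indicator (dilate 1 (e k)) x) * ennreal (h x) \<partial>\<nu>)"
    by (intro nn_integral_mono mult_right_mono inner) auto
  also have "\<dots> = (\<integral>\<^sup>+x. ennreal (2 powr \<beta>) * (\<Sum>k. s k * I k * (ennreal (h x) * indicator (dilate 1 (e k)) x)) \<partial>\<nu>)"
  proof (intro nn_integral_cong)
    fix x
    have "(\<Sum>k. s k * I k * indicator (dilate 1 (e k)) x) * ennreal (h x) = (\<Sum>k. s k * I k * indicator (dilate 1 (e k)) x * ennreal (h x))"
      by (rule ennreal_suminf_multc[symmetric])
    also have "\<dots> = (\<Sum>k. s k * I k * (ennreal (h x) * indicator (dilate 1 (e k)) x))"
      by (simp only: mult_ac)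
    finally show "ennreal (2 powr \<beta>) * (\<Sum>k. s k * I k * indicator (dilate 1 (e k)) x) * ennreal (h x)
      = ennreal (2 powr \<beta>) * (\<Sum>k. s k * I k * (ennreal (h x) * indicator (dilate 1 (e k)) x))"
      by (simp only: mult.assoc)
  qed
  also have "\<dots> = ennreal (2 powr \<beta>) * (\<Sum>k. \<integral>\<^sup>+x. s k * I k * (ennreal (h x) * indicator (dilate 1 (e k)) x) \<partial>\<nu>)"
    by (subst nn_integral_cmult, measurable, subst nn_integral_suminf, measurable)
  also have "(\<lambda>k. \<integral>\<^sup>+x. s k * I k * (ennreal (h x) * indicator (dilate 1 (e k)) x) \<partial>\<nu>) = (\<lambda>k. s k * (I k * J k))"
    unfolding J_def by (subst nn_integral_cmult, measurable) (simp add: mult_ac)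
  also have "ennreal (2 powr \<beta>) * (\<Sum>k. s k * (I k * J k)) \<le> ennreal (2 powr \<beta>) * ennreal (bilinear_const TYPE('n) \<alpha> p q C D C' D' * A * X * Y)"
  proof (intro mult_left_mono suminf_le_const summableI)
    fix N
    have "(\<Sum>k<N. s k * (I k * J k)) = (\<Sum>i\<in>e ` {..<N}. ennreal (side i powr (\<alpha> - CARD('n))) * ((\<integral>\<^sup>+x\<in>dyadic i. ennreal (f x) \<partial>\<mu>) * (\<integral>\<^sup>+x\<in>dilate 1 i. ennreal (h x) \<partial>\<nu>)))"
      using inj by (subst sum.reindex) (auto simp: inj_on_def inj_def s_def I_def J_def \<beta>)
    also have "\<dots> \<le> ennreal (bilinear_const TYPE('n) \<alpha> p q C D C' D' * A * X * Y)"
      by (rule bilinear_finite[OF \<mu> \<nu> _ CD p \<alpha>(1) A cond f h X Y]) auto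
    finally show "(\<Sum>k<N. s k * (I k * J k)) \<le> ennreal (bilinear_const TYPE('n) \<alpha> p q C D C' D' * A * X * Y)" .
  qed auto
  also have "\<dots> = ennreal (2 powr \<beta> * (bilinear_const TYPE('n) \<alpha> p q C D C' D' * A * X * Y))"
    by (simp add: ennreal_mult')
  finally show ?thesis by (simp add: \<beta>_def)
qed

text \<open>Testing with \<open>h = t powr (q - 1)\<close> gives
  \<open>Z \<le> B * Z powr (1 / q')\<close> for the integral \<open>Z\<close> of
  \<open>t powr q\<close>. Cancelling requires \<open>Z\<close> finite; hence the truncations
  \<open>t N\<close> in height and space, which increase to \<open>T\<close>.\<close>

lemma nn_integral_powr_duality:
  fixes T :: "'a \<Rightarrow> ennreal" and W :: "nat \<Rightarrow> 'a set"
  assumes [measurable]: "T \<in> borel_measurable \<nu>" "\<And>N. W N \<in> sets \<nu>"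
    and W: "incseq W" "(\<Union>N. W N) = UNIV" "\<And>N. emeasure \<nu> (W N) < top"
    and q: "q > 1" and B: "B \<ge> 0"
    and dual: "\<And>h Y. h \<in> borel_measurable \<nu> \<Longrightarrow> (\<And>x. h x \<ge> 0) \<Longrightarrow> Y > 0 \<Longrightarrow>
      (\<integral>\<^sup>+x. ennreal (h x powr conj_exp q) \<partial>\<nu>) \<le> ennreal (Y powr conj_exp q) \<Longrightarrow>
      (\<integral>\<^sup>+x. T x * ennreal (h x) \<partial>\<nu>) \<le> ennreal (B * Y)"
  shows "(\<integral>\<^sup>+x. epowr (T x) q \<partial>\<nu>) \<le> ennreal (B powr q)"
proof -
  define t where "t N x = enn2real (min (T x) (of_nat N)) * indicator (W N) x" for N :: nat and x
  have [measurable]: "t N \<in> borel_measurable \<nu>" for N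
    unfolding t_def by measurable
  have t_nonneg: "t N x \<ge> 0" for N x by (simp add: t_def)
  have fin: "min (T x) (of_nat N) < top" for x N
    by (rule le_less_trans[OF min.cobounded2]) (simp add: of_nat_less_top)
  have t_le: "t N x \<le> real N * indicator (W N) x" for N x
    using enn2real_mono[of "min (T x) (of_nat N)" "of_nat N"] by (auto simp: t_def of_nat_less_top split: split_indicator)
  have t_le_T: "ennreal (t N x) \<le> T x" for N x
    using fin[of x N] by (auto simp: t_def split: split_indicator)
  have bound: "(\<integral>\<^sup>+x. ennreal (t N x powr q) \<partial>\<nu>) \<le> ennreal (B powr q)" for N
  proof -
    define Z where "Z = (\<integral>\<^sup>+x. ennreal (t N x powr q) \<partial>\<nu>)"
    have "Z \<le> (\<integral>\<^sup>+x. ennreal (real N powr q) * indicator (W N) x \<partial>\<nu>)"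
      unfolding Z_def
    proof (intro nn_integral_mono)
      fix x
      show "ennreal (t N x powr q) \<le> ennreal (real N powr q) * indicator (W N) x"
        using t_le[of N x] t_nonneg[of N x] q by (auto intro!: ennreal_leI powr_mono2 split: split_indicator_asm)
    qed
    also have "\<dots> = ennreal (real N powr q) * emeasure \<nu> (W N)"
      by (simp add: nn_integral_cmult_indicator)
    also have "\<dots> < top"
      using W(3)[of N] by (simp add: ennreal_mult_less_top)
    finally obtain z where z: "Z = ennreal z" "z \<ge> 0" by (cases Z) auto
    show ?thesis
    proof (cases "z = 0")
      case True
      then show ?thesis using z by (simp add: Z_def)
    next
      case False
      then have "z > 0" using z by simp
      define h where "h x = t N x powr (q - 1)" for x
      have qq: "(q - 1) * conj_exp q = q" using q by (simp add: conj_exp_def)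
      have "(\<integral>\<^sup>+x. ennreal (h x powr conj_exp q) \<partial>\<nu>) = Z"
        unfolding Z_def h_def by (simp add: powr_powr qq)
      also have "\<dots> = ennreal ((z powr (1 / conj_exp q)) powr conj_exp q)"
        using z conj_exp_pos[OF q] by (simp add: powr_powr)
      finally have "(\<integral>\<^sup>+x. T x * ennreal (h x) \<partial>\<nu>) \<le> ennreal (B * z powr (1 / conj_exp q))"
        using \<open>z > 0\<close> by (intro dual) (auto simp: h_def)
      moreover have "Z \<le> (\<integral>\<^sup>+x. T x * ennreal (h x) \<partial>\<nu>)"
        unfolding Z_def
      proof (intro nn_integral_mono)
        fix x
        have "t N x powr q = t N x * h x"
          using t_nonneg[of N x] by (simp add: h_def powr_mult_base)
        then have "ennreal (t N x powr q) = ennreal (t N x) * ennreal (h x)"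
          using t_nonneg[of N x] by (simp add: ennreal_mult')
        also have "\<dots> \<le> T x * ennreal (h x)"
          by (intro mult_right_mono t_le_T) auto
        finally show "ennreal (t N x powr q) \<le> T x * ennreal (h x)" .
      qed
      ultimately have "ennreal z \<le> ennreal (B * z powr (1 / conj_exp q))"
        unfolding z(1) by (rule order_trans[rotated])
      then have le: "z \<le> B * z powr (1 / conj_exp q)"
        using B by (subst (asm) ennreal_le_iff) auto
      have "z = z powr (1 / q) * z powr (1 / conj_exp q)"
        using \<open>z > 0\<close> conj_exp_sum[OF q] by (simp flip: powr_add)
      with le have "z powr (1 / q) \<le> B"
        using \<open>z > 0\<close> by (metis mult_le_cancel_right_pos powr_gt_zero less_irrefl)
      then have "(z powr (1 / q)) powr q \<le> B powr q"
        using q by (intro powr_mono2) auto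
      then show ?thesis
        using z q by (simp add: Z_def[symmetric] powr_powr ennreal_leI)
    qed
  qed
  have "(\<integral>\<^sup>+x. epowr (T x) q \<partial>\<nu>) \<le> (\<integral>\<^sup>+x. (SUP N. ennreal (t N x powr q)) \<partial>\<nu>)"
  proof (intro nn_integral_mono)
    fix x
    obtain N0 where N0: "x \<in> W N0" using W(2) by blast
    have in_W: "x \<in> W N" if "N \<ge> N0" for N
      using N0 incseqD[OF W(1) that] by blast
    show "epowr (T x) q \<le> (SUP N. ennreal (t N x powr q))"
    proof (cases "T x")
      case (real r)
      obtain N1 :: nat where "r \<le> real N1" using real_arch_simple by blast
      define N where "N = max N0 N1"
      have "r \<le> real N" "x \<in> W N"
        using \<open>r \<le> real N1\<close> in_W[of N] by (auto simp: N_def)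
      then have "t N x = r"
        using real by (simp add: t_def min_def flip: ennreal_of_nat_eq_real_of_nat)
      then have "epowr (T x) q = ennreal (t N x powr q)"
        using real q by (simp add: epowr_ennreal)
      then show ?thesis by (auto intro: SUP_upper2)
    next
      case top
      have "(SUP N. ennreal (t N x powr q)) = top"
      proof (rule ennreal_SUP_eq_top)
        fix n :: nat
        define N where "N = max (max N0 1) n"
        have "t N x = real N"
          using top in_W[of N] by (simp add: t_def N_def)
        moreover have "real n \<le> real N powr q"
        proof -
          have "real n \<le> real N powr 1" by (simp add: N_def)
          also have "\<dots> \<le> real N powr q" using q by (intro powr_mono) (auto simp: N_def)
          finally show ?thesis .
        qed
        ultimately show "\<exists>N\<in>UNIV. of_nat n \<le> ennreal (t N x powr q)"
          by (intro bexI[of _ N]) (auto simp: ennreal_of_nat_eq_real_of_nat intro!: ennreal_leI)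
      qed
      then show ?thesis by (simp only: top_greatest)
    qed
  qed
  also have "\<dots> = (SUP N. \<integral>\<^sup>+x. ennreal (t N x powr q) \<partial>\<nu>)"
  proof (intro nn_integral_monotone_convergence_SUP)
    show "incseq (\<lambda>N x. ennreal (t N x powr q))"
    proof (intro incseq_SucI le_funI ennreal_leI powr_mono2)
      fix N x
      have "W N \<subseteq> W (Suc N)" using W(1) by (simp add: incseq_Suc_iff)
      moreover have "enn2real (min (T x) (of_nat N)) \<le> enn2real (min (T x) (of_nat (Suc N)))"
        using fin[of x "Suc N"] by (intro enn2real_mono min.mono) auto
      ultimately show "t N x \<le> t (Suc N) x"
        by (auto simp: t_def split: split_indicator)
    qed (use q t_nonneg in auto)
  qed measurable
  also have "\<dots> \<le> ennreal (B powr q)"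
    by (intro SUP_least bound)
  finally show ?thesis .
qed

section \<open>Measurability and pointwise control of the Riesz potential; positivity of
  \<open>v\<close>\<close>

lemma sigma_finite_lebesgue: "sigma_finite_measure (lebesgue :: (real ^ 'n) measure)"
proof
  let ?A = "range (\<lambda>N :: nat. ball 0 (real N)) :: (real ^ 'n) set set"
  have "emeasure lebesgue (ball (0 :: real ^ 'n) (real N)) \<noteq> \<infinity>" for N
    using emeasure_lborel_ball_finite[of "0 :: real ^ 'n" "real N"]
    by (subst emeasure_completion_sets) auto
  moreover have "\<Union> ?A = UNIV"
    using reals_Archimedean2 by (force simp: dist_norm)
  ultimately show "\<exists>A. countable A \<and> A \<subseteq> sets lebesgue \<and> \<Union> A = space lebesgue \<and> (\<forall>a\<in>A. emeasure (lebesgue :: (real ^ 'n) measure) a \<noteq> \<infinity>)"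
    by (intro exI[of _ ?A]) auto
qed

lemma riesz_kernel_measurable:
  fixes f :: "real ^ 'n \<Rightarrow> ennreal"
  assumes [measurable]: "f \<in> borel_measurable lebesgue"
  shows "(\<lambda>x. \<integral>\<^sup>+y. ennreal (1 / norm (x - y) powr \<beta>) * f y \<partial>lebesgue) \<in> borel_measurable lebesgue"
proof -
  interpret sigma_finite_measure "lebesgue :: (real ^ 'n) measure"
    by (rule sigma_finite_lebesgue)
  have id: "(\<lambda>x :: real ^ 'n. x) \<in> lebesgue \<rightarrow>\<^sub>M borel"
    using measurable_completion[of "\<lambda>x. x" lborel borel] by simp
  note [measurable] = measurable_compose[OF measurable_fst id] measurable_compose[OF measurable_snd id]
  have "(\<lambda>z :: (real ^ 'n) \<times> (real ^ 'n). ennreal (1 / norm (fst z - snd z) powr \<beta>) * f (snd z)) \<in> borel_measurable (lebesgue \<Otimes>\<^sub>M lebesgue)"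
    by measurable
  then show ?thesis
    by (intro borel_measurable_nn_integral) (simp add: case_prod_beta')
qed

lemma dual_weight_pos: "p > 1 \<Longrightarrow> v x \<ge> 0 \<Longrightarrow> dual_weight p v x \<noteq> 0"
  by (cases "v x = 0") (auto simp: dual_weight_def epowr_def conj_exp_def)

lemma dual_weight_eq:
  assumes "p > 1" "v x > 0"
  shows "dual_weight p v x = ennreal (v x powr (- (1 / (p - 1))))"
proof -
  have "- conj_exp p / p = - (1 / (p - 1))"
    using assms by (simp add: conj_exp_def)
  then show ?thesis
    using assms by (simp only: dual_weight_def) (simp add: epowr_ennreal_pos)
qed

text \<open>At a zero of \<open>v\<close> the dual weight is infinite, which local integrability
  permits only on a null set.\<close>

lemma Ainf_dual_weight_AE:
  fixes v :: "real ^ 'n \<Rightarrow> real"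
  assumes "dual_weight p v \<in> Ainf" "p > 1" and v: "\<And>x. v x \<ge> 0"
  shows "AE x in lebesgue. v x > 0"
proof -
  have "AE x in lebesgue. x \<in> cball 0 (real N) \<longrightarrow> v x > 0" for N
  proof -
    have "(\<integral>\<^sup>+x\<in>cball 0 (real N). dual_weight p v x \<partial>lebesgue) < \<infinity>"
      using Ainf_loc_integrable[OF assms(1)] by (simp add: loc_integrable_def)
    then have "AE x in lebesgue. dual_weight p v x * indicator (cball 0 (real N)) x \<noteq> \<infinity>"
      by (intro nn_integral_PInf_AE borel_measurable_times_ennreal borel_measurable_indicator
          Ainf_measurable[OF assms(1)]) auto
    then show ?thesis
    proof eventually_elim
      case (elim x)
      show ?case
      proof
        assume "x \<in> cball 0 (real N)"
        then have "dual_weight p v x \<noteq> top" using elim by simp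
        then have "v x \<noteq> 0"
          using assms(2) by (auto simp: dual_weight_def epowr_def conj_exp_def)
        then show "v x > 0" using v[of x] by simp
      qed
    qed
  qed
  then have "AE x in lebesgue. \<forall>N. x \<in> cball 0 (real N) \<longrightarrow> v x > 0"
    unfolding AE_all_countable by (rule allI)
  then show ?thesis
  proof eventually_elim
    case (elim x)
    obtain N where "norm x \<le> real N" using real_arch_simple by blast
    then show ?case using elim by (auto simp: dist_norm)
  qed
qed

text \<open>Under the convention \<open>\<infinity> - \<infinity> = \<infinity>\<close> the right
  side is infinite as well. So \<open>riesz\<close> is dominated by the positive potential of
  \<open>|f|\<close> even where its integral is undefined.\<close>

lemma e2ennreal_abs_diff_le: "e2ennreal \<bar>enn2ereal a - enn2ereal b\<bar> \<le> a + b"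
proof (cases "a = top \<or> b = top")
  case False
  then obtain r s where rs: "a = ennreal r" "b = ennreal s" "r \<ge> 0" "s \<ge> 0"
    by (cases a; cases b) auto
  then have "e2ennreal \<bar>enn2ereal a - enn2ereal b\<bar> = ennreal \<bar>r - s\<bar>"
    by (simp add: enn2ereal_ennreal e2ennreal_ereal)
  also have "\<dots> \<le> ennreal (r + s)"
    using rs by (intro ennreal_leI) auto
  finally show ?thesis using rs by simp
qed auto

lemma riesz_le:
  fixes f :: "real ^ 'n \<Rightarrow> real" and \<alpha> :: real
  assumes [measurable]: "f \<in> borel_measurable lebesgue"
  shows "e2ennreal \<bar>riesz \<alpha> f x\<bar> \<le> (\<integral>\<^sup>+y. ennreal (1 / norm (x - y) powr (CARD('n) - \<alpha>)) * ennreal \<bar>f y\<bar> \<partial>lebesgue)"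
proof -
  define g where "g y = f y / norm (x - y) powr (real CARD('n) - \<alpha>)" for y
  have id: "(\<lambda>x :: real ^ 'n. x) \<in> lebesgue \<rightarrow>\<^sub>M borel"
    using measurable_completion[of "\<lambda>x. x" lborel borel] by simp
  note [measurable] = id
  have [measurable]: "g \<in> borel_measurable lebesgue"
    unfolding g_def by measurable
  have "e2ennreal \<bar>riesz \<alpha> f x\<bar> \<le> (\<integral>\<^sup>+y. ennreal (g y) \<partial>lebesgue) + (\<integral>\<^sup>+y. ennreal (- g y) \<partial>lebesgue)"
    unfolding riesz_def eintegral_def g_def[symmetric]
    using e2ennreal_abs_diff_le by (simp add: e2ennreal_ereal)
  also have "\<dots> = (\<integral>\<^sup>+y. ennreal (g y) + ennreal (- g y) \<partial>lebesgue)"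
    by (rule nn_integral_add[symmetric]) measurable
  also have "\<dots> = (\<integral>\<^sup>+y. ennreal (1 / norm (x - y) powr (CARD('n) - \<alpha>)) * ennreal \<bar>f y\<bar> \<partial>lebesgue)"
  proof (intro nn_integral_cong)
    fix y
    have "ennreal (g y) + ennreal (- g y) = ennreal \<bar>g y\<bar>"
      by (cases "g y \<ge> 0") (auto simp: ennreal_neg)
    also have "\<bar>g y\<bar> = 1 / norm (x - y) powr (CARD('n) - \<alpha>) * \<bar>f y\<bar>"
      by (simp add: g_def abs_divide)
    also have "ennreal \<dots> = ennreal (1 / norm (x - y) powr (CARD('n) - \<alpha>)) * ennreal \<bar>f y\<bar>"
      by (intro ennreal_mult) auto
    finally show "ennreal (g y) + ennreal (- g y) = ennreal (1 / norm (x - y) powr (CARD('n) - \<alpha>)) * ennreal \<bar>f y\<bar>" .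
  qed
  finally show ?thesis .
qed

text \<open>On the triple, with side \<open>\<rho>\<close>, the powers of \<open>\<rho>\<close> from
  the volume and from the two averages combine to
  \<open>Theta - n / q - n / p' = \<alpha> - n\<close>. Multiplying by
  \<open>M powr (1 / p) * N powr (1 / q')\<close> produces the condition of the bilinear estimate;
  returning from \<open>\<rho>\<close> to \<open>side i\<close> costs
  \<open>3 powr (n - \<alpha>)\<close>.\<close>

lemma A_const_dilate:
  fixes u v :: "real ^ 'n \<Rightarrow> real" and i :: "int \<times> (int ^ 'n)" and \<alpha> p q A :: real
  assumes p: "1 < p" "p \<le> q" and u: "(\<lambda>x. ennreal (u x)) \<in> Ainf" and v: "dual_weight p v \<in> Ainf"
    and A: "A_const \<alpha> p q u v \<le> ennreal A" "A \<ge> 0" and Th: "Theta CARD('n) \<alpha> p q > 0"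
  defines "M \<equiv> measure (density lebesgue (dual_weight p v)) (dilate 1 i)"
    and "N \<equiv> measure (density lebesgue (\<lambda>x. ennreal (u x))) (dilate 1 i)"
  shows "M * N * side i powr (\<alpha> - CARD('n)) \<le> (3 powr (CARD('n) - \<alpha>) * A) * (M powr (1 / p) * N powr (1 / conj_exp q))"
proof -
  have p': "conj_exp p > 1" "conj_exp q > 1" using p conj_exp_pos by auto
  note [measurable] = Ainf_measurable[OF u] Ainf_measurable[OF v]
  define Q where "Q = dilate 1 i"
  have Q: "Q \<in> cubes" unfolding Q_def by (intro dilate_cubes) simp
  note [measurable] = cubes_sets[OF Q]
  define \<rho> where "\<rho> = 3 * side i"
  have \<rho>: "\<rho> > 0" by (simp add: \<rho>_def)
  have mQ: "emeasure lebesgue Q = ennreal (\<rho> powr CARD('n))"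
    using \<rho> by (simp add: Q_def emeasure_dilate \<rho>_def powr_realpow)
  have MN: "M \<ge> 0" "N \<ge> 0" by (simp_all add: M_def N_def)
  have pw: "(y / \<rho> powr d) powr (1 / r) = y powr (1 / r) * \<rho> powr (- d / r)" if "y \<ge> 0" for y d r :: real
    using that \<rho> by (simp add: powr_divide powr_powr powr_minus_divide)
  have int: "(\<integral>\<^sup>+x\<in>Q. dual_weight p v x \<partial>lebesgue) = ennreal M" "(\<integral>\<^sup>+x\<in>Q. ennreal (u x) \<partial>lebesgue) = ennreal N"
    using loc_integrable_cube[OF Ainf_loc_integrable[OF u] Q] loc_integrable_cube[OF Ainf_loc_integrable[OF v] Q]
    unfolding M_def N_def Q_def[symmetric]
    by (simp_all add: measure_def emeasure_density)
  have "epowr (emeasure lebesgue Q) (Theta CARD('n) \<alpha> p q / real CARD('n))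
        * epowr (avg Q (\<lambda>x. ennreal (u x))) (1 / q) * epowr (avg Q (dual_weight p v)) (1 / conj_exp p) \<le> ennreal A"
    using Q A(1) unfolding A_const_def by (auto simp: SUP_le_iff)
  also have "epowr (emeasure lebesgue Q) (Theta CARD('n) \<alpha> p q / real CARD('n)) = ennreal (\<rho> powr Theta CARD('n) \<alpha> p q)"
    unfolding mQ using \<rho> by (simp add: epowr_ennreal_pos powr_powr)
  also have "avg Q (\<lambda>x. ennreal (u x)) = ennreal (N / \<rho> powr CARD('n))"
    unfolding avg_def int mQ using \<rho> MN by (intro divide_ennreal) auto
  also have "avg Q (dual_weight p v) = ennreal (M / \<rho> powr CARD('n))"
    unfolding avg_def int mQ using \<rho> MN by (intro divide_ennreal) auto
  also have "epowr (ennreal (N / \<rho> powr CARD('n))) (1 / q) = ennreal (N powr (1 / q) * \<rho> powr (- CARD('n) / q))"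
    using \<rho> MN p pw[OF MN(2), of "CARD('n)" q] by (simp add: epowr_ennreal)
  also have "epowr (ennreal (M / \<rho> powr CARD('n))) (1 / conj_exp p) = ennreal (M powr (1 / conj_exp p) * \<rho> powr (- CARD('n) / conj_exp p))"
    using \<rho> MN p' pw[OF MN(1), of "CARD('n)" "conj_exp p"] by (simp add: epowr_ennreal)
  finally have "\<rho> powr Theta CARD('n) \<alpha> p q * (N powr (1 / q) * \<rho> powr (- CARD('n) / q)) * (M powr (1 / conj_exp p) * \<rho> powr (- CARD('n) / conj_exp p)) \<le> A"
    using A(2) by (simp add: ennreal_le_iff flip: ennreal_mult')
  also have "\<rho> powr Theta CARD('n) \<alpha> p q * (N powr (1 / q) * \<rho> powr (- CARD('n) / q)) * (M powr (1 / conj_exp p) * \<rho> powr (- CARD('n) / conj_exp p))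
     = (\<rho> powr Theta CARD('n) \<alpha> p q * \<rho> powr (- CARD('n) / q) * \<rho> powr (- CARD('n) / conj_exp p)) * (N powr (1 / q) * M powr (1 / conj_exp p))"
    by (simp only: mult_ac)
  also have "\<rho> powr Theta CARD('n) \<alpha> p q * \<rho> powr (- CARD('n) / q) * \<rho> powr (- CARD('n) / conj_exp p) = \<rho> powr (\<alpha> - CARD('n))"
  proof -
    have "1 / conj_exp p = 1 - 1 / p" using conj_exp_sum[OF p(1)] by simp
    then have "- CARD('n) / conj_exp p = - CARD('n) * (1 - 1 / p)" by (metis divide_inverse inverse_eq_divide)
    then have "Theta CARD('n) \<alpha> p q + - CARD('n) / q + - CARD('n) / conj_exp p = \<alpha> - CARD('n)"
      by (simp add: Theta_def algebra_simps)
    then show ?thesis by (simp flip: powr_add)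
  qed
  finally have A': "\<rho> powr (\<alpha> - CARD('n)) * (N powr (1 / q) * M powr (1 / conj_exp p)) \<le> A" .
  have split: "x = x powr (1 / r) * x powr (1 / conj_exp r)" if "x \<ge> 0" "r > 1" for x r :: real
    using that conj_exp_sum[of r] by (cases "x = 0") (auto simp flip: powr_add)
  have sd: "side i powr (\<alpha> - CARD('n)) = 3 powr (CARD('n) - \<alpha>) * \<rho> powr (\<alpha> - CARD('n))"
    by (simp add: \<rho>_def powr_mult mult.assoc[symmetric] flip: powr_add)
  have "M * N * side i powr (\<alpha> - CARD('n)) = (M powr (1 / p) * M powr (1 / conj_exp p)) * (N powr (1 / q) * N powr (1 / conj_exp q)) * side i powr (\<alpha> - CARD('n))"
    using split[OF MN(1) p(1)] split[OF MN(2), of q] p by simp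
  also have "\<dots> = (3 powr (CARD('n) - \<alpha>) * (\<rho> powr (\<alpha> - CARD('n)) * (N powr (1 / q) * M powr (1 / conj_exp p)))) * (M powr (1 / p) * N powr (1 / conj_exp q))"
    unfolding sd by (simp only: mult_ac)
  also have "\<dots> \<le> (3 powr (CARD('n) - \<alpha>) * A) * (M powr (1 / p) * N powr (1 / conj_exp q))"
    using A' by (intro mult_right_mono mult_left_mono) auto
  finally show ?thesis .
qed

text \<open>Duality in L^q for the measure \<open>u dx\<close> reduces the claim to the bilinear
  form of the positive kernel. In the constant, 6 is 2 from the kernel bound times 3 from the
  passage to triples.\<close>

lemma two_weight_riesz:
  fixes u v f :: "real ^ 'n \<Rightarrow> real" and \<alpha> p q A X :: real
  assumes p: "1 < p" "p \<le> q" and \<alpha>: "0 < \<alpha>" "\<alpha> < CARD('n)" and Th: "Theta CARD('n) \<alpha> p q > 0"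
    and [measurable]: "u \<in> borel_measurable lebesgue" "v \<in> borel_measurable lebesgue"
    and v: "\<And>x. 0 \<le> v x" and u': "(\<lambda>x. ennreal (u x)) \<in> Ainf" and v': "dual_weight p v \<in> Ainf"
    and \<mu>: "dyadic_doubling C D (density lebesgue (dual_weight p v))"
    and \<nu>: "dyadic_doubling C' D' (density lebesgue (\<lambda>x. ennreal (u x)))"
    and CD: "C > 0" "D > 0" "C' > 0" "D' > 0"
    and A: "A_const \<alpha> p q u v \<le> ennreal A" "A \<ge> 0"
    and f[measurable]: "f \<in> borel_measurable lebesgue"
    and X: "X > 0" "(\<integral>\<^sup>+x. ennreal (\<bar>f x\<bar> powr p * v x) \<partial>lebesgue) \<le> ennreal (X powr p)"
  shows "epowr (\<integral>\<^sup>+x. epowr (e2ennreal \<bar>riesz \<alpha> f x\<bar>) q * ennreal (u x) \<partial>lebesgue) (1 / q)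
    \<le> ennreal (6 powr (CARD('n) - \<alpha>) * bilinear_const TYPE('n) \<alpha> p q C D C' D' * A * X)"
proof -
  define \<sigma> where "\<sigma> = dual_weight p v"
  define \<mu>0 where "\<mu>0 = density lebesgue \<sigma>"
  define \<nu>0 where "\<nu>0 = density lebesgue (\<lambda>x. ennreal (u x))"
  note [measurable] = Ainf_measurable[OF v', folded \<sigma>_def]
  have sets_nu: "sets \<nu>0 = sets lebesgue" by (simp add: \<nu>0_def)
  have q: "q > 1" using p by simp
  \<comment> \<open>This is \<open>|f|\<close> divided by the dual weight wherever
    \<open>v > 0\<close>, so that the integral of \<open>F powr p\<close> against the dual weight is
    that of \<open>|f| powr p * v\<close>.\<close>
  define F where "F x = \<bar>f x\<bar> * v x powr (1 / (p - 1))" for x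
  have [measurable]: "F \<in> borel_measurable lebesgue" unfolding F_def by measurable
  have F_nonneg: "F x \<ge> 0" for x by (simp add: F_def)
  have pos: "AE x in lebesgue. v x > 0"
    by (rule Ainf_dual_weight_AE[OF v' p(1) v])
  have \<sigma>F: "\<sigma> x * ennreal (F x) = ennreal \<bar>f x\<bar>" if "v x > 0" for x
    using that p by (simp add: \<sigma>_def F_def dual_weight_eq mult.left_commute flip: ennreal_mult powr_add)
  have \<sigma>Fp: "\<sigma> x * ennreal (F x powr p) = ennreal (\<bar>f x\<bar> powr p * v x)" if "v x > 0" for x
  proof -
    have "p / (p - 1) - 1 / (p - 1) = 1"
      using p by (simp flip: diff_divide_distrib)
    then have "- (1 / (p - 1)) + 1 / (p - 1) * p = 1"
      by simp
    then have "v x powr (- (1 / (p - 1))) * (v x powr (1 / (p - 1))) powr p = v x"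
      using that by (simp add: powr_powr flip: powr_add)
    then have "v x powr (- (1 / (p - 1))) * F x powr p = \<bar>f x\<bar> powr p * v x"
      unfolding F_def by (subst powr_mult) (auto simp: mult.left_commute)
    then show ?thesis
      using that p by (simp add: \<sigma>_def dual_weight_eq flip: ennreal_mult)
  qed
  define T where "T x = (\<integral>\<^sup>+y. ennreal (1 / norm (x - y) powr (CARD('n) - \<alpha>)) * ennreal \<bar>f y\<bar> \<partial>lebesgue)" for x
  have [measurable]: "T \<in> borel_measurable lebesgue"
    unfolding T_def by (intro riesz_kernel_measurable) measurable
  have id: "(\<lambda>x :: real ^ 'n. x) \<in> lebesgue \<rightarrow>\<^sub>M borel"
    using measurable_completion[of "\<lambda>x. x" lborel borel] by simp
  note [measurable] = id
  have T: "T x = (\<integral>\<^sup>+y. ennreal (1 / norm (x - y) powr (CARD('n) - \<alpha>)) * ennreal (F y) \<partial>\<mu>0)" for x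
  proof -
    have "(\<integral>\<^sup>+y. ennreal (1 / norm (x - y) powr (CARD('n) - \<alpha>)) * ennreal (F y) \<partial>\<mu>0)
      = (\<integral>\<^sup>+y. \<sigma> y * (ennreal (1 / norm (x - y) powr (CARD('n) - \<alpha>)) * ennreal (F y)) \<partial>lebesgue)"
      unfolding \<mu>0_def by (intro nn_integral_density) measurable
    also have "\<dots> = T x"
      unfolding T_def
    proof (rule nn_integral_cong_AE)
      show "AE y in lebesgue. \<sigma> y * (ennreal (1 / norm (x - y) powr (CARD('n) - \<alpha>)) * ennreal (F y))
        = ennreal (1 / norm (x - y) powr (CARD('n) - \<alpha>)) * ennreal \<bar>f y\<bar>"
        using pos by eventually_elim (simp only: mult.left_commute[of "\<sigma> _"] \<sigma>F)
    qed
    finally show ?thesis by simp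
  qed
  have Xp: "(\<integral>\<^sup>+x. ennreal (F x powr p) \<partial>\<mu>0) \<le> ennreal (X powr p)"
  proof -
    have "(\<integral>\<^sup>+x. ennreal (F x powr p) \<partial>\<mu>0) = (\<integral>\<^sup>+x. \<sigma> x * ennreal (F x powr p) \<partial>lebesgue)"
      unfolding \<mu>0_def by (intro nn_integral_density) measurable
    also have "\<dots> = (\<integral>\<^sup>+x. ennreal (\<bar>f x\<bar> powr p * v x) \<partial>lebesgue)"
    proof (rule nn_integral_cong_AE)
      show "AE x in lebesgue. \<sigma> x * ennreal (F x powr p) = ennreal (\<bar>f x\<bar> powr p * v x)"
        using pos by eventually_elim (rule \<sigma>Fp)
    qed
    finally show ?thesis using X(2) by simp
  qed
  define c where "c = bilinear_const TYPE('n) \<alpha> p q C D C' D'"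
  have c: "c \<ge> 0"
    using \<alpha> powr_mono[of "- \<alpha>" 0 2] by (simp add: c_def bilinear_const_def)
  define B where "B = 2 powr (CARD('n) - \<alpha>) * (c * (3 powr (CARD('n) - \<alpha>) * A) * X)"
  have B: "B \<ge> 0" using c A X by (simp add: B_def)
  have T_le: "(\<integral>\<^sup>+x. epowr (T x) q \<partial>\<nu>0) \<le> ennreal (B powr q)"
  proof (rule nn_integral_powr_duality[where W = "\<lambda>N. ball 0 (real N)"])
    show "T \<in> borel_measurable \<nu>0" by (simp add: \<nu>0_def)
    show "ball 0 (real N) \<in> sets \<nu>0" for N by (simp add: sets_nu)
    show "incseq (\<lambda>N. ball 0 (real N) :: (real ^ 'n) set)"
      by (auto simp: incseq_def intro: order_less_le_trans)
    show "(\<Union>N. ball 0 (real N)) = (UNIV :: (real ^ 'n) set)"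
      using reals_Archimedean2 by (force simp: dist_norm)
    show "emeasure \<nu>0 (ball 0 (real N)) < top" for N
    proof -
      have "emeasure \<nu>0 (ball 0 (real N)) \<le> emeasure \<nu>0 (cball 0 (real N))"
        by (intro emeasure_mono) (auto simp: sets_nu)
      also have "\<dots> = (\<integral>\<^sup>+x\<in>cball 0 (real N). ennreal (u x) \<partial>lebesgue)"
        unfolding \<nu>0_def by (intro emeasure_density) auto
      also have "\<dots> < top"
        using Ainf_loc_integrable[OF u'] by (simp add: loc_integrable_def)
      finally show ?thesis .
    qed
    show "(\<integral>\<^sup>+x. T x * ennreal (h x) \<partial>\<nu>0) \<le> ennreal (B * Y)"
      if h: "h \<in> borel_measurable \<nu>0" "\<And>x. h x \<ge> 0" and Y: "Y > 0"
        "(\<integral>\<^sup>+x. ennreal (h x powr conj_exp q) \<partial>\<nu>0) \<le> ennreal (Y powr conj_exp q)" for h Y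
    proof -
      have "(\<integral>\<^sup>+x. T x * ennreal (h x) \<partial>\<nu>0)
        \<le> ennreal (2 powr (CARD('n) - \<alpha>) * (bilinear_const TYPE('n) \<alpha> p q C D C' D' * (3 powr (CARD('n) - \<alpha>) * A) * X * Y))"
        unfolding T
      proof (rule bilinear_kernel[where f = F and h = h and X = X and Y = Y and A = "3 powr (CARD('n) - \<alpha>) * A"
            and \<mu> = \<mu>0 and \<nu> = \<nu>0])
        show "dyadic_doubling C D \<mu>0" "dyadic_doubling C' D' \<nu>0"
          using \<mu> \<nu> by (simp_all add: \<mu>0_def \<nu>0_def \<sigma>_def)
        show "measure \<mu>0 (dilate 1 i) * measure \<nu>0 (dilate 1 i) * side i powr (\<alpha> - CARD('n))
          \<le> 3 powr (CARD('n) - \<alpha>) * A * (measure \<mu>0 (dilate 1 i) powr (1 / p) * measure \<nu>0 (dilate 1 i) powr (1 / conj_exp q))" for i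
          unfolding \<mu>0_def \<nu>0_def \<sigma>_def by (rule A_const_dilate[OF p u' v' A Th])
        show "h \<in> borel_measurable lebesgue" using h(1) by (simp add: \<nu>0_def)
      qed (use A X Xp h Y F_nonneg CD p \<alpha> in auto)
      then show ?thesis by (simp add: B_def c_def mult_ac)
    qed
  qed (use q B in auto)
  have T_eq: "(\<integral>\<^sup>+x. epowr (T x) q \<partial>\<nu>0) = (\<integral>\<^sup>+x. ennreal (u x) * epowr (T x) q \<partial>lebesgue)"
    unfolding \<nu>0_def by (intro nn_integral_density) measurable
  have "(\<integral>\<^sup>+x. epowr (e2ennreal \<bar>riesz \<alpha> f x\<bar>) q * ennreal (u x) \<partial>lebesgue) \<le> (\<integral>\<^sup>+x. ennreal (u x) * epowr (T x) q \<partial>lebesgue)"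
  proof (intro nn_integral_mono)
    fix x
    have "epowr (e2ennreal \<bar>riesz \<alpha> f x\<bar>) q \<le> epowr (T x) q"
      unfolding T_def using q by (intro epowr_mono riesz_le f) auto
    then show "epowr (e2ennreal \<bar>riesz \<alpha> f x\<bar>) q * ennreal (u x) \<le> ennreal (u x) * epowr (T x) q"
      by (subst mult.commute) (intro mult_left_mono, auto)
  qed
  then have "(\<integral>\<^sup>+x. epowr (e2ennreal \<bar>riesz \<alpha> f x\<bar>) q * ennreal (u x) \<partial>lebesgue) \<le> ennreal (B powr q)"
    using T_le[unfolded T_eq] by (rule order_trans)
  then have "epowr (\<integral>\<^sup>+x. epowr (e2ennreal \<bar>riesz \<alpha> f x\<bar>) q * ennreal (u x) \<partial>lebesgue) (1 / q) \<le> epowr (ennreal (B powr q)) (1 / q)"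
    using q by (intro epowr_mono) auto
  also have "\<dots> = ennreal B"
    using q B by (simp add: epowr_ennreal powr_powr)
  also have "B = 6 powr (CARD('n) - \<alpha>) * c * A * X"
  proof -
    have "(6 :: real) powr (CARD('n) - \<alpha>) = 2 powr (CARD('n) - \<alpha>) * 3 powr (CARD('n) - \<alpha>)"
      by (simp flip: powr_mult)
    then show ?thesis by (simp add: B_def)
  qed
  finally show ?thesis by (simp add: c_def)
qed

text \<open>The dual weight of a finite \<open>v\<close> is never 0, so a vanishing ratio must come
  from \<open>u\<close>. This settles the right side \<open>0 * \<infinity>\<close>, which counts as
  0.\<close>

lemma weak_norm_eq_0:
  fixes u v :: "real ^ 'n \<Rightarrow> real"
  assumes p: "p > 1" "q > 0" and s: "s > 0"
    and [measurable]: "u \<in> borel_measurable lebesgue" "v \<in> borel_measurable lebesgue"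
    and uv: "\<And>x. 0 \<le> u x" "\<And>x. 0 \<le> v x" and 0: "weak_norm s (weight_ratio p q u v) = 0"
  shows "AE x in lebesgue. u x = 0"
proof -
  define w where "w = weight_ratio p q u v"
  have w: "w \<in> borel_measurable lebesgue"
    unfolding w_def by (rule weight_ratio_measurable) measurable
  have "AE x in lebesgue. \<forall>N :: nat. \<not> w x > ennreal (1 / (1 + real N))"
    unfolding AE_all_countable
  proof
    fix N :: nat
    define l where "l = 1 / (1 + real N)"
    have l: "l > 0" by (simp add: l_def)
    have "ennreal l * epowr (emeasure lebesgue {x. w x > ennreal l}) (1 / s) \<le> weak_norm s w"
      unfolding weak_norm_def using l by (intro SUP_upper) auto
    then have "epowr (emeasure lebesgue {x. w x > ennreal l}) (1 / s) = 0"
      using 0 l by (simp add: w_def)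
    then have "emeasure lebesgue {x. w x > ennreal l} = 0"
      using s by (simp add: epowr_eq_0_iff)
    then have "{x. w x > ennreal l} \<in> null_sets lebesgue"
      using superlevel_sets[OF w] by (simp add: null_sets_def)
    then show "AE x in lebesgue. \<not> w x > ennreal (1 / (1 + real N))"
      by (auto simp: l_def dest!: AE_not_in)
  qed
  then show ?thesis
  proof eventually_elim
    case (elim x)
    have "w x \<le> 0"
    proof (rule LIMSEQ_le_const)
      have "(\<lambda>N. 1 / (1 + real N)) \<longlonglongrightarrow> 0"
        using LIMSEQ_inverse_real_of_nat by (simp add: inverse_eq_divide)
      then show "(\<lambda>N. ennreal (1 / (1 + real N))) \<longlonglongrightarrow> 0"
        by (metis tendsto_ennrealI ennreal_0)
      show "\<exists>K. \<forall>N\<ge>K. w x \<le> ennreal (1 / (1 + real N))"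
        using elim by (auto simp: not_less)
    qed
    then have "epowr (ennreal (u x)) (1 / q) * epowr (dual_weight p v x) (1 / conj_exp p) = 0"
      using p uv by (simp add: w_def weight_ratio_eq)
    then show "u x = 0"
      using p conj_exp_pos[of p] dual_weight_pos[of p v x] uv[of x] by (simp add: epowr_eq_0_iff)
  qed
qed

lemma weak_norm_riesz:
  fixes \<alpha> p q :: real
  shows "\<exists>C>0. \<forall>(u :: real ^ 'n \<Rightarrow> real) v.
      1 < p \<and> p \<le> q \<and> 0 < \<alpha> \<and> \<alpha> < real CARD('n) \<and> Theta CARD('n) \<alpha> p q > 0 \<and>
      u \<in> borel_measurable lebesgue \<and> (\<forall>x. 0 \<le> u x) \<and> v \<in> borel_measurable lebesgue \<and> (\<forall>x. 0 \<le> v x) \<and>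
      (\<lambda>x. ennreal (u x)) \<in> Ainf \<and> dual_weight p v \<in> Ainf \<and>
      Ainf_const (\<lambda>x. ennreal (u x)) = a \<and> Ainf_const (dual_weight p v) = b \<and>
      weak_norm (real CARD('n) / Theta CARD('n) \<alpha> p q) (weight_ratio p q u v) < top \<longrightarrow>
        A_const \<alpha> p q u v \<le> ennreal C * weak_norm (real CARD('n) / Theta CARD('n) \<alpha> p q) (weight_ratio p q u v) \<and>
        (\<forall>f\<in>borel_measurable lebesgue.
          epowr (\<integral>\<^sup>+x. epowr (e2ennreal \<bar>riesz \<alpha> f x\<bar>) q * ennreal (u x) \<partial>lebesgue) (1 / q)
            \<le> ennreal C * weak_norm (real CARD('n) / Theta CARD('n) \<alpha> p q) (weight_ratio p q u v)
               * epowr (\<integral>\<^sup>+x. ennreal (\<bar>f x\<bar> powr p * v x) \<partial>lebesgue) (1 / p))"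
proof (cases "1 < p \<and> p \<le> q \<and> 0 < \<alpha> \<and> \<alpha> < real CARD('n) \<and> Theta CARD('n) \<alpha> p q > 0")
  case False
  \<comment> \<open>For inadmissible parameters the claim is vacuous, but a positive constant must
    still exist, as the constant is to be a total function.\<close>
  then show ?thesis by (intro exI[of _ 1]) auto
next
  case True
  then have p: "1 < p" "p \<le> q" and \<alpha>: "0 < \<alpha>" "\<alpha> < real CARD('n)" and Th: "Theta CARD('n) \<alpha> p q > 0"
    by auto
  define s where "s = real CARD('n) / Theta CARD('n) \<alpha> p q"
  have s: "s > 0" using Th by (simp add: s_def)
  obtain C1 where C1: "C1 > 0" and weak: "\<And>(u :: real ^ 'n \<Rightarrow> real) v. u \<in> borel_measurable lebesgue \<Longrightarrow> v \<in> borel_measurable lebesgue \<Longrightarrow>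
     (\<forall>x. 0 \<le> v x) \<Longrightarrow> (\<lambda>x. ennreal (u x)) \<in> Ainf \<Longrightarrow> dual_weight p v \<in> Ainf \<Longrightarrow>
     Ainf_const (\<lambda>x. ennreal (u x)) = a \<Longrightarrow> Ainf_const (dual_weight p v) = b \<Longrightarrow>
     A_const \<alpha> p q u v \<le> ennreal C1 * weak_norm s (weight_ratio p q u v)"
    using A_const_le_weak_norm[of a b, where 'n = 'n] p \<alpha> Th unfolding s_def by blast
  obtain C D where CD: "C > 0" "D > 0"
    and \<mu>: "\<And>w :: real ^ 'n \<Rightarrow> ennreal. w \<in> Ainf \<Longrightarrow> Ainf_const w = b \<Longrightarrow> dyadic_doubling C D (density lebesgue w)"
    using Ainf_dyadic_doubling[of b, where 'n = 'n] by blast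
  obtain C' D' where CD': "C' > 0" "D' > 0"
    and \<nu>: "\<And>w :: real ^ 'n \<Rightarrow> ennreal. w \<in> Ainf \<Longrightarrow> Ainf_const w = a \<Longrightarrow> dyadic_doubling C' D' (density lebesgue w)"
    using Ainf_dyadic_doubling[of a, where 'n = 'n] by blast
  define c where "c = 6 powr (CARD('n) - \<alpha>) * bilinear_const TYPE('n) \<alpha> p q C D C' D'"
  have c: "c \<ge> 0"
    using \<alpha> powr_mono[of "- \<alpha>" 0 2] by (simp add: c_def bilinear_const_def)
  \<comment> \<open>One constant for both claims: \<open>C1\<close> bounds \<open>A_const\<close>,
    and \<open>c\<close> is the further loss in the norm inequality.\<close>
  define C2 where "C2 = max C1 (c * C1)"
  have C2: "C2 > 0" "C1 \<le> C2" "c * C1 \<le> C2" using C1 by (simp_all add: C2_def)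
  have A_le: "A_const \<alpha> p q u v \<le> ennreal C2 * weak_norm s (weight_ratio p q u v)"
    if "u \<in> borel_measurable lebesgue" "v \<in> borel_measurable lebesgue" "\<forall>x. 0 \<le> v x"
      "(\<lambda>x. ennreal (u x)) \<in> Ainf" "dual_weight p v \<in> Ainf"
      "Ainf_const (\<lambda>x. ennreal (u x)) = a" "Ainf_const (dual_weight p v) = b"
    for u v :: "real ^ 'n \<Rightarrow> real"
    using weak[OF that] C2(2) by (rule order_trans[OF _ mult_right_mono[OF ennreal_leI]]) simp
  have bound: "epowr (\<integral>\<^sup>+x. epowr (e2ennreal \<bar>riesz \<alpha> f x\<bar>) q * ennreal (u x) \<partial>lebesgue) (1 / q)
      \<le> ennreal C2 * weak_norm s (weight_ratio p q u v) * epowr (\<integral>\<^sup>+x. ennreal (\<bar>f x\<bar> powr p * v x) \<partial>lebesgue) (1 / p)"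
    if u[measurable]: "u \<in> borel_measurable lebesgue" and v[measurable]: "v \<in> borel_measurable lebesgue"
      and u0: "\<forall>x. 0 \<le> u x" and v0: "\<forall>x. 0 \<le> v x"
      and u': "(\<lambda>x. ennreal (u x)) \<in> Ainf" and v': "dual_weight p v \<in> Ainf"
      and a: "Ainf_const (\<lambda>x. ennreal (u x)) = a" and b: "Ainf_const (dual_weight p v) = b"
      and fin: "weak_norm s (weight_ratio p q u v) < top"
      and f[measurable]: "f \<in> borel_measurable lebesgue"
    for u v f :: "real ^ 'n \<Rightarrow> real"
  proof -
    define L where "L = epowr (\<integral>\<^sup>+x. epowr (e2ennreal \<bar>riesz \<alpha> f x\<bar>) q * ennreal (u x) \<partial>lebesgue) (1 / q)"
    define J where "J = (\<integral>\<^sup>+x. ennreal (\<bar>f x\<bar> powr p * v x) \<partial>lebesgue)"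
    obtain W where W: "weak_norm s (weight_ratio p q u v) = ennreal W" "W \<ge> 0"
      using fin by (cases "weak_norm s (weight_ratio p q u v)") auto
    have A: "A_const \<alpha> p q u v \<le> ennreal (C1 * W)" "C1 * W \<ge> 0"
      using weak[OF u v v0 u' v' a b] C1 W by (simp_all add: ennreal_mult')
    have key: "L \<le> ennreal (c * (C1 * W) * X)" if "X > 0" "J \<le> ennreal (X powr p)" for X
      unfolding L_def c_def
      by (rule two_weight_riesz[OF p \<alpha> Th u v _ u' v' \<mu>[OF v' b] \<nu>[OF u' a] CD CD' A f that[unfolded J_def]])
         (use v0 in auto)
    have "L \<le> ennreal C2 * ennreal W * epowr J (1 / p)"
    proof (cases J)
      case (real j)
      define x0 where "x0 = j powr (1 / p)"
      have x0: "x0 \<ge> 0" "x0 powr p = j"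
        using real p by (simp_all add: x0_def powr_powr)
      \<comment> \<open>\<open>key\<close> asks for a strictly positive bound of the norm; letting
        \<open>X\<close> decrease to \<open>x0\<close> also covers \<open>x0 = 0\<close>.\<close>
      have X: "L \<le> ennreal (c * (C1 * W) * X)" if "X > x0" for X
      proof (rule key)
        have "x0 powr p \<le> X powr p" using that x0 p by (intro powr_mono2) auto
        then show "J \<le> ennreal (X powr p)" using real x0 by (simp add: ennreal_leI)
      qed (use that x0 in auto)
      have "L \<noteq> top" using X[of "x0 + 1"] by (auto simp: top_unique)
      then obtain l where l: "L = ennreal l" "l \<ge> 0" by (cases L) auto
      define k where "k = c * (C1 * W)"
      have k: "k \<ge> 0" using c A(2) by (simp add: k_def)
      have lX: "l \<le> k * X" if "X > x0" for X
        using X[OF that] k x0 that l by (subst (asm) l, subst (asm) ennreal_le_iff) (auto simp: k_def)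
      have "l \<le> k * x0"
      proof (cases "k = 0")
        case True
        then show ?thesis using lX[of "x0 + 1"] by simp
      next
        case False
        then have "k > 0" using k by simp
        have "l / k \<le> x0"
        proof (rule dense_ge)
          fix X assume "x0 < X"
          then show "l / k \<le> X" using lX \<open>k > 0\<close> by (simp add: pos_divide_le_eq mult.commute)
        qed
        then show ?thesis using \<open>k > 0\<close> by (simp add: pos_divide_le_eq mult.commute)
      qed
      also have "k * x0 \<le> C2 * W * x0"
      proof (intro mult_right_mono x0)
        show "k \<le> C2 * W"
          using mult_right_mono[OF C2(3) W(2)] by (simp add: k_def mult.assoc)
      qed
      finally have "L \<le> ennreal (C2 * W * x0)" unfolding l by (rule ennreal_leI)
      also have "\<dots> = ennreal C2 * ennreal W * epowr J (1 / p)"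
        using real p C2(1) W x0 by (simp add: epowr_ennreal x0_def ennreal_mult)
      finally show ?thesis .
    next
      case top
      show ?thesis
      \<comment> \<open>With an infinite norm of \<open>f\<close> the right side is infinite unless
        \<open>W = 0\<close>; then it is 0 and the left side has to vanish.\<close>
      proof (cases "W = 0")
        case True
        have "AE x in lebesgue. u x = 0"
          by (rule weak_norm_eq_0[OF p(1) _ s u v]) (use u0 v0 p W True in auto)
        then have "AE x in lebesgue. epowr (e2ennreal \<bar>riesz \<alpha> f x\<bar>) q * ennreal (u x) = 0"
          by eventually_elim simp
        then have "(\<integral>\<^sup>+x. epowr (e2ennreal \<bar>riesz \<alpha> f x\<bar>) q * ennreal (u x) \<partial>lebesgue) = (\<integral>\<^sup>+x. 0 \<partial>(lebesgue :: (real ^ 'n) measure))"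
          by (rule nn_integral_cong_AE)
        then have "L = 0" using p by (simp add: L_def)
        then show ?thesis by simp
      next
        case False
        then have "ennreal C2 * ennreal W * epowr J (1 / p) = top"
          using top p C2 W by (simp add: ennreal_mult_top ennreal_mult_eq_top_iff)
        then show ?thesis by simp
      qed
    qed
    then show ?thesis by (simp add: L_def J_def W)
  qed
  show ?thesis
    unfolding s_def[symmetric]
    using C2(1) A_le bound by (intro exI[of _ C2]) blast
qed

text \<open>The constants are functions of the data on which they may depend, chosen before the
  weights; the dimension is fixed by the type.\<close>

theorem theorem1p2:
  shows "\<exists>(C2 :: real \<Rightarrow> real \<Rightarrow> real \<Rightarrow> ennreal \<Rightarrow> ennreal \<Rightarrow> real)
          (\<theta> :: real \<Rightarrow> real \<Rightarrow> ennreal \<Rightarrow> ennreal \<Rightarrow> ennreal \<Rightarrow> real).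
    (\<forall>\<alpha> p q a b. C2 \<alpha> p q a b > 0) \<and>
    (\<forall>\<alpha> p a b c. 0 < \<theta> \<alpha> p a b c \<and> \<theta> \<alpha> p a b c < 1) \<and>
    (\<forall>(\<alpha>::real) (p::real) (q::real) (u :: real ^ 'n \<Rightarrow> real) (v :: real ^ 'n \<Rightarrow> real).
      1 < p \<and> p \<le> q \<and> 0 < \<alpha> \<and> \<alpha> < real CARD('n) \<and> Theta CARD('n) \<alpha> p q > 0 \<and>
      u \<in> borel_measurable lebesgue \<and> (\<forall>x. 0 \<le> u x) \<and>
      v \<in> borel_measurable lebesgue \<and> (\<forall>x. 0 \<le> v x) \<and>
      (\<lambda>x. ennreal (u x)) \<in> Ainf \<and> dual_weight p v \<in> Ainf \<longrightarrow>
      (let s = real CARD('n) / Theta CARD('n) \<alpha> p q;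
           w = weight_ratio p q u v;
           a = Ainf_const (\<lambda>x. ennreal (u x));
           b = Ainf_const (dual_weight p v)
       in
        (w \<in> weak_L s \<longrightarrow>
          A_const \<alpha> p q u v < \<infinity> \<and>
          A_const \<alpha> p q u v \<le> ennreal (C2 \<alpha> p q a b) * weak_norm s w \<and>
          (\<forall>f \<in> borel_measurable lebesgue.
            epowr (\<integral>\<^sup>+x. epowr (e2ennreal \<bar>riesz \<alpha> f x\<bar>) q * ennreal (u x) \<partial>lebesgue) (1 / q)
            \<le> ennreal (C2 \<alpha> p q a b) * weak_norm s w
               * epowr (\<integral>\<^sup>+x. ennreal (\<bar>f x\<bar> powr p * v x) \<partial>lebesgue) (1 / p))) \<and>
        (w \<in> Ainf \<longrightarrow>
          (let M = maximal (Theta CARD('n) \<alpha> p q) w;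
               t = \<theta> \<alpha> p a b (Ainf_const w)
           in
            (A_const \<alpha> p q u v < \<infinity> \<longleftrightarrow> M \<in> L_infinity) \<and>
            ennreal t * esssup lebesgue M \<le> A_const \<alpha> p q u v \<and>
            A_const \<alpha> p q u v \<le> ennreal (inverse t) * esssup lebesgue M))))"
proof -
  \<comment> \<open>Naming the property of a constant lets choice turn existence for each tuple of
    data into a function of the data; \<open>R\<close> does the same for
    \<open>\<theta>\<close>.\<close>
  define P where "P \<alpha> p q a b C \<longleftrightarrow> (\<forall>(u :: real ^ 'n \<Rightarrow> real) v.
      1 < p \<and> p \<le> q \<and> 0 < \<alpha> \<and> \<alpha> < real CARD('n) \<and> Theta CARD('n) \<alpha> p q > 0 \<and>
      u \<in> borel_measurable lebesgue \<and> (\<forall>x. 0 \<le> u x) \<and> v \<in> borel_measurable lebesgue \<and> (\<forall>x. 0 \<le> v x) \<and>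
      (\<lambda>x. ennreal (u x)) \<in> Ainf \<and> dual_weight p v \<in> Ainf \<and>
      Ainf_const (\<lambda>x. ennreal (u x)) = a \<and> Ainf_const (dual_weight p v) = b \<and>
      weak_norm (real CARD('n) / Theta CARD('n) \<alpha> p q) (weight_ratio p q u v) < top \<longrightarrow>
        A_const \<alpha> p q u v \<le> ennreal C * weak_norm (real CARD('n) / Theta CARD('n) \<alpha> p q) (weight_ratio p q u v) \<and>
        (\<forall>f\<in>borel_measurable lebesgue.
          epowr (\<integral>\<^sup>+x. epowr (e2ennreal \<bar>riesz \<alpha> f x\<bar>) q * ennreal (u x) \<partial>lebesgue) (1 / q)
            \<le> ennreal C * weak_norm (real CARD('n) / Theta CARD('n) \<alpha> p q) (weight_ratio p q u v)
               * epowr (\<integral>\<^sup>+x. ennreal (\<bar>f x\<bar> powr p * v x) \<partial>lebesgue) (1 / p)))" for \<alpha> p q :: real and a b and C :: real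
  have "\<exists>C>0. P \<alpha> p q a b C" for \<alpha> p q a b
    unfolding P_def by (rule weak_norm_riesz)
  then obtain C2 where C2: "\<And>\<alpha> p q a b. C2 \<alpha> p q a b > 0" and P: "\<And>\<alpha> p q a b. P \<alpha> p q a b (C2 \<alpha> p q a b)"
    by metis
  note weak = P[unfolded P_def]
  define R where "R a b c t \<longleftrightarrow> (\<forall>p q \<alpha> (u :: real ^ 'n \<Rightarrow> real) v. 1 < p \<longrightarrow> p \<le> q \<longrightarrow>
     u \<in> borel_measurable lebesgue \<longrightarrow> v \<in> borel_measurable lebesgue \<longrightarrow>
     (\<forall>x. 0 \<le> v x) \<longrightarrow> (\<lambda>x. ennreal (u x)) \<in> Ainf \<longrightarrow> dual_weight p v \<in> Ainf \<longrightarrow>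
     weight_ratio p q u v \<in> Ainf \<longrightarrow>
     Ainf_const (\<lambda>x. ennreal (u x)) = a \<longrightarrow> Ainf_const (dual_weight p v) = b \<longrightarrow>
     Ainf_const (weight_ratio p q u v) = c \<longrightarrow>
     ennreal t * esssup lebesgue (maximal (Theta CARD('n) \<alpha> p q) (weight_ratio p q u v)) \<le> A_const \<alpha> p q u v \<and>
     A_const \<alpha> p q u v \<le> ennreal (inverse t) * esssup lebesgue (maximal (Theta CARD('n) \<alpha> p q) (weight_ratio p q u v)))" for a b c and t :: real
  have "\<exists>t>0. t < 1 \<and> R a b c t" for a b c
    unfolding R_def by (rule A_const_maximal_equiv)
  then obtain \<theta> where \<theta>: "\<And>a b c. \<theta> a b c > 0" "\<And>a b c. \<theta> a b c < 1" and R: "\<And>a b c. R a b c (\<theta> a b c)"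
    by metis
  note max = R[unfolded R_def, rule_format]
  show ?thesis
  \<comment> \<open>The witness for \<open>\<theta>\<close> is constant in \<open>\<alpha>\<close>
    and \<open>p\<close>. The first three goals are the sign conditions on the constants; the fourth
    is the estimate.\<close>
  proof (intro exI[of _ C2] exI[of _ "\<lambda>_ _. \<theta>"] conjI allI impI, goal_cases)
    case (4 \<alpha> p q u v)
    note H = this
    define s where "s = real CARD('n) / Theta CARD('n) \<alpha> p q"
    define w where "w = weight_ratio p q u v"
    define a where "a = Ainf_const (\<lambda>x. ennreal (u x))"
    define b where "b = Ainf_const (dual_weight p v)"
    define M where "M = maximal (Theta CARD('n) \<alpha> p q) w"
    define t where "t = \<theta> a b (Ainf_const w)"
    have 1: "A_const \<alpha> p q u v < \<infinity> \<and>
          A_const \<alpha> p q u v \<le> ennreal (C2 \<alpha> p q a b) * weak_norm s w \<and>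
          (\<forall>f \<in> borel_measurable lebesgue.
            epowr (\<integral>\<^sup>+x. epowr (e2ennreal \<bar>riesz \<alpha> f x\<bar>) q * ennreal (u x) \<partial>lebesgue) (1 / q)
            \<le> ennreal (C2 \<alpha> p q a b) * weak_norm s w
               * epowr (\<integral>\<^sup>+x. ennreal (\<bar>f x\<bar> powr p * v x) \<partial>lebesgue) (1 / p))"
      if "w \<in> weak_L s"
    proof -
      have fin: "weak_norm s w < top" using that by (simp add: weak_L_def)
      have *: "A_const \<alpha> p q u v \<le> ennreal (C2 \<alpha> p q a b) * weak_norm s w \<and>
          (\<forall>f \<in> borel_measurable lebesgue.
            epowr (\<integral>\<^sup>+x. epowr (e2ennreal \<bar>riesz \<alpha> f x\<bar>) q * ennreal (u x) \<partial>lebesgue) (1 / q)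
            \<le> ennreal (C2 \<alpha> p q a b) * weak_norm s w
               * epowr (\<integral>\<^sup>+x. ennreal (\<bar>f x\<bar> powr p * v x) \<partial>lebesgue) (1 / p))"
        unfolding s_def w_def
        by (rule weak[rule_format]) (use H fin in \<open>simp add: s_def w_def a_def b_def\<close>)
      moreover have "ennreal (C2 \<alpha> p q a b) * weak_norm s w < top"
        using fin by (simp add: ennreal_mult_less_top)
      ultimately show ?thesis by (auto intro: le_less_trans)
    qed
    have 2: "(A_const \<alpha> p q u v < \<infinity> \<longleftrightarrow> M \<in> L_infinity) \<and>
            ennreal t * esssup lebesgue M \<le> A_const \<alpha> p q u v \<and>
            A_const \<alpha> p q u v \<le> ennreal (inverse t) * esssup lebesgue M"
      if w: "w \<in> Ainf"
    proof -
      have t: "t > 0" using \<theta>(1) by (simp add: t_def)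
      have *: "ennreal t * esssup lebesgue M \<le> A_const \<alpha> p q u v"
        "A_const \<alpha> p q u v \<le> ennreal (inverse t) * esssup lebesgue M"
        using max[of p q u v a b "Ainf_const w" \<alpha>] H w by (simp_all add: t_def M_def w_def a_def b_def)
      have M: "M \<in> borel_measurable lebesgue"
        unfolding M_def by (intro maximal_measurable Ainf_loc_integrable w)
      have "esssup lebesgue M < top" if "A_const \<alpha> p q u v < \<infinity>"
      proof -
        have "ennreal t * esssup lebesgue M < top"
          using *(1) that by (simp add: le_less_trans)
        then show ?thesis using t by (auto simp: ennreal_mult_less_top)
      qed
      moreover have "A_const \<alpha> p q u v < \<infinity>" if "esssup lebesgue M < top"
      proof -
        have "ennreal (inverse t) * esssup lebesgue M < top"
          using that by (simp add: ennreal_mult_less_top)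
        with *(2) show ?thesis by (simp add: le_less_trans)
      qed
      ultimately show ?thesis using * M by (auto simp: L_infinity_def)
    qed
    show ?case
      unfolding Let_def
      by (rule conjI; rule impI)
        (rule 1[unfolded s_def w_def a_def b_def], assumption, rule 2[unfolded M_def t_def w_def a_def b_def], assumption)
  qed (use C2 \<theta> in auto)
qed

end
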